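(* Let $d\ge1$ and $1\le k\le n$ be integers, let $\mu$ be the normalized Haar measure on the unitary group $U_n$, and let $u_{ij}:U_n\to\mathbb{C}$ be the $(i,j)$ coordinate function. Suppose that $I=(i_1,\ldots,i_d)$, $J=(j_1,\ldots,j_d)$, $K=(k_1,\ldots,k_d)$, $L=(l_1,\ldots,l_d)$ all lie in $\{1,\dots,k\}^d$. Then $$\int_{U_n}u_{i_1j_1}\cdots u_{i_dj_d}\,\overline{u_{k_1l_1}}\cdots\overline{u_{k_dl_d}}\,d\mu(U)=\sum_{\substack{\lambda\vdash d,\ l(\lambda)\le \min\{k,d\}\\ S,T\in \mathrm{Stab}(\lambda)}}\frac{\langle e_{J,L},E^{\lambda}_{S,T}\rangle\,\langle E^{\lambda}_{S,T},e_{I,K}\rangle}{\|E^{\lambda}_{S,T}\|^2},$$ where $E^{\lambda}_{S,T}=E^{\lambda}_S\,\sigma_{T,S}\,E^{\lambda}_T\in\mathbb{C}_n[S_d]\subset M_n^{\otimes d}$ (with $\sigma_{T,S}\in S_d$ the unique permutation transforming $T$ into $S$) and $e_{I,J}=e_{i_1,j_1}\otimes\cdots\otimes e_{i_d,j_d}$ are the standard matrix units of $M_n^{\otimes d}$. In other words, one need only sum over those $\lambda$ with $l(\lambda)\le k$.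
   Context: A Young diagram $\lambda\vdash d$ is a sequence $\lambda_1\ge\dots\ge\lambda_m>0$ of integers with sum $d$; its length is $l(\lambda)=m$. $\mathrm{Stab}(\lambda)$ is the set of standard fillings (standard Young tableaux) of $\lambda$, i.e. bijective fillings of the boxes by $1,\dots,d$ increasing along rows and columns. For a filling $T$ and $\sigma\in S_d$, $\sigma T$ is the filling obtained by replacing each entry $i$ by $\sigma(i)$. For $T\in\mathrm{Stab}(\lambda)$, $a_i(T)$ is the content (column index minus row index) of the box of $T$ containing $i$. $V_\lambda$ is the complex vector space with orthonormal basis $\{w_T: T\in\mathrm{Stab}(\lambda)\}$, on which $S_d$ acts irreducibly through the Coxeter generators $s_i=(i,i+1)$ as follows. If $s_iT$ is not standard, $s_iw_T=w_T$ when $i,i+1$ lie in the same row of $T$ and $s_iw_T=-w_T$ when they lie in the same column. If $S=s_iT$ is standard, $s_iw_T=\frac1r w_T+\sqrt{1-\frac1{r^2}}\,w_S$ and $s_iw_S=\sqrt{1-\frac1{r^2}}\,w_T-\frac1r w_S$, where $r=a_{i+1}(T)-a_i(T)$. These actions give a $*$-algebra isomorphism $\mathbb{C}[S_d]\cong\bigoplus_{\lambda\vdash d}\mathrm{End}(V_\lambda)$, by which the two sides are identified. $E_T^\lambda\in\mathbb{C}[S_d]$ is the minimal projection corresponding to the operator with $w_T\mapsto w_T$, $w_R\mapsto 0$ for $R\in\mathrm{Stab}(\lambda)$, $R\ne T$, and which is zero on $V_\beta$ for $\beta\neq\lambda$. $S_d$ acts on $(\mathbb{C}^n)^{\otimes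 d}$ by $p_n^d(\sigma)(v_1\otimes\cdots\otimes v_d)=v_{\sigma^{-1}(1)}\otimes\cdots\otimes v_{\sigma^{-1}(d)}$, extended linearly to $p_n^d:\mathbb{C}[S_d]\to\mathrm{End}((\mathbb{C}^n)^{\otimes d})=M_n^{\otimes d}$. The map $p_n^d$ is injective on $\mathbb{C}_n[S_d]:=\bigoplus_{l(\lambda)\le n}\mathrm{End}(V_\lambda)\subset\mathbb{C}[S_d]$, and $\mathbb{C}_n[S_d]$ is viewed inside $M_n^{\otimes d}$ via $p_n^d$. $\langle A,B\rangle=\mathrm{Tr}(AB^* )$ (non-normalized trace) is the Hilbert–Schmidt inner product on $M_n^{\otimes d}$ and $\|\cdot\|$ the associated norm. *)

theory Defs
  imports "HOL-Probability.Probability" "HOL-Combinatorics.Combinatorics"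
begin

definition ctranspose :: "complex^'n^'m \<Rightarrow> complex^'m^'n"
  where "ctranspose A = (\<chi> i j. cnj (A $ j $ i))"

definition unitary_group :: "(complex^'n^'n) set"
  where "unitary_group = {U. U ** ctranspose U = mat 1 \<and> ctranspose U ** U = mat 1}"

text \<open>On a compact metrizable group the left-invariant Borel probability measure is unique, and it
  is automatically regular and right-invariant.\<close>

definition normalized_haar :: "(complex^'n^'n) measure \<Rightarrow> bool"
  where "normalized_haar \<mu> \<longleftrightarrow>
    sets \<mu> = sets (restrict_space borel unitary_group) \<and>
    prob_space \<mu> \<and>
    (\<forall>V\<in>unitary_group. \<forall>A\<in>sets \<mu>. emeasure \<mu> ((\<lambda>U. V ** U) ` A) = emeasure \<mu> A)"

text \<open>A linear operator on the space with orthonormal basis indexed by the finite set \<open>B\<close> is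
  represented by its matrix, a function vanishing outside \<open>B \<times> B\<close>; column \<open>y\<close> of \<open>A\<close>, that is
  \<open>\<lambda>x. A x y\<close>, is the image of the basis vector \<open>y\<close>. This is used both for \<open>End(V\<^sub>\<lambda>)\<close>, with \<open>B\<close> the
  standard tableaux, and for \<open>End((\<complex>\<^sup>n)\<^sup>\<otimes>\<^sup>d)\<close>, with \<open>B\<close> the multi-indices.\<close>

type_synonym 'b op = "'b \<Rightarrow> 'b \<Rightarrow> complex"

definition ops :: "'b set \<Rightarrow> 'b op set"
  where "ops B = {A. \<forall>x y. A x y \<noteq> 0 \<longrightarrow> x \<in> B \<and> y \<in> B}"

definition op_zero :: "'b op"
  where "op_zero = (\<lambda>x y. 0)"

definition op_one :: "'b set \<Rightarrow> 'b op"
  where "op_one B = (\<lambda>x y. if x \<in> B \<and> x = y then 1 else 0)"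

definition op_mult :: "'b set \<Rightarrow> 'b op \<Rightarrow> 'b op \<Rightarrow> 'b op"
  where "op_mult B A C = (\<lambda>x y. \<Sum>z\<in>B. A x z * C z y)"

definition op_adj :: "'b op \<Rightarrow> 'b op"
  where "op_adj A = (\<lambda>x y. cnj (A y x))"

definition op_trace :: "'b set \<Rightarrow> 'b op \<Rightarrow> complex"
  where "op_trace B A = (\<Sum>x\<in>B. A x x)"

definition op_unit :: "'b \<Rightarrow> 'b \<Rightarrow> 'b op"
  where "op_unit a b = (\<lambda>x y. if x = a \<and> y = b then 1 else 0)"

definition hs_inner :: "'b set \<Rightarrow> 'b op \<Rightarrow> 'b op \<Rightarrow> complex"
  where "hs_inner B A C = op_trace B (op_mult B A (op_adj C))"

definition hs_norm :: "'b set \<Rightarrow> 'b op \<Rightarrow> real"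
  where "hs_norm B A = sqrt (Re (hs_inner B A A))"

definition young_diagram :: "nat \<Rightarrow> nat list \<Rightarrow> bool"
  where "young_diagram d lam \<longleftrightarrow> sorted_wrt (\<ge>) lam \<and> (\<forall>m\<in>set lam. m > 0) \<and> sum_list lam = d"

text \<open>A box is a pair (row index, column index), both counted from 0, which does not affect
  contents.\<close>

definition boxes :: "nat list \<Rightarrow> (nat \<times> nat) set"
  where "boxes lam = {(r, c). r < length lam \<and> c < lam ! r}"

type_synonym filling = "nat \<times> nat \<Rightarrow> nat"

definition fillings :: "nat list \<Rightarrow> filling set"
  where "fillings lam = {T \<in> extensional (boxes lam). bij_betw T (boxes lam) {1..sum_list lam}}"

definition Stab :: "nat list \<Rightarrow> filling set"
  where "Stab lam = {T \<in> fillings lam.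
    (\<forall>r c c'. (r, c) \<in> boxes lam \<and> (r, c') \<in> boxes lam \<and> c < c' \<longrightarrow> T (r, c) < T (r, c')) \<and>
    (\<forall>r r' c. (r, c) \<in> boxes lam \<and> (r', c) \<in> boxes lam \<and> r < r' \<longrightarrow> T (r, c) < T (r', c))}"

definition relabel :: "nat list \<Rightarrow> (nat \<Rightarrow> nat) \<Rightarrow> filling \<Rightarrow> filling"
  where "relabel lam \<sigma> T = (\<lambda>b\<in>boxes lam. \<sigma> (T b))"

definition box_of :: "nat list \<Rightarrow> filling \<Rightarrow> nat \<Rightarrow> nat \<times> nat"
  where "box_of lam T i = the_inv_into (boxes lam) T i"

definition tab_content :: "nat list \<Rightarrow> filling \<Rightarrow> nat \<Rightarrow> int"
  where "tab_content lam T i = int (snd (box_of lam T i)) - int (fst (box_of lam T i))"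

definition sigma_tab :: "nat list \<Rightarrow> filling \<Rightarrow> filling \<Rightarrow> nat \<Rightarrow> nat"
  where "sigma_tab lam T S = (THE \<sigma>. \<sigma> permutes {1..sum_list lam} \<and> relabel lam \<sigma> T = S)"

abbreviation coxeter :: "nat \<Rightarrow> nat \<Rightarrow> nat"
  where "coxeter i \<equiv> Transposition.transpose i (Suc i)"

definition axial_dist :: "nat list \<Rightarrow> nat \<Rightarrow> filling \<Rightarrow> real"
  where "axial_dist lam i T = of_int (tab_content lam T (Suc i) - tab_content lam T i)"

text \<open>\<open>young_image lam i T\<close> is the vector \<open>s\<^sub>i w\<^sub>T\<close> of \<open>V\<^sub>\<lambda>\<close>, given by its coordinates. If \<open>s\<^sub>i T\<close> is not
  standard, then \<open>i\<close> and \<open>i + 1\<close> are in the same row or in the same column. If \<open>S = s\<^sub>i T\<close> is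
  standard, the formula for \<open>s\<^sub>i w\<^sub>S\<close> is the one for \<open>s\<^sub>i w\<^sub>T\<close> with \<open>r\<close> replaced by \<open>-r\<close>; see
  \<open>axial_dist_swap\<close> and \<open>young_image_swap\<close> below.\<close>

definition young_image :: "nat list \<Rightarrow> nat \<Rightarrow> filling \<Rightarrow> filling \<Rightarrow> complex"
  where "young_image lam i T =
    (let w = (\<lambda>T' R. if R = T' then 1 else 0);
         S = relabel lam (coxeter i) T;
         r = axial_dist lam i T
     in if S \<in> Stab lam then (\<lambda>R. of_real (1 / r) * w T R + of_real (sqrt (1 - 1 / r\<^sup>2)) * w S R)
        else if fst (box_of lam T i) = fst (box_of lam T (Suc i)) then w T
        else (\<lambda>R. - w T R))"

definition is_young_rep :: "nat \<Rightarrow> nat list \<Rightarrow> ((nat \<Rightarrow> nat) \<Rightarrow> filling op) \<Rightarrow> bool"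
  where "is_young_rep d lam \<rho> \<longleftrightarrow>
    (\<forall>\<sigma>. \<sigma> permutes {1..d} \<longrightarrow> \<rho> \<sigma> \<in> ops (Stab lam)) \<and>
    (\<forall>\<sigma>. \<not> \<sigma> permutes {1..d} \<longrightarrow> \<rho> \<sigma> = op_zero) \<and>
    \<rho> id = op_one (Stab lam) \<and>
    (\<forall>\<sigma> \<tau>. \<sigma> permutes {1..d} \<and> \<tau> permutes {1..d} \<longrightarrow>
      \<rho> (\<sigma> \<circ> \<tau>) = op_mult (Stab lam) (\<rho> \<sigma>) (\<rho> \<tau>)) \<and>
    (\<forall>i\<in>{1..<d}. \<forall>T\<in>Stab lam. (\<lambda>R. \<rho> (coxeter i) R T) = young_image lam i T)"

definition young_rep :: "nat \<Rightarrow> nat list \<Rightarrow> (nat \<Rightarrow> nat) \<Rightarrow> filling op"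
  where "young_rep d lam = (THE \<rho>. is_young_rep d lam \<rho>)"

type_synonym group_alg = "(nat \<Rightarrow> nat) \<Rightarrow> complex"

definition group_algebra :: "nat \<Rightarrow> group_alg set"
  where "group_algebra d = {x. \<forall>\<sigma>. x \<sigma> \<noteq> 0 \<longrightarrow> \<sigma> permutes {1..d}}"

definition ga_of :: "(nat \<Rightarrow> nat) \<Rightarrow> group_alg"
  where "ga_of \<sigma> = (\<lambda>\<tau>. if \<tau> = \<sigma> then 1 else 0)"

definition ga_mult :: "nat \<Rightarrow> group_alg \<Rightarrow> group_alg \<Rightarrow> group_alg"
  where "ga_mult d x y = (\<lambda>\<pi>. \<Sum>\<sigma> | \<sigma> permutes {1..d}. x \<sigma> * y (inv \<sigma> \<circ> \<pi>))"

definition lin_ext :: "nat \<Rightarrow> ((nat \<Rightarrow> nat) \<Rightarrow> 'b op) \<Rightarrow> group_alg \<Rightarrow> 'b op"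
  where "lin_ext d \<rho> x = (\<lambda>a b. \<Sum>\<sigma> | \<sigma> permutes {1..d}. x \<sigma> * \<rho> \<sigma> a b)"

text \<open>The preimage, under the isomorphism of the group algebra with \<open>\<Oplus>\<^sub>\<beta> End(V\<^sub>\<beta>)\<close>, of the projection
  onto the line spanned by \<open>w\<^sub>T\<close> in \<open>V\<^sub>\<lambda>\<close>.\<close>

definition min_proj :: "nat \<Rightarrow> nat list \<Rightarrow> filling \<Rightarrow> group_alg"
  where "min_proj d lam T = (THE x. x \<in> group_algebra d \<and>
    (\<forall>\<beta>. young_diagram d \<beta> \<longrightarrow>
      lin_ext d (young_rep d \<beta>) x = (if \<beta> = lam then op_unit T T else op_zero)))"

definition E_tab :: "nat \<Rightarrow> nat list \<Rightarrow> filling \<Rightarrow> filling \<Rightarrow> group_alg"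
  where "E_tab d lam S T =
    ga_mult d (ga_mult d (min_proj d lam S) (ga_of (sigma_tab lam T S))) (min_proj d lam T)"

definition multi_idx :: "nat \<Rightarrow> nat \<Rightarrow> (nat \<Rightarrow> nat) set"
  where "multi_idx d n = {1..d} \<rightarrow>\<^sub>E {1..n}"

definition tensor_vec :: "nat \<Rightarrow> nat \<Rightarrow> (nat \<Rightarrow> nat \<Rightarrow> complex) \<Rightarrow> (nat \<Rightarrow> nat) \<Rightarrow> complex"
  where "tensor_vec d n v X = (if X \<in> multi_idx d n then \<Prod>r=1..d. v r (X r) else 0)"

definition tensor_op :: "nat \<Rightarrow> nat \<Rightarrow> (nat \<Rightarrow> nat op) \<Rightarrow> (nat \<Rightarrow> nat) op"
  where "tensor_op d n A X Y =
    (if X \<in> multi_idx d n \<and> Y \<in> multi_idx d n then \<Prod>r=1..d. A r (X r) (Y r) else 0)"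

definition mat_unit :: "nat \<Rightarrow> nat \<Rightarrow> (nat \<Rightarrow> nat) \<Rightarrow> (nat \<Rightarrow> nat) \<Rightarrow> (nat \<Rightarrow> nat) op"
  where "mat_unit d n I J = tensor_op d n (\<lambda>r. op_unit (I r) (J r))"

text \<open>The operator sending the basis vector indexed by \<open>X\<close> to the one indexed by \<open>X \<circ> \<sigma>\<^sup>-\<^sup>1\<close>; the
  lemma \<open>perm_op_tensor_vec\<close> below gives its action on arbitrary simple tensors.\<close>

definition perm_op :: "nat \<Rightarrow> nat \<Rightarrow> (nat \<Rightarrow> nat) \<Rightarrow> (nat \<Rightarrow> nat) op"
  where "perm_op d n \<sigma> Y X =
    (if X \<in> multi_idx d n \<and> Y \<in> multi_idx d n \<and> Y = X \<circ> inv \<sigma> then 1 else 0)"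

definition tensor_rep :: "nat \<Rightarrow> nat \<Rightarrow> group_alg \<Rightarrow> (nat \<Rightarrow> nat) op"
  where "tensor_rep d n = lin_ext d (perm_op d n)"

lemma box_of_swap:
  assumes "T \<in> fillings lam" "i \<in> {1..<sum_list lam}"
  shows "box_of lam (relabel lam (coxeter i) T) i = box_of lam T (Suc i)"
    and "box_of lam (relabel lam (coxeter i) T) (Suc i) = box_of lam T i"
proof -
  let ?S = "relabel lam (coxeter i) T"
  have bT: "bij_betw T (boxes lam) {1..sum_list lam}"
    using assms(1) by (simp add: fillings_def)
  have inj: "inj_on T (boxes lam)" and im: "T ` boxes lam = {1..sum_list lam}"
    using bT by (auto simp: bij_betw_def)
  have injS: "inj_on ?S (boxes lam)"
    using inj by (auto simp: inj_on_def relabel_def dest: injD[OF inj_transpose])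
  have *: "box_of lam ?S (coxeter i j) = box_of lam T j" if "j \<in> {1..sum_list lam}" for j
  proof -
    have b: "box_of lam T j \<in> boxes lam" "T (box_of lam T j) = j"
      using that im inj unfolding box_of_def
      by (auto intro: the_inv_into_into f_the_inv_into_f)
    then have "?S (box_of lam T j) = coxeter i j"
      by (simp add: relabel_def)
    then show ?thesis
      using the_inv_into_f_f[OF injS b(1)] unfolding box_of_def by simp
  qed
  show "box_of lam ?S i = box_of lam T (Suc i)"
    using *[of "Suc i"] assms(2) by simp
  show "box_of lam ?S (Suc i) = box_of lam T i"
    using *[of i] assms(2) by simp
qed

lemma axial_dist_swap:
  assumes "T \<in> fillings lam" "i \<in> {1..<sum_list lam}"
  shows "axial_dist lam i (relabel lam (coxeter i) T) = - axial_dist lam i T"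
  using box_of_swap[OF assms] by (simp add: axial_dist_def tab_content_def)

lemma relabel_swap:
  assumes "T \<in> fillings lam"
  shows "relabel lam (coxeter i) (relabel lam (coxeter i) T) = T"
  using assms by (auto simp: relabel_def fillings_def extensional_def fun_eq_iff)

lemma young_image_swap:
  assumes "T \<in> Stab lam" "i \<in> {1..<sum_list lam}"
    and S: "S = relabel lam (coxeter i) T" "S \<in> Stab lam" and r: "r = axial_dist lam i T"
  shows "young_image lam i S =
    (\<lambda>R. of_real (sqrt (1 - 1 / r\<^sup>2)) * (if R = T then 1 else 0) -
      of_real (1 / r) * (if R = S then 1 else 0))"
proof -
  have T: "T \<in> fillings lam" using assms(1) by (simp add: Stab_def)
  have "relabel lam (coxeter i) S = T" "axial_dist lam i S = - r"
    using relabel_swap[OF T] axial_dist_swap[OF T assms(2)] S(1) r by simp_all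
  then show ?thesis
    using assms(1) by (simp add: young_image_def Let_def)
qed

lemma perm_op_tensor_vec:
  assumes \<sigma>: "\<sigma> permutes {1..d}"
  shows "(\<Sum>X\<in>multi_idx d n. perm_op d n \<sigma> Y X * tensor_vec d n v X) =
    tensor_vec d n (\<lambda>r. v (inv \<sigma> r)) Y"
proof (cases "Y \<in> multi_idx d n")
  case False
  then show ?thesis by (simp add: perm_op_def tensor_vec_def)
next
  case True
  have Y\<sigma>: "Y \<circ> \<sigma> \<in> multi_idx d n"
    using True \<sigma> permutes_in_image[OF \<sigma>] permutes_not_in[OF \<sigma>]
    by (auto simp: multi_idx_def PiE_def Pi_def extensional_def)
  have eq: "Y = X \<circ> inv \<sigma> \<longleftrightarrow> X = Y \<circ> \<sigma>" for X
    using permutes_inv_o[OF \<sigma>] by (metis comp_assoc comp_id)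
  have fin: "finite (multi_idx d n)"
    by (simp add: multi_idx_def finite_PiE)
  have "(\<Sum>X\<in>multi_idx d n. perm_op d n \<sigma> Y X * tensor_vec d n v X) =
      (\<Sum>X\<in>multi_idx d n. if X = Y \<circ> \<sigma> then tensor_vec d n v X else 0)"
    using True by (intro sum.cong) (auto simp: perm_op_def eq)
  also have "\<dots> = tensor_vec d n v (Y \<circ> \<sigma>)"
    using fin Y\<sigma> by simp
  also have "\<dots> = (\<Prod>r=1..d. v r (Y (\<sigma> r)))"
    using Y\<sigma> by (simp add: tensor_vec_def)
  also have "\<dots> = (\<Prod>r=1..d. v (inv \<sigma> r) (Y r))"
    using prod.permute[OF \<sigma>, of "\<lambda>r. v (inv \<sigma> r) (Y r)"] permutes_inverses(2)[OF \<sigma>]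
    by (simp add: o_def)
  finally show ?thesis using True by (simp add: tensor_vec_def)
qed

end

theory Submission
  imports Defs "Jordan_Normal_Form.Determinant"
begin

text \<open>The integral is the entry at \<open>(I, K)\<close> of the twirl \<open>M = \<integral> U\<^sup>\<otimes>\<^sup>d e\<^sub>J\<^sub>L (U\<^sup>\<otimes>\<^sup>d)\<^sup>* d\<mu>\<close>.
  By invariance of the measure, \<open>M\<close> commutes with all \<open>V\<^sup>\<otimes>\<^sup>d\<close>, \<open>V\<close> unitary, so by Schur--Weyl duality
  it is in the image \<open>A\<close> of \<open>\<complex>[S\<^sub>d]\<close> in the operators on the tensor space. As conjugation by
  \<open>U\<^sup>\<otimes>\<^sup>d\<close> fixes the elements of \<open>A\<close>, \<open>M\<close> and \<open>e\<^sub>J\<^sub>L\<close> have the same inner products with them: \<open>M\<close> is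
  the orthogonal projection of \<open>e\<^sub>J\<^sub>L\<close> to \<open>A\<close>. The formula is the expansion of this projection
  in the elements \<open>E\<^sub>S\<^sub>,\<^sub>T\<close>, which span \<open>A\<close> and are pairwise orthogonal; a term whose \<open>E\<^sub>S\<^sub>,\<^sub>T\<close> acts by
  zero has the value \<open>0 / 0 = 0\<close>. Entries at indices up to \<open>k\<close> see only the
  action on \<open>(\<complex>\<^sup>k)\<^sup>\<otimes>\<^sup>d\<close>, where diagrams with more than \<open>k\<close> rows act by zero
  (\<open>tensor_unit_long_vanishes\<close>), so that only diagrams with at most \<open>k\<close> rows contribute.

  That \<open>E\<^sub>S\<^sub>,\<^sub>T\<close> has these properties depends on the structure of \<open>\<complex>[S\<^sub>d]\<close>. Young's formulas satisfy the
  Coxeter relations (\<open>young_op_braid\<close>), hence define a representation on each \<open>V\<^sub>\<lambda>\<close>. The Jucys--Murphy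
  elements act diagonally by contents (\<open>jucys_murphy\<close>) and contents determine the tableau
  (\<open>contents_determine_tableau\<close>), so polynomials in these elements give all diagonal matrix units
  of \<open>\<Oplus>\<^sub>\<lambda> End(V\<^sub>\<lambda>)\<close>. The coefficient of \<open>w\<^sub>S\<close> in \<open>\<sigma>\<^sub>T\<^sub>,\<^sub>S w\<^sub>T\<close> is nonzero (\<open>rho_relabel_nonzero\<close>);
  therefore \<open>E\<^sub>S\<^sub>,\<^sub>T\<close> is a nonzero multiple of the matrix unit with row \<open>S\<close> and column \<open>T\<close>
  (\<open>E_tab_eq_matrix_unit\<close>), and the
  map from \<open>\<complex>[S\<^sub>d]\<close> to \<open>\<Oplus>\<^sub>\<lambda> End(V\<^sub>\<lambda>)\<close> is onto. It is injective because both sides have dimension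
  \<open>d!\<close> (\<open>sum_squares_Stab\<close>).

  For the duality, let \<open>M\<close> commute with all \<open>V\<^sup>\<otimes>\<^sup>d\<close>. Differentiating along curves of unitaries shows
  that \<open>M\<close> commutes with the Lie algebra action of every matrix (\<open>commutes_lie_op\<close>), hence with all
  symmetrized tensor products of matrices (\<open>commutes_sym_op\<close>), which span the operators
  commuting with \<open>S\<^sub>d\<close>. The matrix units of \<open>A\<close> then exhibit \<open>M\<close> as an element of \<open>A\<close>
  (\<open>bicommutant\<close>).\<close>

(* In this theory the symbols denote components of fixed-size vectors and inverse functions. *)
no_notation vec_index (infixl "$" 100)
unbundle no m_inv_syntax

section \<open>Adjacent transpositions generate the symmetric group\<close>

definition inversions :: "nat \<Rightarrow> (nat \<Rightarrow> nat) \<Rightarrow> (nat \<times> nat) set"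
  where "inversions d \<sigma> = {(a, b). 1 \<le> a \<and> a < b \<and> b \<le> d \<and> \<sigma> b < \<sigma> a}"

lemma finite_inversions: "finite (inversions d \<sigma>)"
  by (rule finite_subset[of _ "{1..d} \<times> {1..d}"]) (auto simp: inversions_def)

lemma coxeter_permutes: "i \<in> {1..<d} \<Longrightarrow> coxeter i permutes {1..d}"
  by (rule permutes_swap_id) auto

lemma permutes_o_coxeter:
  "\<sigma> permutes {1..d} \<Longrightarrow> i \<in> {1..<d} \<Longrightarrow> \<sigma> \<circ> coxeter i permutes {1..d}"
  by (rule permutes_compose[OF coxeter_permutes])

lemma o_coxeter_o_coxeter: "\<sigma> \<circ> coxeter i \<circ> coxeter i = \<sigma>"
  by (simp add: fun_eq_iff)

text \<open>Swapping the positions \<open>i\<close> and \<open>i + 1\<close> in all pairs matches the old inversions with the new ones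
  other than \<open>(i, i + 1)\<close> itself.\<close>

lemma card_inversions_ascent:
  assumes "\<sigma> permutes {1..d}" "i \<in> {1..<d}" "\<sigma> i < \<sigma> (Suc i)"
  shows "card (inversions d (\<sigma> \<circ> coxeter i)) = Suc (card (inversions d \<sigma>))"
proof -
  let ?s = "coxeter i"
  let ?f = "map_prod ?s ?s"
  have s: "?s j = (if j = i then Suc i else if j = Suc i then i else j)" for j
    by (simp add: Transposition.transpose_def)
  have "inversions d (\<sigma> \<circ> ?s) = insert (i, Suc i) (?f ` inversions d \<sigma>)"
  proof (intro equalityI subsetI)
    fix p assume p: "p \<in> inversions d (\<sigma> \<circ> ?s)"
    show "p \<in> insert (i, Suc i) (?f ` inversions d \<sigma>)"
    proof (cases "p = (i, Suc i)")
      case False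
      obtain a b where ab: "p = (a, b)" by force
      have "?f p \<in> inversions d \<sigma>"
        using p False assms(2) by (auto simp: ab inversions_def s split: if_splits)
      moreover have "p = ?f (?f p)" by (simp add: ab)
      ultimately show ?thesis by blast
    qed simp
  next
    fix p assume "p \<in> insert (i, Suc i) (?f ` inversions d \<sigma>)"
    then show "p \<in> inversions d (\<sigma> \<circ> ?s)"
      using assms(2,3) by (auto simp: inversions_def s split: if_splits)
  qed
  moreover have "(i, Suc i) \<notin> ?f ` inversions d \<sigma>"
    by (auto simp: inversions_def s split: if_splits)
  moreover have "inj_on ?f (inversions d \<sigma>)"
    by (auto simp: inj_on_def dest: injD[OF inj_transpose])
  ultimately show ?thesis
    by (simp add: finite_inversions card_image)
qed

lemma permutes_eq_iff: "\<sigma> permutes S \<Longrightarrow> \<sigma> a = \<sigma> b \<longleftrightarrow> a = b"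
  by (meson injD permutes_inj)

lemma card_inversions_descent:
  assumes "\<sigma> permutes {1..d}" "i \<in> {1..<d}" "\<sigma> (Suc i) < \<sigma> i"
  shows "card (inversions d \<sigma>) = Suc (card (inversions d (\<sigma> \<circ> coxeter i)))"
  using card_inversions_ascent[OF permutes_o_coxeter[OF assms(1,2)] assms(2)] assms(3)
  by (simp add: o_coxeter_o_coxeter)

lemma card_inversions_o_coxeter_le:
  assumes "\<sigma> permutes {1..d}" "i \<in> {1..<d}"
  shows "card (inversions d (\<sigma> \<circ> coxeter i)) \<le> Suc (card (inversions d \<sigma>))"
  using card_inversions_ascent[OF assms] card_inversions_descent[OF assms]
    permutes_eq_iff[OF assms(1), of i "Suc i"] by (cases "\<sigma> i" "\<sigma> (Suc i)" rule: linorder_cases) auto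

lemma no_descent_imp_id:
  assumes \<sigma>: "\<sigma> permutes {1..d}" and asc: "\<And>i. i \<in> {1..<d} \<Longrightarrow> \<not> \<sigma> (Suc i) < \<sigma> i"
  shows "\<sigma> = id"
proof -
  have step: "\<sigma> i < \<sigma> (Suc i)" if "i \<in> {1..<d}" for i
    using asc[OF that] permutes_eq_iff[OF \<sigma>, of i "Suc i"] by simp
  have ge: "i \<le> d \<longrightarrow> i \<le> \<sigma> i" for i
  proof (induction i)
    case (Suc i)
    show ?case
    proof
      assume le: "Suc i \<le> d"
      show "Suc i \<le> \<sigma> (Suc i)"
      proof (cases "i = 0")
        case True
        then show ?thesis using le permutes_in_image[OF \<sigma>, of 1] by simp
      next
        case False
        then show ?thesis using Suc step[of i] le by simp
      qed
    qed
  qed simp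
  have "\<sigma> i = i" if "i \<in> {1..d}" for i
  proof (rule permutes_natset_ge[THEN fun_cong, of \<sigma> "{1..d}" i, simplified])
    show "\<sigma> permutes {Suc 0..d}" using \<sigma> by simp
  qed (use ge in auto)
  then show ?thesis using permutes_not_in[OF \<sigma>] by (auto simp: fun_eq_iff)
qed

text \<open>Removing a descent removes exactly one inversion, so sorting writes every permutation as a reduced
  word. The induction thus passes along ascents only.\<close>

lemma permutes_coxeter_induct [consumes 1, case_names id coxeter]:
  assumes "\<sigma> permutes {1..d}" and "P id"
    and "\<And>\<sigma> i. \<sigma> permutes {1..d} \<Longrightarrow> i \<in> {1..<d} \<Longrightarrow> \<sigma> i < \<sigma> (Suc i) \<Longrightarrow> P \<sigma> \<Longrightarrow> P (\<sigma> \<circ> coxeter i)"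
  shows "P \<sigma>"
  using assms(1)
proof (induction "card (inversions d \<sigma>)" arbitrary: \<sigma> rule: less_induct)
  case less
  show ?case
  proof (cases "\<exists>i\<in>{1..<d}. \<sigma> (Suc i) < \<sigma> i")
    case True
    then obtain i where i: "i \<in> {1..<d}" "\<sigma> (Suc i) < \<sigma> i" by blast
    let ?\<tau> = "\<sigma> \<circ> coxeter i"
    have "P ?\<tau>"
      using less card_inversions_descent[OF less.prems i] permutes_o_coxeter i by simp
    then have "P (?\<tau> \<circ> coxeter i)"
      using assms(3)[of ?\<tau> i] i permutes_o_coxeter[OF less.prems i(1)] by simp
    then show ?thesis by (simp add: o_coxeter_o_coxeter)
  next
    case False
    then show ?thesis using no_descent_imp_id[OF less.prems] assms(2) by blast
  qed
qed

section \<open>The Coxeter presentation\<close>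

text \<open>The product of the generators along a reduced word of \<open>\<sigma>\<close>; the descent that is split off is
  arbitrary, and \<open>coxeter_ext_descent\<close> shows that its choice is irrelevant.\<close>

function coxeter_ext :: "nat \<Rightarrow> (nat \<Rightarrow> 'v \<Rightarrow> 'v) \<Rightarrow> (nat \<Rightarrow> nat) \<Rightarrow> 'v \<Rightarrow> 'v" where
  "coxeter_ext d a \<sigma> =
    (if \<sigma> permutes {1..d} \<and> (\<exists>i. i \<in> {1..<d} \<and> \<sigma> (Suc i) < \<sigma> i)
     then let i = (SOME i. i \<in> {1..<d} \<and> \<sigma> (Suc i) < \<sigma> i)
       in coxeter_ext d a (\<sigma> \<circ> coxeter i) \<circ> a i
     else id)"
  by auto
termination
proof (relation "Wellfounded.measure (\<lambda>(d, a, \<sigma>). card (inversions d \<sigma>))")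
  fix d and a :: "nat \<Rightarrow> 'v \<Rightarrow> 'v" and \<sigma> :: "nat \<Rightarrow> nat" and i
  assume *: "\<sigma> permutes {1..d} \<and> (\<exists>i. i \<in> {1..<d} \<and> \<sigma> (Suc i) < \<sigma> i)"
    and i: "i = (SOME i. i \<in> {1..<d} \<and> \<sigma> (Suc i) < \<sigma> i)"
  have "i \<in> {1..<d} \<and> \<sigma> (Suc i) < \<sigma> i"
    unfolding i by (rule someI_ex) (use * in blast)
  then show "((d, a, \<sigma> \<circ> coxeter i), d, a, \<sigma>) \<in> Wellfounded.measure (\<lambda>(d, a, \<sigma>). card (inversions d \<sigma>))"
    using card_inversions_descent[of \<sigma> d i] * by simp
qed simp

declare coxeter_ext.simps [simp del]

text \<open>The generators are maps, and composition is the product. Equality of maps on a whole type avoids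
  carrying a closure condition through the arguments.\<close>

locale coxeter_action =
  fixes d :: nat and a :: "nat \<Rightarrow> 'v \<Rightarrow> 'v"
  assumes square: "i \<in> {1..<d} \<Longrightarrow> a i \<circ> a i = id"
    and far: "i \<in> {1..<d} \<Longrightarrow> j \<in> {1..<d} \<Longrightarrow> Suc i < j \<Longrightarrow> a i \<circ> a j = a j \<circ> a i"
    and braid: "i \<in> {1..<d} \<Longrightarrow> Suc i \<in> {1..<d} \<Longrightarrow> a i \<circ> a (Suc i) \<circ> a i = a (Suc i) \<circ> a i \<circ> a (Suc i)"
begin

abbreviation "F \<equiv> coxeter_ext d a"

text \<open>Two descents \<open>i\<close>, \<open>j\<close> of \<open>\<sigma>\<close> give the same value by induction on the number of inversions. If they
  are far apart, both can be split off, in either order. If they are neighbours, \<open>\<sigma>\<close> reverses three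
  consecutive positions, and the words \<open>s\<^sub>i s\<^sub>j s\<^sub>i\<close> and \<open>s\<^sub>j s\<^sub>i s\<^sub>j\<close> can be split off.\<close>

lemma coxeter_ext_descent:
  assumes "\<sigma> permutes {1..d}" "j \<in> {1..<d}" "\<sigma> (Suc j) < \<sigma> j"
  shows "F \<sigma> = F (\<sigma> \<circ> coxeter j) \<circ> a j"
  using assms
proof (induction "card (inversions d \<sigma>)" arbitrary: \<sigma> j rule: less_induct)
  case less
  note \<sigma> = less.prems(1) and j = less.prems(2,3)
  define i where "i = (SOME i. i \<in> {1..<d} \<and> \<sigma> (Suc i) < \<sigma> i)"
  have i: "i \<in> {1..<d}" "\<sigma> (Suc i) < \<sigma> i"
    using someI[of "\<lambda>i. i \<in> {1..<d} \<and> \<sigma> (Suc i) < \<sigma> i" j] j unfolding i_def by auto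
  have Fi: "F \<sigma> = F (\<sigma> \<circ> coxeter i) \<circ> a i"
    using \<sigma> j by (subst coxeter_ext.simps) (auto simp: i_def Let_def)
  have IH: "F \<tau> = F (\<tau> \<circ> coxeter k) \<circ> a k"
    if "\<tau> permutes {1..d}" "card (inversions d \<tau>) < card (inversions d \<sigma>)"
      "k \<in> {1..<d}" "\<tau> (Suc k) < \<tau> k" for \<tau> k
    using less.hyps that by blast
  have smaller: "\<tau> \<circ> coxeter k permutes {1..d}"
    "card (inversions d (\<tau> \<circ> coxeter k)) < card (inversions d \<tau>)"
    if "\<tau> permutes {1..d}" "k \<in> {1..<d}" "\<tau> (Suc k) < \<tau> k" for \<tau> k
    using that permutes_o_coxeter card_inversions_descent by fastforce+
  have far': "F (\<sigma> \<circ> coxeter p) \<circ> a p = F (\<sigma> \<circ> coxeter q) \<circ> a q"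
    if p: "p \<in> {1..<d}" "\<sigma> (Suc p) < \<sigma> p" and q: "q \<in> {1..<d}" "\<sigma> (Suc q) < \<sigma> q"
      and pq: "Suc p < q" for p q
  proof -
    have c: "\<sigma> \<circ> coxeter p \<circ> coxeter q = \<sigma> \<circ> coxeter q \<circ> coxeter p"
    proof -
      have "coxeter p \<circ> coxeter q = coxeter q \<circ> coxeter p"
        using pq by (auto simp: fun_eq_iff Transposition.transpose_def)
      then show ?thesis by (simp only: comp_assoc)
    qed
    have "F (\<sigma> \<circ> coxeter p) = F (\<sigma> \<circ> coxeter p \<circ> coxeter q) \<circ> a q"
      using smaller[OF \<sigma> p] q pq by (intro IH) (auto simp: Transposition.transpose_def)
    moreover have "F (\<sigma> \<circ> coxeter q) = F (\<sigma> \<circ> coxeter q \<circ> coxeter p) \<circ> a p"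
      using smaller[OF \<sigma> q] p pq by (intro IH) (auto simp: Transposition.transpose_def)
    ultimately show ?thesis
      using far[OF p(1) q(1) pq] c by (simp only: comp_assoc)
  qed
  have near: "F (\<sigma> \<circ> coxeter p) \<circ> a p = F (\<sigma> \<circ> coxeter (Suc p)) \<circ> a (Suc p)"
    if p: "p \<in> {1..<d}" "\<sigma> (Suc p) < \<sigma> p"
      and q: "Suc p \<in> {1..<d}" "\<sigma> (Suc (Suc p)) < \<sigma> (Suc p)" for p
  proof -
    let ?s = "coxeter p" and ?t = "coxeter (Suc p)"
    have c: "\<sigma> \<circ> ?s \<circ> ?t \<circ> ?s = \<sigma> \<circ> ?t \<circ> ?s \<circ> ?t"
      by (auto simp: fun_eq_iff Transposition.transpose_def)
    have d1: "(\<sigma> \<circ> ?s) (Suc (Suc p)) < (\<sigma> \<circ> ?s) (Suc p)" "(\<sigma> \<circ> ?t) (Suc p) < (\<sigma> \<circ> ?t) p"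
      "(\<sigma> \<circ> ?s \<circ> ?t) (Suc p) < (\<sigma> \<circ> ?s \<circ> ?t) p" "(\<sigma> \<circ> ?t \<circ> ?s) (Suc (Suc p)) < (\<sigma> \<circ> ?t \<circ> ?s) (Suc p)"
      using p q by (auto simp: Transposition.transpose_def)
    have "F (\<sigma> \<circ> ?s) = F (\<sigma> \<circ> ?s \<circ> ?t) \<circ> a (Suc p)"
      using smaller[OF \<sigma> p] q(1) d1 by (intro IH) auto
    also have "F (\<sigma> \<circ> ?s \<circ> ?t) = F (\<sigma> \<circ> ?s \<circ> ?t \<circ> ?s) \<circ> a p"
      by (rule IH[OF smaller(1)[OF smaller(1)[OF \<sigma> p] q(1) d1(1)]
            less_trans[OF smaller(2)[OF smaller(1)[OF \<sigma> p] q(1) d1(1)] smaller(2)[OF \<sigma> p]] p(1) d1(3)])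
    finally have 1: "F (\<sigma> \<circ> ?s) \<circ> a p = F (\<sigma> \<circ> ?s \<circ> ?t \<circ> ?s) \<circ> (a p \<circ> a (Suc p) \<circ> a p)"
      by (simp only: comp_assoc)
    have "F (\<sigma> \<circ> ?t) = F (\<sigma> \<circ> ?t \<circ> ?s) \<circ> a p"
      using smaller[OF \<sigma> q] p(1) d1 by (intro IH) auto
    also have "F (\<sigma> \<circ> ?t \<circ> ?s) = F (\<sigma> \<circ> ?t \<circ> ?s \<circ> ?t) \<circ> a (Suc p)"
      by (rule IH[OF smaller(1)[OF smaller(1)[OF \<sigma> q] p(1) d1(2)]
            less_trans[OF smaller(2)[OF smaller(1)[OF \<sigma> q] p(1) d1(2)] smaller(2)[OF \<sigma> q]] q(1) d1(4)])
    finally have 2: "F (\<sigma> \<circ> ?t) \<circ> a (Suc p) =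
        F (\<sigma> \<circ> ?t \<circ> ?s \<circ> ?t) \<circ> (a (Suc p) \<circ> a p \<circ> a (Suc p))"
      by (simp only: comp_assoc)
    show ?thesis
      by (simp only: 1 2 c braid[OF p(1) q(1)])
  qed
  consider "i = j" | "Suc i < j" | "Suc j < i" | "j = Suc i" | "i = Suc j" by linarith
  then show ?case
  proof cases
    case 1
    then show ?thesis using Fi by simp
  next
    case 2
    show ?thesis unfolding Fi by (rule far'[OF i j 2])
  next
    case 3
    show ?thesis unfolding Fi by (rule far'[OF j i 3, symmetric])
  next
    case 4
    show ?thesis unfolding Fi 4 by (rule near[OF i j[unfolded 4]])
  next
    case 5
    show ?thesis using near[OF j] i Fi 5 by simp
  qed
qed

lemma coxeter_ext_id: "F id = id"
  by (subst coxeter_ext.simps) auto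

lemma coxeter_ext_o_coxeter:
  assumes "\<sigma> permutes {1..d}" "i \<in> {1..<d}"
  shows "F (\<sigma> \<circ> coxeter i) = F \<sigma> \<circ> a i"
proof (cases "\<sigma> (Suc i) < \<sigma> i")
  case True
  then show ?thesis
    using coxeter_ext_descent[OF assms] square[OF assms(2)] by (simp only: comp_assoc comp_id)
next
  case False
  then have "\<sigma> i < \<sigma> (Suc i)" using permutes_eq_iff[OF assms(1), of i "Suc i"] by simp
  then show ?thesis
    using coxeter_ext_descent[OF permutes_o_coxeter[OF assms] assms(2)]
    by (simp add: o_coxeter_o_coxeter)
qed

lemma coxeter_ext_comp:
  assumes "\<sigma> permutes {1..d}" "\<tau> permutes {1..d}"
  shows "F (\<sigma> \<circ> \<tau>) = F \<sigma> \<circ> F \<tau>"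
  using assms(2)
proof (induction rule: permutes_coxeter_induct)
  case id
  then show ?case by (simp only: coxeter_ext_id comp_id)
next
  case (coxeter \<tau> i)
  show ?case
    using coxeter_ext_o_coxeter[OF permutes_compose[OF coxeter(1) assms(1)] coxeter(2)]
      coxeter_ext_o_coxeter[OF coxeter(1,2)] coxeter(4)
    by (simp only: comp_assoc)
qed

lemma coxeter_ext_coxeter: "i \<in> {1..<d} \<Longrightarrow> F (coxeter i) = a i"
  using coxeter_ext_o_coxeter[of id i] by (simp add: coxeter_ext_id permutes_id)

end

section \<open>Standard tableaux\<close>

locale young =
  fixes d :: nat and lam :: "nat list"
  assumes young_diagram: "young_diagram d lam"
begin

lemma sum_lam: "sum_list lam = d"
  using young_diagram by (simp add: young_diagram_def)

lemma boxes_down_closed: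
  assumes "(r', c') \<in> boxes lam" "r \<le> r'" "c \<le> c'"
  shows "(r, c) \<in> boxes lam"
proof -
  have "lam ! r' \<le> lam ! r"
    using assms young_diagram
    by (cases "r = r'") (auto simp: young_diagram_def boxes_def sorted_wrt_iff_nth_less)
  then show ?thesis using assms by (auto simp: boxes_def)
qed

lemma boxes_Sigma: "boxes lam = Sigma {..<length lam} (\<lambda>r. {..<lam ! r})"
  by (auto simp: boxes_def)

lemma finite_boxes: "finite (boxes lam)"
  by (simp add: boxes_Sigma)

lemma card_boxes: "card (boxes lam) = d"
  using sum_lam by (simp add: boxes_Sigma sum_list_sum_nth lessThan_atLeast0)

lemma finite_fillings: "finite (fillings lam)"
proof (rule finite_subset)
  show "fillings lam \<subseteq> boxes lam \<rightarrow>\<^sub>E {1..d}"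
    by (auto simp: fillings_def bij_betw_def sum_lam PiE_def)
  show "finite (boxes lam \<rightarrow>\<^sub>E {1..d})"
    by (intro finite_PiE finite_boxes) simp
qed

lemma Stab_fillings: "T \<in> Stab lam \<Longrightarrow> T \<in> fillings lam"
  by (simp add: Stab_def)

lemma finite_Stab: "finite (Stab lam)"
  using finite_fillings by (rule finite_subset[rotated]) (auto simp: Stab_def)

lemma box_of:
  assumes "T \<in> fillings lam" "i \<in> {1..d}"
  shows "box_of lam T i \<in> boxes lam" "T (box_of lam T i) = i"
proof -
  have "inj_on T (boxes lam)" "T ` boxes lam = {1..d}"
    using assms by (auto simp: fillings_def bij_betw_def sum_lam)
  then show "box_of lam T i \<in> boxes lam" "T (box_of lam T i) = i"
    using assms(2) unfolding box_of_def
    by (auto intro: the_inv_into_into f_the_inv_into_f)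
qed

lemma filling_range: "T \<in> fillings lam \<Longrightarrow> b \<in> boxes lam \<Longrightarrow> T b \<in> {1..d}"
  by (auto simp: fillings_def bij_betw_def sum_lam)

lemma filling_inj: "T \<in> fillings lam \<Longrightarrow> inj_on T (boxes lam)"
  by (simp add: fillings_def bij_betw_def)

lemma box_of_entry: "T \<in> fillings lam \<Longrightarrow> b \<in> boxes lam \<Longrightarrow> box_of lam T (T b) = b"
  unfolding box_of_def by (rule the_inv_into_f_f[OF filling_inj])

lemma relabel_fillings:
  assumes "T \<in> fillings lam" "\<sigma> permutes {1..d}"
  shows "relabel lam \<sigma> T \<in> fillings lam"
proof -
  have "bij_betw (\<sigma> \<circ> T) (boxes lam) {1..d}"
    using assms by (intro bij_betw_trans[OF _ permutes_imp_bij]) (auto simp: fillings_def sum_lam)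
  then have "bij_betw (relabel lam \<sigma> T) (boxes lam) {1..d}"
    by (rule bij_betw_cong[THEN iffD1, rotated]) (simp add: relabel_def)
  then show ?thesis by (simp add: fillings_def relabel_def sum_lam)
qed

lemma relabel_comp:
  "relabel lam \<sigma> (relabel lam \<tau> T) = relabel lam (\<sigma> \<circ> \<tau>) T"
  by (auto simp: relabel_def fun_eq_iff)

lemma relabel_id: "T \<in> fillings lam \<Longrightarrow> relabel lam id T = T"
  by (auto simp: relabel_def fillings_def extensional_def fun_eq_iff)

lemma relabel_inject:
  assumes "T \<in> fillings lam" "\<sigma> permutes {1..d}" "\<tau> permutes {1..d}"
    and "relabel lam \<sigma> T = relabel lam \<tau> T"
  shows "\<sigma> = \<tau>"
proof
  fix i
  show "\<sigma> i = \<tau> i"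
  proof (cases "i \<in> {1..d}")
    case True
    then show ?thesis
      using fun_cong[OF assms(4), of "box_of lam T i"] box_of[OF assms(1)] by (simp add: relabel_def)
  next
    case False
    then show ?thesis using assms(2,3) by (simp add: permutes_not_in)
  qed
qed

lemma box_of_relabel:
  assumes "T \<in> fillings lam" "\<sigma> permutes {1..d}" "j \<in> {1..d}"
  shows "box_of lam (relabel lam \<sigma> T) j = box_of lam T (inv \<sigma> j)"
proof -
  let ?b = "box_of lam T (inv \<sigma> j)"
  have b: "?b \<in> boxes lam" "T ?b = inv \<sigma> j"
    using box_of[OF assms(1)] permutes_in_image[OF permutes_inv[OF assms(2)]] assms(3) by auto
  then have "relabel lam \<sigma> T ?b = j"
    using permutes_inverses(1)[OF assms(2)] by (simp add: relabel_def)
  then show ?thesis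
    using box_of_entry[OF relabel_fillings[OF assms(1,2)] b(1)] by simp
qed

lemma content_coxeter:
  assumes "T \<in> fillings lam" "i \<in> {1..<d}" "j \<in> {1..d}"
  shows "tab_content lam (relabel lam (coxeter i) T) j = tab_content lam T (coxeter i j)"
  using box_of_relabel[OF assms(1) coxeter_permutes[OF assms(2)] assms(3)]
  by (simp add: tab_content_def inv_transpose_eq)

lemma Stab_mono:
  assumes T: "T \<in> Stab lam" and b: "(r, c) \<in> boxes lam" "(r', c') \<in> boxes lam"
    and le: "r \<le> r'" "c \<le> c'" "(r, c) \<noteq> (r', c')"
  shows "T (r, c) < T (r', c')"
proof -
  have row: "T (x, y) < T (x, y')" if "(x, y) \<in> boxes lam" "(x, y') \<in> boxes lam" "y < y'" for x y y'
    using T that unfolding Stab_def by blast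
  have col: "T (x, y) < T (x', y)" if "(x, y) \<in> boxes lam" "(x', y) \<in> boxes lam" "x < x'" for x x' y
    using T that unfolding Stab_def by blast
  have corner: "(r, c') \<in> boxes lam" using boxes_down_closed[OF b(2)] le by simp
  show ?thesis
  proof (cases "r = r'")
    case True
    then show ?thesis using row[OF b(1) corner] le by simp
  next
    case False
    then have "T (r, c') < T (r', c')" using col[OF corner b(2)] le by simp
    moreover have "T (r, c) \<le> T (r, c')" using row[OF b(1) corner] le by (cases "c = c'") auto
    ultimately show ?thesis by simp
  qed
qed

text \<open>The boxes to the right of and below the first box both have entries strictly between \<open>i\<close> and \<open>j\<close>.
  In particular the contents of three consecutive entries are distinct, so that no denominator in
  Young's formulas vanishes.\<close>

lemma same_diagonal_far:
  assumes T: "T \<in> Stab lam" and ij: "i \<in> {1..d}" "j \<in> {1..d}" "i < j"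
    and ct: "tab_content lam T i = tab_content lam T j"
  shows "i + 3 \<le> j"
proof -
  note Tf = Stab_fillings[OF T]
  obtain r c where rc: "box_of lam T i = (r, c)" by force
  obtain r' c' where rc': "box_of lam T j = (r', c')" by force
  have b: "(r, c) \<in> boxes lam" "T (r, c) = i" "(r', c') \<in> boxes lam" "T (r', c') = j"
    using box_of[OF Tf] ij rc rc' by metis+
  have eq: "int c - int r = int c' - int r'"
    using ct rc rc' by (simp add: tab_content_def)
  have "\<not> r' \<le> r"
  proof
    assume "r' \<le> r"
    then have "c' \<le> c" using eq by linarith
    then show False
      using Stab_mono[OF T b(3,1) \<open>r' \<le> r\<close>] b ij(3) by (cases "(r', c') = (r, c)") auto
  qed
  then have lt: "r < r'" "c < c'" using eq by auto
  have b2: "(r, Suc c) \<in> boxes lam" "(Suc r, c) \<in> boxes lam"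
    using boxes_down_closed[OF b(3)] lt by auto
  have "i < T (r, Suc c)" "i < T (Suc r, c)" "T (r, Suc c) < j" "T (Suc r, c) < j"
    using Stab_mono[OF T b(1) b2(1)] Stab_mono[OF T b(1) b2(2)]
      Stab_mono[OF T b2(1) b(3)] Stab_mono[OF T b2(2) b(3)] b lt by auto
  moreover have "T (r, Suc c) \<noteq> T (Suc r, c)"
    using inj_onD[OF filling_inj[OF Tf] _ b2] by auto
  ultimately show ?thesis by linarith
qed

text \<open>No box lies between the boxes of \<open>i\<close> and \<open>i + 1\<close> in the product order. Hence such boxes in one
  row, in one column or on adjacent diagonals are neighbours.\<close>

lemma content_Suc:
  assumes T: "T \<in> Stab lam" and i: "i \<in> {1..<d}"
  shows same_row_iff: "fst (box_of lam T i) = fst (box_of lam T (Suc i)) \<longleftrightarrow>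
      tab_content lam T (Suc i) - tab_content lam T i = 1"
    and same_column_iff: "snd (box_of lam T i) = snd (box_of lam T (Suc i)) \<longleftrightarrow>
      tab_content lam T (Suc i) - tab_content lam T i = -1"
proof -
  note Tf = Stab_fillings[OF T]
  obtain r c where rc: "box_of lam T i = (r, c)" by force
  obtain r' c' where rc': "box_of lam T (Suc i) = (r', c')" by force
  have "i \<in> {1..d}" "Suc i \<in> {1..d}" using i by auto
  then have b: "(r, c) \<in> boxes lam" "T (r, c) = i" "(r', c') \<in> boxes lam" "T (r', c') = Suc i"
    using box_of[OF Tf] rc rc' by metis+
  have nle: "\<not> (r' \<le> r \<and> c' \<le> c)"
    using Stab_mono[OF T b(3,1)] b by (cases "(r', c') = (r, c)") auto
  have nbetween: False if "(x, y) \<noteq> (r, c)" "(x, y) \<noteq> (r', c')" "r \<le> x" "x \<le> r'" "c \<le> y" "y \<le> c'" for x y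
  proof -
    have xy: "(x, y) \<in> boxes lam" using boxes_down_closed[OF b(3)] that by simp
    have "i < T (x, y)" using Stab_mono[OF T b(1) xy that(3,5)] that(1) b(2) by metis
    moreover have "T (x, y) < Suc i" using Stab_mono[OF T xy b(3) that(4,6) that(2)] b(4) by simp
    ultimately show False by simp
  qed
  have row: "c' = Suc c" if "r = r'"
  proof -
    have "c < c'" using nle that by simp
    then show ?thesis using nbetween[of r "Suc c"] that by fastforce
  qed
  have col: "r' = Suc r" if "c = c'"
  proof -
    have "r < r'" using nle that by simp
    then show ?thesis using nbetween[of "Suc r" c] that by fastforce
  qed
  have row': "r = r'" if eq: "int c' - int r' - (int c - int r) = 1"
  proof (rule ccontr)
    assume "r \<noteq> r'"
    then consider "r < r'" | "r' < r" by linarith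
    then show False
    proof cases
      case 1
      then have "c < c'" using eq by linarith
      then show False using nbetween[of r' c] 1 by simp
    next
      case 2
      then show False using nle eq by auto
    qed
  qed
  have col': "c = c'" if eq: "int c' - int r' - (int c - int r) = -1"
  proof (rule ccontr)
    assume "c \<noteq> c'"
    then consider "c < c'" | "c' < c" by linarith
    then show False
    proof cases
      case 1
      then have "r < r'" using eq by linarith
      then show False using nbetween[of r' c] 1 by simp
    next
      case 2
      then show False using nle eq by auto
    qed
  qed
  show "fst (box_of lam T i) = fst (box_of lam T (Suc i)) \<longleftrightarrow>
      tab_content lam T (Suc i) - tab_content lam T i = 1"
    using row row' by (auto simp: tab_content_def rc rc')
  show "snd (box_of lam T i) = snd (box_of lam T (Suc i)) \<longleftrightarrow>
      tab_content lam T (Suc i) - tab_content lam T i = -1"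
    using col col' by (auto simp: tab_content_def rc rc')
qed

lemma coxeter_Stab_iff:
  assumes T: "T \<in> Stab lam" and i: "i \<in> {1..<d}"
  shows "relabel lam (coxeter i) T \<in> Stab lam \<longleftrightarrow>
    fst (box_of lam T i) \<noteq> fst (box_of lam T (Suc i)) \<and>
    snd (box_of lam T i) \<noteq> snd (box_of lam T (Suc i))" (is "?S \<in> _ \<longleftrightarrow> ?R")
proof
  note Tf = Stab_fillings[OF T]
  have "i \<in> {1..d}" "Suc i \<in> {1..d}" using i by auto
  note b = box_of[OF Tf this(1)] box_of[OF Tf this(2)]
  {
    assume S: "?S \<in> Stab lam"
    have ST: "?S (box_of lam T i) = Suc i" "?S (box_of lam T (Suc i)) = i"
      using b by (simp_all add: relabel_def)
    show ?R
    proof (rule ccontr)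
      obtain r c where rc: "box_of lam T i = (r, c)" by force
      obtain r' c' where rc': "box_of lam T (Suc i) = (r', c')" by force
      assume "\<not> ?R"
      then have "(r \<le> r' \<and> c \<le> c') \<or> (r' \<le> r \<and> c' \<le> c)" by (auto simp: rc rc')
      moreover have "(r, c) \<noteq> (r', c')" using b rc rc' by force
      ultimately show False
        using Stab_mono[OF T, of r c r' c'] Stab_mono[OF T, of r' c' r c]
          Stab_mono[OF S, of r c r' c'] Stab_mono[OF S, of r' c' r c] b ST rc rc' by auto
    qed
  next
    assume R: ?R
    have key: "?S x < ?S y"
      if "x \<in> boxes lam" "y \<in> boxes lam" "T x < T y" "fst x = fst y \<or> snd x = snd y" for x y
    proof -
      have "\<not> (T x = i \<and> T y = Suc i)"
        using R that box_of_entry[OF Tf that(1)] box_of_entry[OF Tf that(2)] by auto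
      then show ?thesis
        using that by (auto simp: relabel_def Transposition.transpose_def)
    qed
    have "?S \<in> fillings lam" using relabel_fillings[OF Tf coxeter_permutes[OF i]] .
    then show "?S \<in> Stab lam"
      using T key unfolding Stab_def by simp
  }
qed

end

section \<open>Young's orthogonal form\<close>

definition young_diag :: "nat list \<Rightarrow> nat \<Rightarrow> filling \<Rightarrow> complex"
  where "young_diag lam i T = of_real (1 / axial_dist lam i T)"

definition young_off :: "nat list \<Rightarrow> nat \<Rightarrow> filling \<Rightarrow> complex"
  where "young_off lam i T = of_real (sqrt (1 - 1 / (axial_dist lam i T)\<^sup>2))"

text \<open>The action of \<open>s\<^sub>i\<close> on coordinate functions. At nonstandard fillings it is the identity, so that the
  Coxeter relations hold for all functions and not only for those supported on the standard
  tableaux.\<close>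

definition young_op :: "nat list \<Rightarrow> nat \<Rightarrow> (filling \<Rightarrow> complex) \<Rightarrow> filling \<Rightarrow> complex"
  where "young_op lam i g R =
    (if R \<in> Stab lam
     then young_diag lam i R * g R + young_off lam i R * g (relabel lam (coxeter i) R)
     else g R)"

context young
begin

lemma axial_dist_nonzero:
  assumes "T \<in> Stab lam" "i \<in> {1..<d}"
  shows "axial_dist lam i T \<noteq> 0"
  using same_diagonal_far[OF assms(1), of i "Suc i"] assms(2) by (auto simp: axial_dist_def)

text \<open>The off-diagonal coefficient vanishes exactly for axial distance 1 or -1. This makes the separate
  rules of Young for entries in one row or one column instances of a single formula, see
  \<open>young_image_uniform\<close>.\<close>

lemma young_off_eq_0_iff:
  assumes T: "T \<in> Stab lam" and i: "i \<in> {1..<d}"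
  shows "young_off lam i T = 0 \<longleftrightarrow> relabel lam (coxeter i) T \<notin> Stab lam"
proof -
  let ?k = "tab_content lam T (Suc i) - tab_content lam T i"
  have "young_off lam i T = 0 \<longleftrightarrow> (real_of_int ?k)\<^sup>2 = 1"
    using axial_dist_nonzero[OF assms] by (simp add: young_off_def axial_dist_def field_simps)
  also have "\<dots> \<longleftrightarrow> ?k = 1 \<or> ?k = -1"
    by (simp only: power2_eq_1_iff) linarith
  finally show ?thesis
    unfolding coxeter_Stab_iff[OF assms] using same_row_iff[OF assms] same_column_iff[OF assms] by auto
qed

lemma young_off_squared:
  assumes T: "T \<in> Stab lam" and i: "i \<in> {1..<d}"
  shows "young_off lam i T * young_off lam i T = 1 - young_diag lam i T * young_diag lam i T"
proof -
  let ?k = "tab_content lam T (Suc i) - tab_content lam T i"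
  have "?k \<noteq> 0" using axial_dist_nonzero[OF assms] by (simp add: axial_dist_def)
  then have "1 \<le> \<bar>?k\<bar>" by linarith
  then have "1 \<le> (axial_dist lam i T)\<^sup>2"
    unfolding axial_dist_def by (metis abs_le_square_iff abs_one of_int_1_le_iff of_int_abs one_power2)
  then have "0 \<le> 1 - 1 / (axial_dist lam i T)\<^sup>2"
    using divide_le_eq_1_pos[of "(axial_dist lam i T)\<^sup>2" 1] by linarith
  then have "sqrt (1 - 1 / (axial_dist lam i T)\<^sup>2) * sqrt (1 - 1 / (axial_dist lam i T)\<^sup>2)
      = 1 - 1 / axial_dist lam i T * (1 / axial_dist lam i T)"
    by (simp add: power2_eq_square)
  then show ?thesis
    unfolding young_off_def young_diag_def by (metis of_real_1 of_real_diff of_real_mult)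
qed

lemma young_image_uniform:
  assumes T: "T \<in> Stab lam" and i: "i \<in> {1..<d}"
  shows "young_image lam i T R =
    (if R = T then young_diag lam i T else 0) +
    (if R = relabel lam (coxeter i) T then young_off lam i T else 0)"
proof (cases "relabel lam (coxeter i) T \<in> Stab lam")
  case True
  then show ?thesis
    by (simp add: young_image_def Let_def young_diag_def young_off_def)
next
  case False
  then have off: "young_off lam i T = 0" using young_off_eq_0_iff[OF assms] by simp
  have "fst (box_of lam T i) = fst (box_of lam T (Suc i)) \<or> snd (box_of lam T i) = snd (box_of lam T (Suc i))"
    using coxeter_Stab_iff[OF assms] False by auto
  then have "axial_dist lam i T =
      (if fst (box_of lam T i) = fst (box_of lam T (Suc i)) then 1 else -1)"
    using same_row_iff[OF assms] same_column_iff[OF assms]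
    by (auto simp: axial_dist_def simp del: of_int_diff)
  then show ?thesis
    using False off by (simp add: young_image_def Let_def young_diag_def)
qed

lemma young_diag_swap:
  "T \<in> fillings lam \<Longrightarrow> i \<in> {1..<d} \<Longrightarrow> young_diag lam i (relabel lam (coxeter i) T) = - young_diag lam i T"
  using axial_dist_swap[of T lam i] by (simp add: young_diag_def sum_lam)

lemma young_off_swap:
  "T \<in> fillings lam \<Longrightarrow> i \<in> {1..<d} \<Longrightarrow> young_off lam i (relabel lam (coxeter i) T) = young_off lam i T"
  using axial_dist_swap[of T lam i] by (simp add: young_off_def sum_lam)

lemma young_op_standard:
  "R \<in> Stab lam \<Longrightarrow> young_op lam i g R =
    young_diag lam i R * g R + young_off lam i R * g (relabel lam (coxeter i) R)"
  by (simp add: young_op_def)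

text \<open>A coefficient leading to a nonstandard filling is zero; so iterated operators can be expanded as if
  all fillings on the way were standard.\<close>

lemma young_op_twice:
  assumes R: "R \<in> Stab lam" and i: "i \<in> {1..<d}"
  defines "D \<equiv> young_diag lam" and "Q \<equiv> young_off lam" and "s \<equiv> \<lambda>i. relabel lam (coxeter i)"
  shows "young_op lam i (young_op lam j g) R =
    D i R * (D j R * g R + Q j R * g (s j R)) +
    Q i R * (D j (s i R) * g (s i R) + Q j (s i R) * g (s j (s i R)))"
  using young_off_eq_0_iff[OF R i]
  by (cases "relabel lam (coxeter i) R \<in> Stab lam") (simp_all add: R young_op_standard assms(3-))

lemma young_op_thrice:
  assumes R: "R \<in> Stab lam" and i: "i \<in> {1..<d}" and j: "j \<in> {1..<d}"
  defines "D \<equiv> young_diag lam" and "Q \<equiv> young_off lam" and "s \<equiv> \<lambda>i. relabel lam (coxeter i)"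
  shows "young_op lam i (young_op lam j (young_op lam k g)) R =
    D i R * (D j R * (D k R * g R + Q k R * g (s k R)) +
      Q j R * (D k (s j R) * g (s j R) + Q k (s j R) * g (s k (s j R)))) +
    Q i R * (D j (s i R) * (D k (s i R) * g (s i R) + Q k (s i R) * g (s k (s i R))) +
      Q j (s i R) * (D k (s j (s i R)) * g (s j (s i R)) + Q k (s j (s i R)) * g (s k (s j (s i R)))))"
proof -
  have 1: "young_op lam i h R = D i R * h R + Q i R * h (s i R)" for h
    by (simp add: young_op_standard[OF R] assms(4-))
  show ?thesis
  proof (cases "s i R \<in> Stab lam")
    case True
    show ?thesis
      unfolding 1 young_op_twice[OF True[unfolded s_def] j, folded D_def Q_def s_def]
        young_op_twice[OF R j, folded assms(4-)] s_def ..
  next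
    case False
    then have "Q i R = 0" using young_off_eq_0_iff[OF R i] by (simp add: Q_def s_def)
    then show ?thesis
      unfolding 1 young_op_twice[OF R j, folded assms(4-)] by (simp add: s_def)
  qed
qed

lemma young_op_square:
  assumes i: "i \<in> {1..<d}"
  shows "young_op lam i (young_op lam i g) = g"
proof
  fix R
  show "young_op lam i (young_op lam i g) R = g R"
  proof (cases "R \<in> Stab lam")
    case True
    note Rf = Stab_fillings[OF True]
    have "young_op lam i (young_op lam i g) R =
        (young_diag lam i R * young_diag lam i R + young_off lam i R * young_off lam i R) * g R"
      unfolding young_op_twice[OF True i] young_diag_swap[OF Rf i] young_off_swap[OF Rf i] relabel_swap[OF Rf]
      by (simp add: algebra_simps)
    then show ?thesis by (simp add: young_off_squared[OF True i])
  qed (simp add: young_op_def)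
qed

lemma young_op_far:
  assumes i: "i \<in> {1..<d}" and j: "j \<in> {1..<d}" and far: "Suc i < j"
  shows "young_op lam i (young_op lam j g) = young_op lam j (young_op lam i g)"
proof
  fix R
  show "young_op lam i (young_op lam j g) R = young_op lam j (young_op lam i g) R"
  proof (cases "R \<in> Stab lam")
    case True
    note Rf = Stab_fillings[OF True]
    have ij: "i \<in> {1..d}" "Suc i \<in> {1..d}" "j \<in> {1..d}" "Suc j \<in> {1..d}" using i j by auto
    have fixed: "coxeter i j = j" "coxeter i (Suc j) = Suc j" "coxeter j i = i" "coxeter j (Suc i) = Suc i"
      using far by (auto simp: Transposition.transpose_def)
    have dist: "axial_dist lam j (relabel lam (coxeter i) R) = axial_dist lam j R"
      "axial_dist lam i (relabel lam (coxeter j) R) = axial_dist lam i R"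
      using content_coxeter[OF Rf i ij(3)] content_coxeter[OF Rf i ij(4)]
        content_coxeter[OF Rf j ij(1)] content_coxeter[OF Rf j ij(2)] fixed
      by (simp_all add: axial_dist_def)
    have "coxeter i \<circ> coxeter j = coxeter j \<circ> coxeter i"
      using far by (auto simp: fun_eq_iff Transposition.transpose_def)
    then have comm: "relabel lam (coxeter i) (relabel lam (coxeter j) R) =
        relabel lam (coxeter j) (relabel lam (coxeter i) R)"
      by (simp add: relabel_comp)
    show ?thesis
      unfolding young_op_twice[OF True i] young_op_twice[OF True j]
      by (simp add: young_diag_def young_off_def dist comm algebra_simps)
  qed (simp add: young_op_def)
qed

text \<open>In terms of the distinct contents \<open>a, b, c\<close> of three consecutive entries put
  \<open>p(x, y) = 1 / (y - x)\<close> and \<open>q\<^sup>2 = 1 - p\<^sup>2\<close>. All six coefficients agree because of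
  \<open>p(a, b) p(b, c) = p(a, c) (p(a, b) + p(b, c))\<close>.\<close>

lemma young_op_braid:
  assumes i: "i \<in> {1..<d}" and j: "Suc i \<in> {1..<d}"
  shows "young_op lam i (young_op lam (Suc i) (young_op lam i g)) =
    young_op lam (Suc i) (young_op lam i (young_op lam (Suc i) g))"
proof
  fix R
  let ?j = "Suc i"
  show "young_op lam i (young_op lam ?j (young_op lam i g)) R =
    young_op lam ?j (young_op lam i (young_op lam ?j g)) R"
  proof (cases "R \<in> Stab lam")
    case R: True
    note Rf = Stab_fillings[OF R]
    let ?s = "\<lambda>k. relabel lam (coxeter k)"
    note f = relabel_fillings[OF _ coxeter_permutes]
    have fs: "?s i R \<in> fillings lam" "?s ?j R \<in> fillings lam"
      "?s ?j (?s i R) \<in> fillings lam" "?s i (?s ?j R) \<in> fillings lam"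
      using f[OF f[OF Rf]] f[OF Rf] i j by auto
    have m: "i \<in> {1..d}" "?j \<in> {1..d}" "Suc ?j \<in> {1..d}" using i j by auto
    define a b c where "a = real_of_int (tab_content lam R i)"
      and "b = real_of_int (tab_content lam R ?j)" and "c = real_of_int (tab_content lam R (Suc ?j))"
    define p q where "p = (\<lambda>x y. complex_of_real (1 / (y - x)))"
      and "q = (\<lambda>x y. complex_of_real (sqrt (1 - 1 / (y - x)\<^sup>2)))"
    have "a \<noteq> b" "b \<noteq> c" "a \<noteq> c"
      using same_diagonal_far[OF R m(1,2)] same_diagonal_far[OF R m(2,3)] same_diagonal_far[OF R m(1,3)]
      by (auto simp: a_def b_def c_def)
    then have pp: "p a b * p b c = p a c * (p a b + p b c)"
      unfolding p_def of_real_mult[symmetric] of_real_add[symmetric] of_real_eq_iff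
      by (simp add: field_simps)
    have anti: "p b a = - p a b" "p c b = - p b c" "q b a = q a b" "q c b = q b c"
      by (simp_all add: p_def q_def power2_commute divide_minus_right[symmetric] del: divide_minus_right)
    have tr: "coxeter i i = ?j" "coxeter i ?j = i" "coxeter i (Suc ?j) = Suc ?j"
      "coxeter ?j i = i" "coxeter ?j ?j = Suc ?j" "coxeter ?j (Suc ?j) = ?j"
      by (auto simp: Transposition.transpose_def)
    note ct = content_coxeter[OF Rf i] content_coxeter[OF Rf j]
      content_coxeter[OF fs(1) i] content_coxeter[OF fs(1) j]
      content_coxeter[OF fs(2) i] content_coxeter[OF fs(2) j]
    have P: "young_diag lam i R = p a b" "young_diag lam ?j R = p b c"
      "young_diag lam i (?s i R) = p b a" "young_diag lam ?j (?s i R) = p a c"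
      "young_diag lam i (?s ?j R) = p a c" "young_diag lam ?j (?s ?j R) = p c b"
      "young_diag lam i (?s ?j (?s i R)) = p b c" "young_diag lam ?j (?s i (?s ?j R)) = p a b"
      using m by (simp_all add: young_diag_def axial_dist_def ct tr p_def a_def b_def c_def)
    have Q: "young_off lam i R = q a b" "young_off lam ?j R = q b c"
      "young_off lam i (?s i R) = q b a" "young_off lam ?j (?s i R) = q a c"
      "young_off lam i (?s ?j R) = q a c" "young_off lam ?j (?s ?j R) = q c b"
      "young_off lam i (?s ?j (?s i R)) = q b c" "young_off lam ?j (?s i (?s ?j R)) = q a b"
      using m by (simp_all add: young_off_def axial_dist_def ct tr q_def a_def b_def c_def)
    have qq: "q a b * q a b = 1 - p a b * p a b" "q b c * q b c = 1 - p b c * p b c"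
      using young_off_squared[OF R i] young_off_squared[OF R j] P Q by simp_all
    have "coxeter i \<circ> (coxeter ?j \<circ> coxeter i) = coxeter ?j \<circ> (coxeter i \<circ> coxeter ?j)"
      by (auto simp: fun_eq_iff Transposition.transpose_def)
    then have br: "?s i (?s ?j (?s i R)) = ?s ?j (?s i (?s ?j R))"
      by (simp add: relabel_comp comp_assoc)
    have diag: "(p a b * p a b * p b c + q a b * q a b * p a c) -
        (p b c * p b c * p a b + q b c * q b c * p a c) = 0"
    proof -
      have "(p a b * p a b * p b c + q a b * q a b * p a c) -
        (p b c * p b c * p a b + q b c * q b c * p a c) =
        (p a b - p b c) * (p a b * p b c - p a c * (p a b + p b c))"
        unfolding qq by (simp add: algebra_simps)
      then show ?thesis using pp by simp
    qed
    have "young_op lam i (young_op lam ?j (young_op lam i g)) R -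
        young_op lam ?j (young_op lam i (young_op lam ?j g)) R =
      ((p a b * p a b * p b c + q a b * q a b * p a c) -
        (p b c * p b c * p a b + q b c * q b c * p a c)) * g R +
      (q a b * g (?s i R) - q b c * g (?s ?j R)) * (p a b * p b c - p a c * (p a b + p b c))"
      unfolding young_op_thrice[OF R i j] young_op_thrice[OF R j i]
        relabel_swap[OF Rf] br P Q anti
      by (simp add: algebra_simps)
    then show ?thesis using diag pp by simp
  qed (simp add: young_op_def)
qed

sublocale coxeter_action d "young_op lam"
proof unfold_locales
  fix i j assume i: "i \<in> {1..<d}" 
  show "young_op lam i \<circ> young_op lam i = id"
    by (rule ext) (simp only: comp_apply id_apply young_op_square[OF i])
  show "young_op lam i \<circ> young_op lam j = young_op lam j \<circ> young_op lam i" if j: "j \<in> {1..<d}" and "Suc i < j"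
    by (rule ext) (simp only: comp_apply young_op_far[OF i that])
  show "young_op lam i \<circ> young_op lam (Suc i) \<circ> young_op lam i =
      young_op lam (Suc i) \<circ> young_op lam i \<circ> young_op lam (Suc i)" if "Suc i \<in> {1..<d}"
    by (rule ext) (simp only: comp_apply young_op_braid[OF i that])
qed

end

context young
begin

definition young_mat :: "(nat \<Rightarrow> nat) \<Rightarrow> filling op"
  where "young_mat \<sigma> R T =
    (if \<sigma> permutes {1..d} \<and> R \<in> Stab lam \<and> T \<in> Stab lam
     then F \<sigma> (\<lambda>X. if X = T then 1 else 0) R else 0)"

lemma young_op_sum:
  "young_op lam i (\<lambda>X. \<Sum>j\<in>A. c j * g j X) = (\<lambda>X. \<Sum>j\<in>A. c j * young_op lam i (g j) X)"
  by (auto simp: fun_eq_iff young_op_def sum_distrib_left sum.distrib[symmetric] algebra_simps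
      intro!: sum.cong)

lemma F_sum:
  assumes "\<sigma> permutes {1..d}"
  shows "F \<sigma> (\<lambda>X. \<Sum>j\<in>A. c j * g j X) = (\<lambda>X. \<Sum>j\<in>A. c j * F \<sigma> (g j) X)"
  using assms
proof (induction arbitrary: g rule: permutes_coxeter_induct)
  case id
  show ?case by (simp only: coxeter_ext_id[unfolded id_def] id_def)
next
  case (coxeter \<sigma> i)
  show ?case
    unfolding coxeter_ext_o_coxeter[OF coxeter(1,2)] by (simp only: comp_apply young_op_sum coxeter(4))
qed

lemma F_nonstandard:
  assumes "\<sigma> permutes {1..d}" "X \<notin> Stab lam"
  shows "F \<sigma> g X = g X"
  using assms(1)
proof (induction arbitrary: g rule: permutes_coxeter_induct)
  case id
  show ?case by (simp only: coxeter_ext_id[unfolded id_def] id_def)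
next
  case (coxeter \<sigma> i)
  show ?case
    unfolding coxeter_ext_o_coxeter[OF coxeter(1,2)]
    using assms(2) by (simp only: comp_apply coxeter(4)) (simp add: young_op_def)
qed

text \<open>Functions supported on the standard tableaux are combinations of the basis vectors \<open>w\<^sub>T\<close>, and these
  give the columns of the matrix of \<open>\<sigma>\<close>.\<close>

lemma F_eq_young_mat:
  assumes \<sigma>: "\<sigma> permutes {1..d}" and g: "\<And>X. X \<notin> Stab lam \<Longrightarrow> g X = 0" and R: "R \<in> Stab lam"
  shows "F \<sigma> g R = (\<Sum>T\<in>Stab lam. young_mat \<sigma> R T * g T)"
proof -
  have "g = (\<lambda>X. \<Sum>T\<in>Stab lam. g T * (if X = T then 1 else 0))"
    by (rule ext) (simp add: g finite_Stab if_distrib cong: if_cong)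
  then have "F \<sigma> g = F \<sigma> (\<lambda>X. \<Sum>T\<in>Stab lam. g T * (if X = T then 1 else 0))" by (rule arg_cong)
  also have "\<dots> = (\<lambda>X. \<Sum>T\<in>Stab lam. g T * F \<sigma> (\<lambda>X. if X = T then 1 else 0) X)"
    by (rule F_sum[OF \<sigma>])
  finally show ?thesis
    using \<sigma> R by (simp add: young_mat_def mult.commute)
qed

lemma is_young_rep_young_mat: "is_young_rep d lam young_mat"
  unfolding is_young_rep_def
proof (intro conjI allI impI ballI)
  fix \<sigma> :: "nat \<Rightarrow> nat"
  show "young_mat \<sigma> \<in> ops (Stab lam)"
    by (auto simp: ops_def young_mat_def)
  show "young_mat \<sigma> = op_zero" if "\<not> \<sigma> permutes {1..d}"
    using that by (simp add: fun_eq_iff young_mat_def op_zero_def)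
next
  show "young_mat id = op_one (Stab lam)"
    unfolding fun_eq_iff young_mat_def coxeter_ext_id by (auto simp: op_one_def permutes_id)
next
  fix \<sigma> \<tau> :: "nat \<Rightarrow> nat"
  assume p: "\<sigma> permutes {1..d} \<and> \<tau> permutes {1..d}"
  show "young_mat (\<sigma> \<circ> \<tau>) = op_mult (Stab lam) (young_mat \<sigma>) (young_mat \<tau>)"
  proof (intro ext)
    fix R T
    show "young_mat (\<sigma> \<circ> \<tau>) R T = op_mult (Stab lam) (young_mat \<sigma>) (young_mat \<tau>) R T"
    proof (cases "R \<in> Stab lam \<and> T \<in> Stab lam")
      case True
      let ?g = "F \<tau> (\<lambda>X. if X = T then 1 else 0)"
      have "young_mat (\<sigma> \<circ> \<tau>) R T = F \<sigma> ?g R"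
        using p True coxeter_ext_comp[of \<sigma> \<tau>] by (simp add: young_mat_def permutes_compose)
      also have "\<dots> = (\<Sum>Z\<in>Stab lam. young_mat \<sigma> R Z * ?g Z)"
        using p True F_nonstandard[of \<tau>] by (intro F_eq_young_mat) auto
      finally show ?thesis
        using p True by (simp add: op_mult_def young_mat_def[of \<tau>])
    qed (auto simp: young_mat_def op_mult_def)
  qed
next
  fix i T assume i: "i \<in> {1..<d}" and T: "T \<in> Stab lam"
  note Tf = Stab_fillings[OF T]
  show "(\<lambda>R. young_mat (coxeter i) R T) = young_image lam i T"
  proof
    fix R
    show "young_mat (coxeter i) R T = young_image lam i T R"
    proof (cases "R \<in> Stab lam")
      case True
      have swap: "relabel lam (coxeter i) R = T \<longleftrightarrow> R = relabel lam (coxeter i) T"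
        using relabel_swap[OF Tf] relabel_swap[OF Stab_fillings[OF True]] by auto
      have "young_mat (coxeter i) R T = young_op lam i (\<lambda>X. if X = T then 1 else 0) R"
        using True T coxeter_permutes[OF i] by (simp add: young_mat_def coxeter_ext_coxeter[OF i])
      also have "\<dots> = young_image lam i T R"
        unfolding young_image_uniform[OF T i] young_op_standard[OF True] swap
        using young_off_swap[OF Tf i] by auto
      finally show ?thesis .
    next
      case False
      then show ?thesis
        using T young_off_eq_0_iff[OF T i] by (auto simp: young_mat_def young_image_uniform[OF T i])
    qed
  qed
qed

lemma is_young_rep_unique:
  assumes 1: "is_young_rep d lam \<rho>" and 2: "is_young_rep d lam \<rho>'"
  shows "\<rho> = \<rho>'"
proof
  fix \<sigma> :: "nat \<Rightarrow> nat"
  show "\<rho> \<sigma> = \<rho>' \<sigma>"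
  proof (cases "\<sigma> permutes {1..d}")
    case True
    then show ?thesis
    proof (induction rule: permutes_coxeter_induct)
      case id
      have "\<rho> id = op_one (Stab lam)" "\<rho>' id = op_one (Stab lam)"
        using 1 2 unfolding is_young_rep_def by blast+
      then show ?case by (simp only:)
    next
      case (coxeter \<sigma> i)
      have "\<rho> (coxeter i) R T = \<rho>' (coxeter i) R T" for R T
      proof (cases "T \<in> Stab lam")
        case True
        then have "(\<lambda>R. \<rho> (coxeter i) R T) = (\<lambda>R. \<rho>' (coxeter i) R T)"
          using 1 2 coxeter(2) by (simp add: is_young_rep_def)
        then show ?thesis by (rule fun_cong)
      next
        case False
        have "\<rho> (coxeter i) \<in> ops (Stab lam)" "\<rho>' (coxeter i) \<in> ops (Stab lam)"
          using 1 2 coxeter_permutes[OF coxeter(2)] by (simp_all add: is_young_rep_def)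
        then have "\<rho> (coxeter i) R T = 0" "\<rho>' (coxeter i) R T = 0"
          using False unfolding ops_def by blast+
        then show ?thesis by simp
      qed
      then have "\<rho> (coxeter i) = \<rho>' (coxeter i)" by (simp add: fun_eq_iff)
      moreover have "r (\<sigma> \<circ> coxeter i) = op_mult (Stab lam) (r \<sigma>) (r (coxeter i))"
        if "is_young_rep d lam r" for r
        using that coxeter(1) coxeter_permutes[OF coxeter(2)] unfolding is_young_rep_def by blast
      ultimately show ?case using 1 2 coxeter(4) by (simp only:)
    qed
  qed (use 1 2 in \<open>simp add: is_young_rep_def\<close>)
qed

abbreviation "\<rho> \<equiv> young_rep d lam"

lemma is_young_rep: "is_young_rep d lam \<rho>"
  unfolding young_rep_def
  by (rule theI[of _ young_mat]) (use is_young_rep_young_mat is_young_rep_unique in blast)+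

lemma rho_outside: "R \<notin> Stab lam \<or> T \<notin> Stab lam \<Longrightarrow> \<rho> \<sigma> R T = 0"
  using is_young_rep by (cases "\<sigma> permutes {1..d}") (fastforce simp: is_young_rep_def ops_def op_zero_def)+

lemma rho_id: "\<rho> id = op_one (Stab lam)"
  using is_young_rep by (simp add: is_young_rep_def)

lemma rho_ident: "\<rho> (\<lambda>x. x) = op_one (Stab lam)"
  using rho_id by (simp only: id_def)

lemma rho_comp:
  "\<sigma> permutes {1..d} \<Longrightarrow> \<tau> permutes {1..d} \<Longrightarrow> \<rho> (\<sigma> \<circ> \<tau>) = op_mult (Stab lam) (\<rho> \<sigma>) (\<rho> \<tau>)"
  using is_young_rep by (simp add: is_young_rep_def)

lemma rho_coxeter:
  assumes "T \<in> Stab lam" "i \<in> {1..<d}"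
  shows "\<rho> (coxeter i) R T =
    (if R = T then young_diag lam i T else 0) +
    (if R = relabel lam (coxeter i) T then young_off lam i T else 0)"
proof -
  have "(\<lambda>R. \<rho> (coxeter i) R T) = young_image lam i T"
    using is_young_rep assms by (simp add: is_young_rep_def)
  then show ?thesis using young_image_uniform[OF assms] by metis
qed

lemma rho_o_coxeter:
  assumes \<sigma>: "\<sigma> permutes {1..d}" and i: "i \<in> {1..<d}" and T: "T \<in> Stab lam"
  shows "\<rho> (\<sigma> \<circ> coxeter i) R T =
    young_diag lam i T * \<rho> \<sigma> R T + young_off lam i T * \<rho> \<sigma> R (relabel lam (coxeter i) T)"
proof -
  let ?S = "relabel lam (coxeter i) T"
  have "\<rho> (\<sigma> \<circ> coxeter i) R T = (\<Sum>Z\<in>Stab lam. \<rho> \<sigma> R Z *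
      ((if Z = T then young_diag lam i T else 0) + (if Z = ?S then young_off lam i T else 0)))"
    unfolding rho_comp[OF \<sigma> coxeter_permutes[OF i]] op_mult_def rho_coxeter[OF T i] ..
  also have "\<dots> = \<rho> \<sigma> R T * young_diag lam i T + (if ?S \<in> Stab lam then \<rho> \<sigma> R ?S * young_off lam i T else 0)"
    unfolding distrib_left sum.distrib using T by (simp add: finite_Stab if_distrib cong: if_cong)
  finally show ?thesis
    using rho_outside[of R ?S] by auto
qed

lemma rho_coxeter_o:
  assumes \<sigma>: "\<sigma> permutes {1..d}" and i: "i \<in> {1..<d}" and R: "R \<in> Stab lam"
  shows "\<rho> (coxeter i \<circ> \<sigma>) R T =
    young_diag lam i R * \<rho> \<sigma> R T + young_off lam i R * \<rho> \<sigma> (relabel lam (coxeter i) R) T"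
proof -
  let ?S = "relabel lam (coxeter i) R"
  note Rf = Stab_fillings[OF R]
  have "\<rho> (coxeter i \<circ> \<sigma>) R T = (\<Sum>Z\<in>Stab lam. \<rho> (coxeter i) R Z * \<rho> \<sigma> Z T)"
    unfolding rho_comp[OF coxeter_permutes[OF i] \<sigma>] op_mult_def ..
  also have "\<dots> = (\<Sum>Z\<in>Stab lam.
      ((if Z = R then young_diag lam i R else 0) + (if Z = ?S then young_off lam i R else 0)) * \<rho> \<sigma> Z T)"
  proof (intro sum.cong refl)
    fix Z assume Z: "Z \<in> Stab lam"
    have "R = relabel lam (coxeter i) Z \<longleftrightarrow> Z = ?S"
      using relabel_swap[OF Rf] relabel_swap[OF Stab_fillings[OF Z]] by auto
    then show "\<rho> (coxeter i) R Z * \<rho> \<sigma> Z T =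
      ((if Z = R then young_diag lam i R else 0) + (if Z = ?S then young_off lam i R else 0)) * \<rho> \<sigma> Z T"
      using rho_coxeter[OF Z i] young_off_swap[OF Rf i] by auto
  qed
  also have "\<dots> = young_diag lam i R * \<rho> \<sigma> R T + (if ?S \<in> Stab lam then young_off lam i R * \<rho> \<sigma> ?S T else 0)"
    unfolding distrib_right sum.distrib
    using R by (simp add: finite_Stab if_distrib[of "\<lambda>x. x * _"] cong: if_cong)
  finally show ?thesis
    using rho_outside[of ?S T] by auto
qed

lemma cnj_young_diag: "cnj (young_diag lam i T) = young_diag lam i T"
  unfolding young_diag_def by (rule complex_cnj_complex_of_real)

lemma cnj_young_off: "cnj (young_off lam i T) = young_off lam i T"
  unfolding young_off_def by (rule complex_cnj_complex_of_real)

text \<open>The generators act by real symmetric matrices, and inversion reverses words; thus the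
  representation is unitary.\<close>

lemma rho_inv:
  assumes "\<sigma> permutes {1..d}"
  shows "\<rho> (inv \<sigma>) T R = cnj (\<rho> \<sigma> R T)"
  using assms
proof (induction arbitrary: R T rule: permutes_coxeter_induct)
  case id
  then show ?case by (auto simp: rho_ident op_one_def)
next
  case (coxeter \<sigma> i)
  have inv: "inv (\<sigma> \<circ> coxeter i) = coxeter i \<circ> inv \<sigma>"
    using o_inv_distrib[OF permutes_bij[OF coxeter(1)] bij_transpose] by simp
  show ?case
  proof (cases "T \<in> Stab lam")
    case True
    show ?thesis
      unfolding inv rho_coxeter_o[OF permutes_inv[OF coxeter(1)] coxeter(2) True]
        rho_o_coxeter[OF coxeter(1,2) True] coxeter(4)
      by (simp add: cnj_young_diag cnj_young_off)
  next
    case False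
    then show ?thesis by (simp add: rho_outside)
  qed
qed

section \<open>Jucys--Murphy elements act by contents\<close>

lemma content_one:
  assumes T: "T \<in> Stab lam" and d: "1 \<le> d"
  shows "tab_content lam T 1 = 0"
proof -
  note Tf = Stab_fillings[OF T]
  obtain r c where rc: "box_of lam T 1 = (r, c)" by force
  have b: "(r, c) \<in> boxes lam" "T (r, c) = 1" using box_of[OF Tf, of 1] d rc by auto
  have b0: "(0, 0) \<in> boxes lam" using boxes_down_closed[OF b(1)] by simp
  have "(r, c) = (0, 0)"
    using Stab_mono[OF T b0 b(1)] b(2) filling_range[OF Tf b0] by force
  then show ?thesis using rc by (simp add: tab_content_def)
qed

text \<open>With \<open>X\<^sub>m = \<Sum>\<^sub>j\<^sub><\<^sub>m (j m)\<close> one has \<open>X\<^sub>m\<^sub>+\<^sub>1 = s\<^sub>m X\<^sub>m s\<^sub>m + s\<^sub>m\<close>. Hence, if \<open>X\<^sub>m\<close> is the diagonal matrix of the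
  contents of \<open>m\<close>, Young's formula for \<open>s\<^sub>m\<close> yields that of the contents of \<open>m + 1\<close>.\<close>

lemma jucys_murphy:
  assumes "1 \<le> m" "m \<le> d" "R \<in> Stab lam" "T \<in> Stab lam"
  shows "(\<Sum>j\<in>{1..<m}. \<rho> (Transposition.transpose j m) R T) =
    (if R = T then of_int (tab_content lam T m) else 0)"
  using assms
proof (induction m arbitrary: R T rule: nat_induct_at_least)
  case base
  then show ?case using content_one by simp
next
  case (Suc m)
  note R = \<open>R \<in> Stab lam\<close> and T = \<open>T \<in> Stab lam\<close>
  note Rf = Stab_fillings[OF R] and Tf = Stab_fillings[OF T]
  have m: "m \<in> {1..<d}" "m \<in> {1..d}" "Suc m \<in> {1..d}" using Suc by auto
  let ?t = "\<lambda>j. Transposition.transpose j m"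
  let ?s = "coxeter m"
  let ?sT = "relabel lam ?s T" and ?sR = "relabel lam ?s R"
  let ?D = "young_diag lam m" and ?Q = "young_off lam m"
  let ?c = "\<lambda>X. of_int (tab_content lam X m) :: complex"
  have tp: "?t j permutes {1..d}" if "j \<in> {1..<m}" for j
    using that m by (intro permutes_swap_id) auto
  have conj: "Transposition.transpose j (Suc m) = ?s \<circ> (?t j \<circ> ?s)" if "j \<in> {1..<m}" for j
    using that by (auto simp: fun_eq_iff Transposition.transpose_def)
  have IH: "(\<Sum>j\<in>{1..<m}. \<rho> (?t j) X Y) = (if X = Y \<and> X \<in> Stab lam then ?c Y else 0)" for X Y
    using Suc.IH[of X Y] Suc.prems
    by (cases "X \<in> Stab lam \<and> Y \<in> Stab lam") (auto simp: rho_outside)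
  have "(\<Sum>j\<in>{1..<m}. \<rho> (Transposition.transpose j (Suc m)) R T) =
    (\<Sum>j\<in>{1..<m}. ?D R * (?D T * \<rho> (?t j) R T + ?Q T * \<rho> (?t j) R ?sT) +
       ?Q R * (?D T * \<rho> (?t j) ?sR T + ?Q T * \<rho> (?t j) ?sR ?sT))"
    by (intro sum.cong refl)
      (simp only: conj rho_coxeter_o[OF permutes_o_coxeter[OF tp m(1)] m(1) R] rho_o_coxeter[OF tp m(1) T])
  also have "\<dots> = ?D R * (?D T * (\<Sum>j\<in>{1..<m}. \<rho> (?t j) R T) + ?Q T * (\<Sum>j\<in>{1..<m}. \<rho> (?t j) R ?sT)) +
       ?Q R * (?D T * (\<Sum>j\<in>{1..<m}. \<rho> (?t j) ?sR T) + ?Q T * (\<Sum>j\<in>{1..<m}. \<rho> (?t j) ?sR ?sT))"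
    by (simp only: sum.distrib sum_distrib_left[symmetric])
  finally have sum: "(\<Sum>j\<in>{1..<Suc m}. \<rho> (Transposition.transpose j (Suc m)) R T) =
      ?D R * (?D T * (if R = T then ?c T else 0) + ?Q T * (if R = ?sT then ?c R else 0)) +
      ?Q R * (?D T * (if ?sR = T then ?c T else 0) +
         ?Q T * (if ?sR = ?sT \<and> ?sT \<in> Stab lam then ?c ?sT else 0)) +
      ((if R = T then ?D T else 0) + (if R = ?sT then ?Q T else 0))"
    using R T Suc.hyps unfolding IH
    by (simp add: rho_coxeter[OF T m(1)] sum.atLeastLessThan_Suc) (auto simp: algebra_simps)
  have ne: "?sT \<noteq> T"
    using relabel_inject[OF Tf coxeter_permutes[OF m(1)] permutes_id] relabel_id[OF Tf]
    by (metis Transposition.transpose_apply_first id_apply n_not_Suc_n)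
  have swap: "?sR = T \<longleftrightarrow> R = ?sT" "?sR = ?sT \<longleftrightarrow> R = T"
    using relabel_swap[OF Tf] relabel_swap[OF Rf] by metis+
  have tr: "?s m = Suc m" "?s (Suc m) = m" by simp_all
  define c where "c = ?c T"
  define c' where "c' = (of_int (tab_content lam T (Suc m)) :: complex)"
  have "tab_content lam T (Suc m) \<noteq> tab_content lam T m"
    using same_diagonal_far[OF T m(2,3)] by auto
  then have "c' \<noteq> c" by (simp add: c_def c'_def)
  have D: "?D T = 1 / (c' - c)"
    by (simp add: young_diag_def axial_dist_def c_def c'_def)
  have Dc: "?D T * (c' - c) = 1" using \<open>c' \<noteq> c\<close> by (simp add: D)
  note QQ = young_off_squared[OF T m(1)]
  have csT: "?c ?sT = c'"
    using content_coxeter[OF Tf m(1,2)] tr by (simp add: c'_def)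
  show ?case
  proof (cases "R = T")
    case True
    have "(\<Sum>j\<in>{1..<Suc m}. \<rho> (Transposition.transpose j (Suc m)) R T) =
        ?D T * ?D T * c + ?Q T * ?Q T * c' + ?D T"
      using True ne swap csT young_off_eq_0_iff[OF T m(1)]
      unfolding sum by (cases "?sT \<in> Stab lam") (simp_all add: c_def)
    also have "\<dots> = c' - ?D T * (?D T * (c' - c)) + ?D T"
      unfolding QQ by (simp add: algebra_simps)
    also have "\<dots> = c'" by (simp add: Dc)
    finally show ?thesis using True by (simp add: c'_def)
  next
    case False
    show ?thesis
    proof (cases "R = ?sT")
      case True
      have "(\<Sum>j\<in>{1..<Suc m}. \<rho> (Transposition.transpose j (Suc m)) R T) =
          - ?D T * ?Q T * c' + ?Q T * ?D T * c + ?Q T"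
        using True False swap csT young_diag_swap[OF Tf m(1)] young_off_swap[OF Tf m(1)]
        unfolding sum by (simp add: c_def)
      also have "\<dots> = ?Q T * (1 - ?D T * (c' - c))" by (simp add: algebra_simps)
      also have "\<dots> = 0" by (simp add: Dc)
      finally show ?thesis using False by simp
    next
      case False
      then show ?thesis using \<open>R \<noteq> T\<close> swap unfolding sum by simp
    qed
  qed
qed

section \<open>A nonvanishing matrix coefficient\<close>

text \<open>Expanding \<open>\<sigma> w\<^sub>T\<close> along a reduced word of \<open>\<sigma>\<close>, each letter is either skipped or applied to the
  tableau, and applying it creates at most one inversion.\<close>

lemma rho_support:
  assumes "\<sigma> permutes {1..d}" "T \<in> Stab lam" "\<rho> \<sigma> R T \<noteq> 0"
  shows "\<exists>\<tau>. \<tau> permutes {1..d} \<and> R = relabel lam \<tau> T \<and> card (inversions d \<tau>) \<le> card (inversions d \<sigma>)"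
  using assms
proof (induction arbitrary: T rule: permutes_coxeter_induct)
  case id
  then have "R = relabel lam id T"
    using relabel_id[OF Stab_fillings] by (auto simp: rho_ident op_one_def split: if_splits)
  then show ?case using permutes_id by blast
next
  case (coxeter \<sigma> i)
  let ?S = "relabel lam (coxeter i) T"
  note asc = card_inversions_ascent[OF coxeter(1-3)]
  have "\<rho> (\<sigma> \<circ> coxeter i) R T \<noteq> 0" by (rule coxeter.prems(2))
  then have "\<rho> \<sigma> R T \<noteq> 0 \<or> (?S \<in> Stab lam \<and> \<rho> \<sigma> R ?S \<noteq> 0)"
    unfolding rho_o_coxeter[OF coxeter(1,2) coxeter.prems(1)] using rho_outside[of R ?S \<sigma>]
    by (cases "?S \<in> Stab lam") auto
  then show ?case
  proof
    assume "\<rho> \<sigma> R T \<noteq> 0"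
    then obtain \<tau> where "\<tau> permutes {1..d}" "R = relabel lam \<tau> T"
      "card (inversions d \<tau>) \<le> card (inversions d \<sigma>)"
      using coxeter.IH[OF coxeter.prems(1)] by blast
    moreover from this asc have "card (inversions d \<tau>) \<le> card (inversions d (\<sigma> \<circ> coxeter i))" by linarith
    ultimately show ?thesis by (intro exI[of _ \<tau>] conjI)
  next
    assume S: "?S \<in> Stab lam \<and> \<rho> \<sigma> R ?S \<noteq> 0"
    then obtain \<tau> where \<tau>: "\<tau> permutes {1..d}" "R = relabel lam \<tau> ?S"
      "card (inversions d \<tau>) \<le> card (inversions d \<sigma>)"
      using coxeter.IH[of ?S] by blast
    have "card (inversions d (\<tau> \<circ> coxeter i)) \<le> card (inversions d (\<sigma> \<circ> coxeter i))"
      using card_inversions_o_coxeter_le[OF \<tau>(1) coxeter(2)] asc \<tau>(3) by linarith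
    moreover have "R = relabel lam (\<tau> \<circ> coxeter i) T" using \<tau>(2) by (simp add: relabel_comp)
    ultimately show ?thesis
      using permutes_o_coxeter[OF \<tau>(1) coxeter(2)] by (intro exI[of _ "\<tau> \<circ> coxeter i"] conjI)
  qed
qed

text \<open>A descent \<open>i\<close> of \<open>\<sigma>\<close> exchanges the order of the entries \<open>i\<close>, \<open>i + 1\<close> of \<open>T\<close> in the standard tableau \<open>\<sigma> T\<close>,
  so their boxes are incomparable and \<open>s\<^sub>i T\<close> is standard as well. Thus every reduced word leads from
  \<open>T\<close> to \<open>\<sigma> T\<close> through standard tableaux, each step with a nonzero coefficient. Words with skipped
  letters have fewer inversions and end at other tableaux, so nothing cancels.\<close>

lemma rho_relabel_nonzero:
  assumes "\<sigma> permutes {1..d}" "T \<in> Stab lam" "relabel lam \<sigma> T \<in> Stab lam"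
  shows "\<rho> \<sigma> (relabel lam \<sigma> T) T \<noteq> 0"
  using assms
proof (induction arbitrary: T rule: permutes_coxeter_induct)
  case id
  then show ?case
    using relabel_id[OF Stab_fillings[OF id(1)], unfolded id_def] by (simp add: rho_ident op_one_def)
next
  case (coxeter \<sigma> i)
  note T = coxeter.prems(1) and i = coxeter(2)
  note Tf = Stab_fillings[OF T]
  let ?sT = "relabel lam (coxeter i) T"
  define S where "S = relabel lam (\<sigma> \<circ> coxeter i) T"
  have S: "S \<in> Stab lam" unfolding S_def by (rule coxeter.prems(2))
  have S': "S = relabel lam \<sigma> ?sT" by (simp add: S_def relabel_comp)
  have sT: "?sT \<in> Stab lam"
  proof (rule ccontr)
    assume ns: "?sT \<notin> Stab lam"
    obtain r c where rc: "box_of lam T i = (r, c)" by force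
    obtain r' c' where rc': "box_of lam T (Suc i) = (r', c')" by force
    have "i \<in> {1..d}" "Suc i \<in> {1..d}" using i by auto
    then have b: "(r, c) \<in> boxes lam" "T (r, c) = i" "(r', c') \<in> boxes lam" "T (r', c') = Suc i"
      using box_of[OF Tf] rc rc' by metis+
    have "(r \<le> r' \<and> c \<le> c') \<or> (r' \<le> r \<and> c' \<le> c)" "(r, c) \<noteq> (r', c')"
      using ns b unfolding coxeter_Stab_iff[OF T i] rc rc' by auto
    moreover have "S (r', c') < S (r, c)"
      using b coxeter(3) by (simp add: S_def relabel_def)
    ultimately show False
      using Stab_mono[OF S b(1,3)] Stab_mono[OF T b(3,1)] b by fastforce
  qed
  have "\<rho> \<sigma> S T = 0"
  proof (rule ccontr)
    assume "\<rho> \<sigma> S T \<noteq> 0"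
    then obtain \<tau> where \<tau>: "\<tau> permutes {1..d}" "S = relabel lam \<tau> T"
      "card (inversions d \<tau>) \<le> card (inversions d \<sigma>)"
      using rho_support[OF coxeter(1) T] by blast
    then have "\<tau> = \<sigma> \<circ> coxeter i"
      using relabel_inject[OF Tf \<tau>(1) permutes_o_coxeter[OF coxeter(1,2)]] by (simp add: S_def)
    then show False using \<tau>(3) card_inversions_ascent[OF coxeter(1-3)] by simp
  qed
  moreover have "\<rho> \<sigma> S ?sT \<noteq> 0" using coxeter.IH[OF sT] S S' by simp
  moreover have "young_off lam i T \<noteq> 0" using sT young_off_eq_0_iff[OF T i] by simp
  ultimately have "\<rho> (\<sigma> \<circ> coxeter i) S T \<noteq> 0"
    using rho_o_coxeter[OF coxeter(1,2) T, of S] by simp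
  then show ?case unfolding S_def .
qed

lemma sigma_tab:
  assumes T: "T \<in> fillings lam" and S: "S \<in> fillings lam"
  shows "sigma_tab lam T S permutes {1..d}" "relabel lam (sigma_tab lam T S) T = S"
proof -
  define \<sigma> where "\<sigma> = (\<lambda>i. if i \<in> {1..d} then S (box_of lam T i) else i)"
  have "bij_betw (S \<circ> the_inv_into (boxes lam) T) {1..d} {1..d}"
    using T S by (intro bij_betw_trans[OF bij_betw_the_inv_into]) (auto simp: fillings_def sum_lam)
  then have "bij_betw \<sigma> {1..d} {1..d}"
    by (rule bij_betw_cong[THEN iffD1, rotated]) (simp add: \<sigma>_def box_of_def)
  then have \<sigma>: "\<sigma> permutes {1..d}"
    by (rule bij_imp_permutes) (auto simp: \<sigma>_def)
  have "relabel lam \<sigma> T = S"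
  proof
    fix b
    show "relabel lam \<sigma> T b = S b"
    proof (cases "b \<in> boxes lam")
      case True
      then show ?thesis
        using filling_range[OF T True] box_of_entry[OF T True] by (simp add: relabel_def \<sigma>_def)
    next
      case False
      then show ?thesis using S extensional_arb[of S "boxes lam"] by (simp add: relabel_def fillings_def)
    qed
  qed
  then have rel: "\<sigma> permutes {1..d} \<and> relabel lam \<sigma> T = S" using \<sigma> by simp
  have "\<tau> = \<sigma>" if "\<tau> permutes {1..d} \<and> relabel lam \<tau> T = S" for \<tau>
    using relabel_inject[OF T] that rel by simp
  then have "sigma_tab lam T S permutes {1..d} \<and> relabel lam (sigma_tab lam T S) T = S"
    unfolding sigma_tab_def sum_lam 
    by (rule theI[where P = "\<lambda>\<tau>. \<tau> permutes {1..d} \<and> relabel lam \<tau> T = S", OF rel])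
  then show "sigma_tab lam T S permutes {1..d}" "relabel lam (sigma_tab lam T S) T = S" by auto
qed

section \<open>Contents determine the tableau\<close>

text \<open>The boxes of one diagonal are filled in their natural order. Counting the earlier entries of equal
  content therefore locates a box on its diagonal.\<close>

lemma box_of_from_contents:
  assumes T: "T \<in> Stab lam" and i: "i \<in> {1..d}"
  shows "card {j. j \<in> {1..<i} \<and> tab_content lam T j = tab_content lam T i} =
    min (fst (box_of lam T i)) (snd (box_of lam T i))"
proof -
  note Tf = Stab_fillings[OF T]
  obtain r c where rc: "box_of lam T i = (r, c)" by force
  have b: "(r, c) \<in> boxes lam" "T (r, c) = i" using box_of[OF Tf i] rc by simp_all
  let ?f = "\<lambda>k. T (r - Suc k, c - Suc k)"
  have sub: "(r - Suc k, c - Suc k) \<in> boxes lam" for k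
    using boxes_down_closed[OF b(1)] by simp
  have "{j. j \<in> {1..<i} \<and> tab_content lam T j = tab_content lam T i} = ?f ` {..<min r c}"
  proof (intro equalityI subsetI)
    fix j assume j: "j \<in> {j. j \<in> {1..<i} \<and> tab_content lam T j = tab_content lam T i}"
    obtain r' c' where rc': "box_of lam T j = (r', c')" by force
    have j': "j \<in> {1..d}" using j i by auto
    have b': "(r', c') \<in> boxes lam" "T (r', c') = j" using box_of[OF Tf j'] rc' by simp_all
    have eq: "int c' - int r' = int c - int r" using j rc rc' by (simp add: tab_content_def)
    have "\<not> r \<le> r'"
    proof
      assume le: "r \<le> r'"
      then have "c \<le> c'" using eq by linarith
      then show False
        using Stab_mono[OF T b(1) b'(1) le] b b' j by (cases "(r, c) = (r', c')") auto
    qed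
    then have k: "r - Suc (r - r' - 1) = r'" "c - Suc (r - r' - 1) = c'" "r - r' - 1 < min r c"
      using eq by auto
    have "?f (r - r' - 1) = j" unfolding k using b' by simp
    then show "j \<in> ?f ` {..<min r c}" using k(3) by (intro image_eqI[of _ _ "r - r' - 1"]) auto
  next
    fix j assume "j \<in> ?f ` {..<min r c}"
    then obtain k where k: "k < min r c" "j = ?f k" by auto
    have "j < i" using Stab_mono[OF T sub b(1), of k] b k by auto
    moreover have "1 \<le> j" using filling_range[OF Tf sub] k by simp
    moreover have "tab_content lam T j = tab_content lam T i"
      using k box_of_entry[OF Tf sub, of k] by (auto simp: tab_content_def rc)
    ultimately show "j \<in> {j. j \<in> {1..<i} \<and> tab_content lam T j = tab_content lam T i}" by simp
  qed
  moreover have "inj_on ?f {..<min r c}"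
  proof (rule inj_onI)
    fix k l assume "k \<in> {..<min r c}" "l \<in> {..<min r c}" "?f k = ?f l"
    then show "k = l" using inj_onD[OF filling_inj[OF Tf] _ sub sub, of k l] by auto
  qed
  ultimately show ?thesis by (simp add: card_image rc)
qed

end

lemma contents_determine_box:
  fixes a a' :: "nat \<Rightarrow> int" and i :: nat and b b' :: "nat \<times> nat"
  assumes "card {j. j \<in> {1..<i} \<and> a j = a i} = min (fst b) (snd b)" "a i = int (snd b) - int (fst b)"
    "card {j. j \<in> {1..<i} \<and> a' j = a' i} = min (fst b') (snd b')" "a' i = int (snd b') - int (fst b')"
    and "\<And>j. j \<in> {1..i} \<Longrightarrow> a j = a' j" and "1 \<le> i"
  shows "b = b'"
proof -
  have "a i = a' i" using assms(5)[of i] assms(6) by simp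
  moreover have "a j = a' j" if "j \<in> {1..<i}" for j using assms(5)[of j] that by simp
  ultimately have "{j. j \<in> {1..<i} \<and> a j = a i} = {j. j \<in> {1..<i} \<and> a' j = a' i}"
    by auto
  then have "min (fst b) (snd b) = min (fst b') (snd b')" "int (snd b) - int (fst b) = int (snd b') - int (fst b')"
    using assms by auto
  then show ?thesis by (auto simp: prod_eq_iff min_def split: if_splits)
qed

lemma boxes_inject:
  assumes "young_diagram d lam" "young_diagram e bet" "boxes lam = boxes bet"
  shows "lam = bet"
proof -
  have row: "r < length l \<longleftrightarrow> (r, 0) \<in> boxes l" if "young_diagram x l" for x l r
    using that by (auto simp: boxes_def young_diagram_def)
  have "r < length lam \<longleftrightarrow> r < length bet" for r
    using row[OF assms(1)] row[OF assms(2)] assms(3) by simp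
  then have len: "length lam = length bet" by (meson linorder_neqE_nat less_irrefl)
  moreover have "lam ! r = bet ! r" if r: "r < length lam" for r
  proof -
    have "c < lam ! r \<longleftrightarrow> c < bet ! r" for c
      using assms(3) r len by (auto simp: boxes_def set_eq_iff)
    then show ?thesis by (meson linorder_neqE_nat less_irrefl)
  qed
  ultimately show ?thesis by (rule nth_equalityI)
qed

lemma contents_determine_tableau:
  assumes lam: "young_diagram d lam" and bet: "young_diagram d bet"
    and T: "T \<in> Stab lam" and R: "R \<in> Stab bet"
    and ct: "\<And>i. i \<in> {1..d} \<Longrightarrow> tab_content lam T i = tab_content bet R i"
  shows "lam = bet \<and> T = R"
proof -
  interpret L: young d lam by unfold_locales (rule lam)
  interpret B: young d bet by unfold_locales (rule bet)
  note Tf = L.Stab_fillings[OF T] and Rf = B.Stab_fillings[OF R]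
  have box: "box_of lam T i = box_of bet R i" if i: "i \<in> {1..d}" for i
    using i ct
    by (intro contents_determine_box[OF L.box_of_from_contents[OF T i] _ B.box_of_from_contents[OF R i]])
      (auto simp: tab_content_def)
  have imL: "b \<in> boxes lam \<longleftrightarrow> b \<in> box_of lam T ` {1..d}" for b
    using L.box_of(1)[OF Tf] L.filling_range[OF Tf] L.box_of_entry[OF Tf] by (metis image_iff)
  have imB: "b \<in> boxes bet \<longleftrightarrow> b \<in> box_of bet R ` {1..d}" for b
    using B.box_of(1)[OF Rf] B.filling_range[OF Rf] B.box_of_entry[OF Rf] by (metis image_iff)
  have "boxes lam = boxes bet"
    using imL imB box by (auto simp: set_eq_iff image_iff)
  then have eq: "lam = bet" using boxes_inject[OF lam bet] by simp
  have "T b = R b" for b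
  proof (cases "b \<in> boxes lam")
    case True
    then show ?thesis
      using L.box_of_entry[OF Tf True] L.filling_range[OF Tf True] box[of "T b"]
        B.box_of(2)[OF Rf, of "T b"] by metis
  next
    case False
    then show ?thesis
      using Tf Rf eq extensional_arb[of T "boxes lam"] extensional_arb[of R "boxes lam"]
      by (simp add: fillings_def)
  qed
  then show ?thesis using eq by auto
qed

section \<open>The squares of the numbers of standard tableaux add up to d factorial\<close>

text \<open>Diagrams as finite down-closed sets of boxes, where adding and removing a box is a set operation.
  The count follows the pattern of Young's lattice as a differential poset: a diagram has one more
  addable than removable box, and adding one box and removing another one can be done in either
  order.\<close>

definition order_ideal :: "(nat \<times> nat) set \<Rightarrow> bool"
  where "order_ideal D \<longleftrightarrow> finite D \<and> (\<forall>r' c' r c. (r', c') \<in> D \<and> r \<le> r' \<and> c \<le> c' \<longrightarrow> (r, c) \<in> D)"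

definition addable :: "(nat \<times> nat) set \<Rightarrow> (nat \<times> nat) set"
  where "addable D = {b. b \<notin> D \<and> order_ideal (insert b D)}"

definition removable :: "(nat \<times> nat) set \<Rightarrow> (nat \<times> nat) set"
  where "removable D = {b \<in> D. order_ideal (D - {b})}"

definition row_length :: "(nat \<times> nat) set \<Rightarrow> nat \<Rightarrow> nat"
  where "row_length D r = card {c. (r, c) \<in> D}"

lemma initial_segment_eq:
  fixes A :: "nat set"
  assumes fin: "finite A" and down: "\<And>x y. x \<in> A \<Longrightarrow> y \<le> x \<Longrightarrow> y \<in> A"
  shows "A = {..<card A}"
proof (cases "A = {}")
  case False
  have "A = {..Max A}"
    using Max_in[OF fin False] down Max_ge[OF fin] by auto
  moreover from this have "card A = Suc (Max A)" by (metis card_atMost)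
  ultimately show ?thesis by (metis lessThan_Suc_atMost)
qed simp

lemma order_idealD:
  "order_ideal D \<Longrightarrow> (r', c') \<in> D \<Longrightarrow> r \<le> r' \<Longrightarrow> c \<le> c' \<Longrightarrow> (r, c) \<in> D"
  unfolding order_ideal_def by blast

lemma order_ideal_finite: "order_ideal D \<Longrightarrow> finite D"
  unfolding order_ideal_def by blast

lemma mem_iff_row_length:
  assumes "order_ideal D"
  shows "(r, c) \<in> D \<longleftrightarrow> c < row_length D r"
proof -
  have "finite {c. (r, c) \<in> D}"
    by (rule finite_subset[OF _ finite_imageI[OF order_ideal_finite[OF assms], of snd]]) force
  then have "{c. (r, c) \<in> D} = {..<row_length D r}"
    unfolding row_length_def by (rule initial_segment_eq) (use order_idealD[OF assms] in auto)
  then show ?thesis by blast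
qed

lemma row_length_antimono:
  assumes "order_ideal D" "r \<le> r'"
  shows "row_length D r' \<le> row_length D r"
proof (rule ccontr)
  assume "\<not> ?thesis"
  then have "(r', row_length D r) \<in> D" using mem_iff_row_length[OF assms(1)] by simp
  then have "(r, row_length D r) \<in> D" using order_idealD[OF assms(1)] assms(2) by blast
  then show False using mem_iff_row_length[OF assms(1)] by simp
qed

lemma removable_rows:
  assumes D: "order_ideal D"
  shows "removable D = (\<lambda>r. (r, row_length D r - 1)) ` {r. row_length D (Suc r) < row_length D r}"
proof (intro equalityI subsetI)
  note mem = mem_iff_row_length[OF D]
  fix b assume b: "b \<in> removable D"
  obtain r c where rc: "b = (r, c)" by force
  have in_D: "(r, c) \<in> D" and del: "order_ideal (D - {(r, c)})" using b by (auto simp: removable_def rc)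
  have "(r, Suc c) \<notin> D" using order_idealD[OF del, of r "Suc c" r c] by auto
  moreover have "(Suc r, c) \<notin> D" using order_idealD[OF del, of "Suc r" c r c] by auto
  ultimately have "c = row_length D r - 1" "row_length D (Suc r) < row_length D r"
    using in_D mem by auto
  then show "b \<in> (\<lambda>r. (r, row_length D r - 1)) ` {r. row_length D (Suc r) < row_length D r}"
    by (auto simp: rc)
next
  note mem = mem_iff_row_length[OF D]
  fix b assume "b \<in> (\<lambda>r. (r, row_length D r - 1)) ` {r. row_length D (Suc r) < row_length D r}"
  then obtain r where r: "b = (r, row_length D r - 1)" "row_length D (Suc r) < row_length D r" by auto
  have "b \<in> D" using r mem by auto
  moreover have "order_ideal (D - {b})"
    unfolding order_ideal_def
  proof (intro conjI allI impI)
    show "finite (D - {b})" using order_ideal_finite[OF D] by simp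
    fix r' c' x y assume *: "(r', c') \<in> D - {b} \<and> x \<le> r' \<and> y \<le> c'"
    then have "(x, y) \<in> D" using order_idealD[OF D] by blast
    moreover have "(x, y) \<noteq> b"
    proof
      assume eq: "(x, y) = b"
      show False
      proof (cases "r' = r")
        case True
        then have "c' < row_length D r" using * mem by auto
        then show False using * eq r True by auto
      next
        case False
        then have "(Suc r, row_length D r - 1) \<in> D" using * eq r order_idealD[OF D, of r' c'] by auto
        then show False using r mem by auto
      qed
    qed
    ultimately show "(x, y) \<in> D - {b}" by simp
  qed
  ultimately show "b \<in> removable D" by (simp add: removable_def)
qed

lemma addable_rows:
  assumes D: "order_ideal D"
  shows "addable D = (\<lambda>r. (r, row_length D r)) ` insert 0 (Suc ` {r. row_length D (Suc r) < row_length D r})"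
    (is "_ = _ ` ?R")
proof (intro equalityI subsetI)
  note mem = mem_iff_row_length[OF D]
  fix b assume b: "b \<in> addable D"
  obtain r c where rc: "b = (r, c)" by force
  have nin: "(r, c) \<notin> D" and ins: "order_ideal (insert (r, c) D)" using b by (auto simp: addable_def rc)
  have "\<not> row_length D r < c"
  proof
    assume "row_length D r < c"
    then have "(r, row_length D r) \<in> D"
      using order_idealD[OF ins, of r c r "row_length D r"] by auto
    then show False using mem by simp
  qed
  then have c: "c = row_length D r" using nin mem by simp
  have "r \<in> ?R"
  proof (cases r)
    case (Suc r')
    then have "(r', c) \<in> D" using order_idealD[OF ins, of r c r' c] by auto
    then show ?thesis using Suc c mem by auto
  qed simp
  then show "b \<in> (\<lambda>r. (r, row_length D r)) ` ?R" unfolding rc c by (rule imageI)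
next
  note mem = mem_iff_row_length[OF D]
  fix b assume "b \<in> (\<lambda>r. (r, row_length D r)) ` ?R"
  then obtain r where r: "b = (r, row_length D r)" "r \<in> ?R" by auto
  have "order_ideal (insert b D)"
    unfolding order_ideal_def
  proof (intro conjI allI impI)
    show "finite (insert b D)" using order_ideal_finite[OF D] by simp
    fix r' c' x y assume *: "(r', c') \<in> insert b D \<and> x \<le> r' \<and> y \<le> c'"
    show "(x, y) \<in> insert b D"
    proof (cases "(r', c') = b")
      case False
      then show ?thesis using * order_idealD[OF D] by blast
    next
      case True
      then have xy: "x \<le> r" "y \<le> row_length D r" using * r by auto
      show ?thesis
      proof (cases "x = r")
        case True
        then show ?thesis using xy r mem by (cases "y = row_length D r") auto
      next
        case False
        then obtain k where k: "r = Suc k" "row_length D (Suc k) < row_length D k" using xy r by auto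
        then have "row_length D k \<le> row_length D x" using False xy by (intro row_length_antimono[OF D]) auto
        then show ?thesis using xy k mem by auto
      qed
    qed
  qed
  moreover have "b \<notin> D" using r mem by simp
  ultimately show "b \<in> addable D" by (simp add: addable_def)
qed

text \<open>A row below the first one can be lengthened if and only if the row above it can be shortened.\<close>

lemma card_addable:
  assumes D: "order_ideal D"
  shows "card (addable D) = Suc (card (removable D))" "finite (addable D)" "finite (removable D)"
proof -
  let ?R = "{r. row_length D (Suc r) < row_length D r}"
  have "?R \<subseteq> fst ` D"
  proof
    fix r assume "r \<in> ?R"
    then have "(r, 0) \<in> D" using mem_iff_row_length[OF D] by auto
    then show "r \<in> fst ` D" by force
  qed
  then have fin: "finite ?R" using order_ideal_finite[OF D] finite_surj by blast
  have "card (addable D) = card (insert 0 (Suc ` ?R))"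
    unfolding addable_rows[OF D] by (rule card_image) (auto simp: inj_on_def)
  also have "\<dots> = Suc (card ?R)"
    using fin by (subst card_insert_disjoint) (auto simp: card_image)
  also have "card ?R = card (removable D)"
    unfolding removable_rows[OF D] by (rule card_image[symmetric]) (auto simp: inj_on_def)
  finally show "card (addable D) = Suc (card (removable D))" .
  show "finite (addable D)" "finite (removable D)"
    unfolding addable_rows[OF D] removable_rows[OF D] using fin by auto
qed

text \<open>The standard tableaux of a shape given as a set of boxes, with monotonicity in the product order;
  see \<open>Stab_eq_standard_fillings\<close>.\<close>

definition standard_fillings :: "(nat \<times> nat) set \<Rightarrow> filling set"
  where "standard_fillings D = {T \<in> extensional D. bij_betw T D {1..card D} \<and>
    (\<forall>r c r' c'. (r, c) \<in> D \<and> (r', c') \<in> D \<and> r \<le> r' \<and> c \<le> c' \<and> (r, c) \<noteq> (r', c') \<longrightarrow>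
       T (r, c) < T (r', c'))}"

lemma finite_standard_fillings: "finite D \<Longrightarrow> finite (standard_fillings D)"
  by (rule finite_subset[of _ "D \<rightarrow>\<^sub>E {1..card D}"])
    (auto simp: standard_fillings_def PiE_def dest: bij_betwE intro: finite_PiE[unfolded PiE_def])

text \<open>Deleting the box of the largest entry is inverse to inserting it.\<close>

lemma standard_fillings_remove_max:
  assumes D: "order_ideal D" and b: "b \<in> removable D"
  shows "card {T \<in> standard_fillings D. T b = card D} = card (standard_fillings (D - {b}))"
proof -
  note fin = order_ideal_finite[OF D]
  have bD: "b \<in> D" and del: "order_ideal (D - {b})" using b by (auto simp: removable_def)
  have cD: "card D = Suc (card (D - {b}))" using bD fin by (metis card_Suc_Diff1)
  have set: "{1..card D} = insert (card D) {1..card (D - {b})}" unfolding cD by auto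
  have "bij_betw (\<lambda>T. restrict T (D - {b})) {T \<in> standard_fillings D. T b = card D} (standard_fillings (D - {b}))"
  proof (rule bij_betw_byWitness[where f' = "\<lambda>T. T(b := card D)"])
    show "\<forall>T\<in>{T \<in> standard_fillings D. T b = card D}. (restrict T (D - {b}))(b := card D) = T"
    proof clarify
      fix T assume "T \<in> standard_fillings D" "T b = card D"
      then have "((restrict T (D - {b}))(b := card D)) x = T x" for x
        using extensional_arb[of T D x] by (simp add: standard_fillings_def)
      then show "(restrict T (D - {b}))(b := card D) = T" ..
    qed
    show "\<forall>T\<in>standard_fillings (D - {b}). restrict (T(b := card D)) (D - {b}) = T"
    proof
      fix T assume "T \<in> standard_fillings (D - {b})"
      then have "restrict (T(b := card D)) (D - {b}) x = T x" for x
        using extensional_arb[of T "D - {b}" x] by (simp add: standard_fillings_def restrict_def)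
      then show "restrict (T(b := card D)) (D - {b}) = T" ..
    qed
    show "(\<lambda>T. restrict T (D - {b})) ` {T \<in> standard_fillings D. T b = card D} \<subseteq> standard_fillings (D - {b})"
    proof (intro subsetI, elim imageE, clarify)
      fix T assume T: "T \<in> standard_fillings D" and Tb: "T b = card D"
      have bij: "bij_betw T D {1..card D}" using T by (simp add: standard_fillings_def)
      have "T ` (D - {b}) = {1..card D} - {card D}"
        using bij bD Tb by (simp add: bij_betw_def inj_on_image_set_diff[of T D])
      then have "bij_betw T (D - {b}) ({1..card D} - {card D})"
        using bij by (intro bij_betw_subset[OF bij]) auto
      moreover have "{1..card D} - {card D} = {1..card (D - {b})}" unfolding cD by auto
      ultimately have "bij_betw (restrict T (D - {b})) (D - {b}) {1..card (D - {b})}"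
        by (metis bij_betw_restrict_eq)
      then show "restrict T (D - {b}) \<in> standard_fillings (D - {b})"
        using T by (auto simp: standard_fillings_def)
    qed
    show "(\<lambda>T. T(b := card D)) ` standard_fillings (D - {b}) \<subseteq> {T \<in> standard_fillings D. T b = card D}"
    proof (intro subsetI, elim imageE, clarify)
      fix T assume T: "T \<in> standard_fillings (D - {b})"
      have bij: "bij_betw T (D - {b}) {1..card (D - {b})}" using T by (simp add: standard_fillings_def)
      have "bij_betw (T(b := card D)) (insert b (D - {b})) (insert (card D) {1..card (D - {b})})"
      proof -
        have "bij_betw (T(b := card D)) (D - {b}) {1..card (D - {b})}"
          using bij by (rule bij_betw_cong[THEN iffD1, rotated]) auto
        then show ?thesis
          using notIn_Un_bij_betw[of b "D - {b}" "T(b := card D)" "{1..card (D - {b})}"] cD by simp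
      qed
      then have bij': "bij_betw (T(b := card D)) D {1..card D}"
        unfolding set using bD by (simp add: insert_absorb)
      have small: "T x < card D" if "x \<in> D - {b}" for x
      proof -
        have "T x \<le> card (D - {b})" using bij_betwE[OF bij] that by auto
        then show ?thesis unfolding cD by simp
      qed
      have "(T(b := card D)) (r, c) < (T(b := card D)) (r', c')"
        if "(r, c) \<in> D" "(r', c') \<in> D" "r \<le> r'" "c \<le> c'" "(r, c) \<noteq> (r', c')" for r c r' c'
      proof (cases "(r, c) = b")
        case True
        then have "(r, c) \<in> D - {b}"
          using order_idealD[OF del, of r' c' r c] that by auto
        then show ?thesis using True by simp
      next
        case False
        then show ?thesis
          using that small[of "(r, c)"] T by (cases "(r', c') = b") (auto simp: standard_fillings_def)
      qed
      then show "T(b := card D) \<in> standard_fillings D \<and> (T(b := card D)) b = card D"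
        using bij' T bD by (auto simp: standard_fillings_def extensional_def)
    qed
  qed
  then show ?thesis by (rule bij_betw_same_card)
qed

lemma card_standard_fillings_rec:
  assumes D: "order_ideal D" and ne: "D \<noteq> {}"
  shows "card (standard_fillings D) = (\<Sum>b\<in>removable D. card (standard_fillings (D - {b})))"
proof -
  note fin = order_ideal_finite[OF D]
  have un: "standard_fillings D = (\<Union>b\<in>removable D. {T \<in> standard_fillings D. T b = card D})"
  proof (intro equalityI subsetI)
    fix T assume T: "T \<in> standard_fillings D"
    then have bij: "bij_betw T D {1..card D}" by (simp add: standard_fillings_def)
    have "card D \<in> {1..card D}" using ne fin by (simp add: Suc_le_eq card_gt_0_iff)
    then obtain b where b: "b \<in> D" "T b = card D" using bij by (metis bij_betw_iff_bijections)
    have "order_ideal (D - {b})"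
      unfolding order_ideal_def
    proof (intro conjI allI impI)
      show "finite (D - {b})" using fin by simp
      fix r' c' r c assume *: "(r', c') \<in> D - {b} \<and> r \<le> r' \<and> c \<le> c'"
      then have "(r, c) \<in> D" using order_idealD[OF D] by blast
      moreover have "(r, c) \<noteq> b"
      proof
        assume eq: "(r, c) = b"
        have "(r, c) \<noteq> (r', c')" using * eq by auto
        then have "T (r, c) < T (r', c')"
          using T * eq b(1) unfolding standard_fillings_def by blast
        moreover have "T (r', c') \<le> card D" using bij_betwE[OF bij] * by auto
        ultimately show False using eq b by simp
      qed
      ultimately show "(r, c) \<in> D - {b}" by simp
    qed
    then show "T \<in> (\<Union>b\<in>removable D. {T \<in> standard_fillings D. T b = card D})"
      using T b unfolding removable_def by blast
  qed auto
  have "card (standard_fillings D) = (\<Sum>b\<in>removable D. card {T \<in> standard_fillings D. T b = card D})"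
  proof (subst un, rule card_UN_disjoint)
    show "finite (removable D)" by (rule card_addable(3)[OF D])
    show "\<forall>b\<in>removable D. finite {T \<in> standard_fillings D. T b = card D}"
      using finite_standard_fillings[OF fin] by simp
    show "\<forall>b\<in>removable D. \<forall>c\<in>removable D. b \<noteq> c \<longrightarrow>
        {T \<in> standard_fillings D. T b = card D} \<inter> {T \<in> standard_fillings D. T c = card D} = {}"
    proof (intro ballI impI)
      fix b c assume "b \<in> removable D" "c \<in> removable D" "b \<noteq> c"
      then have ne: "T b \<noteq> T c" if "T \<in> standard_fillings D" for T
        using that inj_onD[of T D b c] by (auto simp: removable_def standard_fillings_def bij_betw_def)
      then show "{T \<in> standard_fillings D. T b = card D} \<inter> {T \<in> standard_fillings D. T c = card D} = {}"
        using ne by (intro equals0I) (simp, metis)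
    qed
  qed
  then show ?thesis
    using standard_fillings_remove_max[OF D] by simp
qed

lemma order_ideal_Un:
  assumes D: "order_ideal D" and E: "order_ideal E"
  shows "order_ideal (D \<union> E)"
  unfolding order_ideal_def
proof (intro conjI allI impI)
  show "finite (D \<union> E)" using order_ideal_finite[OF D] order_ideal_finite[OF E] by simp
  fix r' c' r c assume "(r', c') \<in> D \<union> E \<and> r \<le> r' \<and> c \<le> c'"
  then show "(r, c) \<in> D \<union> E"
    using order_idealD[OF D, of r' c' r c] order_idealD[OF E, of r' c' r c] by auto
qed

lemma order_ideal_Int:
  assumes D: "order_ideal D" and E: "order_ideal E"
  shows "order_ideal (D \<inter> E)"
  unfolding order_ideal_def
proof (intro conjI allI impI)
  show "finite (D \<inter> E)" using order_ideal_finite[OF D] by simp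
  fix r' c' r c assume "(r', c') \<in> D \<inter> E \<and> r \<le> r' \<and> c \<le> c'"
  then show "(r, c) \<in> D \<inter> E"
    using order_idealD[OF D, of r' c' r c] order_idealD[OF E, of r' c' r c] by auto
qed

lemma add_then_remove_iff:
  assumes D: "order_ideal D" and ne: "b \<noteq> c"
  shows "b \<in> addable D \<and> c \<in> removable (insert b D) \<longleftrightarrow> c \<in> removable D \<and> b \<in> addable (D - {c})"
proof
  assume *: "b \<in> addable D \<and> c \<in> removable (insert b D)"
  then have ins: "order_ideal (insert b D - {c})" and b: "b \<notin> D" and c: "c \<in> D"
    using ne by (auto simp: removable_def addable_def)
  have "insert b D - {c} = insert b (D - {c})" "D \<inter> (insert b D - {c}) = D - {c}"
    using ne by auto
  then have "order_ideal (insert b (D - {c}))" "order_ideal (D - {c})"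
    using ins order_ideal_Int[OF D ins] by simp_all
  then show "c \<in> removable D \<and> b \<in> addable (D - {c})"
    using b c by (simp add: removable_def addable_def)
next
  assume *: "c \<in> removable D \<and> b \<in> addable (D - {c})"
  then have ins: "order_ideal (insert b (D - {c}))" and b: "b \<notin> D" and c: "c \<in> D"
    using ne by (auto simp: removable_def addable_def)
  have "insert b (D - {c}) = insert b D - {c}" "D \<union> insert b (D - {c}) = insert b D"
    using ne by auto
  then have "order_ideal (insert b D - {c})" "order_ideal (insert b D)"
    using ins order_ideal_Un[OF D ins] by metis+
  then show "b \<in> addable D \<and> c \<in> removable (insert b D)"
    using b c ne by (simp add: removable_def addable_def)
qed

text \<open>The relation \<open>D U - U D = 1\<close> for the up and down operators of Young's lattice, applied to the
  function counting standard tableaux and combined with the induction hypothesis for the shapes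
  with one box less.\<close>

lemma sum_addable:
  assumes "order_ideal D"
  shows "(\<Sum>b\<in>addable D. card (standard_fillings (insert b D))) = Suc (card D) * card (standard_fillings D)"
  using assms
proof (induction "card D" arbitrary: D rule: less_induct)
  case (less D)
  note D = less.prems
  let ?f = "\<lambda>D. card (standard_fillings D)"
  note fin = card_addable(2,3)[OF D]
  have step: "?f (insert b D) = ?f D + (\<Sum>c\<in>removable (insert b D) - {b}. ?f (insert b D - {c}))"
    if b: "b \<in> addable D" for b
  proof -
    have ib: "order_ideal (insert b D)" "b \<notin> D" using b by (auto simp: addable_def)
    have "b \<in> removable (insert b D)" using D ib by (simp add: removable_def)
    then show ?thesis
      using card_standard_fillings_rec[OF ib(1)] card_addable(3)[OF ib(1)] ib(2)
      by (simp add: sum.remove)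
  qed
  have swap: "(\<Sum>b\<in>addable D. \<Sum>c\<in>removable (insert b D) - {b}. ?f (insert b D - {c})) =
      (\<Sum>c\<in>removable D. \<Sum>b\<in>addable (D - {c}) - {c}. ?f (insert b (D - {c})))"
  proof -
    let ?A = "Sigma (addable D) (\<lambda>b. removable (insert b D) - {b})"
    let ?B = "Sigma (removable D) (\<lambda>c. addable (D - {c}) - {c})"
    have finA: "\<forall>b\<in>addable D. finite (removable (insert b D) - {b})"
      using card_addable(3) by (auto simp: addable_def)
    have finB: "\<forall>c\<in>removable D. finite (addable (D - {c}) - {c})"
      using card_addable(2) by (auto simp: removable_def)
    have "(\<Sum>b\<in>addable D. \<Sum>c\<in>removable (insert b D) - {b}. ?f (insert b D - {c})) =
        (\<Sum>(b, c)\<in>?A. ?f (insert b D - {c}))"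
      by (rule sum.Sigma[OF fin(1) finA])
    also have "\<dots> = (\<Sum>(c, b)\<in>?B. ?f (insert b (D - {c})))"
    proof (rule sum.reindex_bij_witness[of _ prod.swap prod.swap])
      fix p assume p: "p \<in> ?A"
      obtain b c where bc: "p = (b, c)" by (cases p)
      then have "b \<noteq> c" "b \<in> addable D \<and> c \<in> removable (insert b D)" using p by auto
      then show "prod.swap p \<in> ?B"
        using add_then_remove_iff[OF D, of b c] unfolding bc by simp
    next
      fix p assume p: "p \<in> ?B"
      obtain c b where bc: "p = (c, b)" by (cases p)
      then have "b \<noteq> c" "c \<in> removable D \<and> b \<in> addable (D - {c})" using p by auto
      then have "b \<in> addable D \<and> c \<in> removable (insert b D)" "c \<noteq> b"
        using add_then_remove_iff[OF D, of b c] by simp_all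
      then show "prod.swap p \<in> ?A" unfolding bc by simp
    next
      fix p assume p: "p \<in> ?A"
      obtain b c where bc: "p = (b, c)" by (cases p)
      then have "b \<noteq> c" using p by auto
      then have "insert b (D - {c}) = insert b D - {c}" by auto
      then show "(case prod.swap p of (c, b) \<Rightarrow> ?f (insert b (D - {c}))) =
          (case p of (b, c) \<Rightarrow> ?f (insert b D - {c}))"
        unfolding bc by simp
    qed auto
    also have "\<dots> = (\<Sum>c\<in>removable D. \<Sum>b\<in>addable (D - {c}) - {c}. ?f (insert b (D - {c})))"
      by (rule sum.Sigma[OF fin(2) finB, symmetric])
    finally show ?thesis .
  qed
  have inner: "?f D + (\<Sum>b\<in>addable (D - {c}) - {c}. ?f (insert b (D - {c}))) = card D * ?f (D - {c})"
    if c: "c \<in> removable D" for c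
  proof -
    have cD: "c \<in> D" "order_ideal (D - {c})" using c by (auto simp: removable_def)
    have cardD: "Suc (card (D - {c})) = card D"
      using cD(1) order_ideal_finite[OF D] by (metis card_Suc_Diff1)
    have ins: "insert c (D - {c}) = D" using cD by auto
    then have "c \<in> addable (D - {c})" using D by (simp add: addable_def)
    then have "?f D + (\<Sum>b\<in>addable (D - {c}) - {c}. ?f (insert b (D - {c}))) =
        (\<Sum>b\<in>addable (D - {c}). ?f (insert b (D - {c})))"
      using card_addable(2)[OF cD(2)] ins by (simp add: sum.remove)
    also have "\<dots> = card D * ?f (D - {c})"
      using less.hyps[OF _ cD(2)] cardD by simp
    finally show ?thesis .
  qed
  have "(\<Sum>b\<in>addable D. ?f (insert b D)) =
      card (addable D) * ?f D + (\<Sum>c\<in>removable D. \<Sum>b\<in>addable (D - {c}) - {c}. ?f (insert b (D - {c})))"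
    using step by (simp add: sum.distrib swap)
  also have "\<dots> = ?f D + (\<Sum>c\<in>removable D. ?f D + (\<Sum>b\<in>addable (D - {c}) - {c}. ?f (insert b (D - {c}))))"
    using card_addable(1)[OF D] by (simp add: sum.distrib)
  also have "\<dots> = ?f D + card D * (\<Sum>c\<in>removable D. ?f (D - {c}))"
    using inner by (simp add: sum_distrib_left)
  also have "\<dots> = Suc (card D) * ?f D"
    using card_standard_fillings_rec[OF D] by (cases "D = {}") simp_all
  finally show ?case .
qed

definition order_ideals :: "nat \<Rightarrow> (nat \<times> nat) set set"
  where "order_ideals d = {D. order_ideal D \<and> card D = d}"

lemma finite_order_ideals: "finite (order_ideals d)"
proof (rule finite_subset)
  show "order_ideals d \<subseteq> Pow ({..<d} \<times> {..<d})"
  proof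
    fix D assume D: "D \<in> order_ideals d"
    have "r < d \<and> c < d" if rc: "(r, c) \<in> D" for r c
    proof -
      have "(\<lambda>x. (x, c)) ` {..r} \<subseteq> D" "(\<lambda>y. (r, y)) ` {..c} \<subseteq> D" "finite D"
        using D order_idealD[OF _ rc] order_ideal_finite by (auto simp: order_ideals_def)
      then have "card ((\<lambda>x. (x, c)) ` {..r}) \<le> d" "card ((\<lambda>y. (r, y)) ` {..c}) \<le> d"
        using D by (auto simp: order_ideals_def intro: card_mono)
      then show ?thesis by (simp add: card_image inj_on_def)
    qed
    then show "D \<in> Pow ({..<d} \<times> {..<d})" by auto
  qed
qed simp

text \<open>Expanding one factor of each square by the removal recursion turns the sum over pairs of a shape and
  a removable box into one over pairs of a smaller shape and an addable box.\<close>

lemma sum_squares_standard_fillings: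
  "(\<Sum>D\<in>order_ideals d. card (standard_fillings D) * card (standard_fillings D)) = fact d"
proof (induction d)
  case 0
  have "order_ideals 0 = {{}}" by (auto simp: order_ideals_def order_ideal_def)
  moreover have "standard_fillings {} = {\<lambda>_. undefined}"
    by (auto simp: standard_fillings_def bij_betw_def)
  ultimately show ?case by simp
next
  case (Suc d)
  let ?f = "\<lambda>D. card (standard_fillings D)"
  let ?A = "Sigma (order_ideals (Suc d)) removable" and ?B = "Sigma (order_ideals d) addable"
  have "(\<Sum>D\<in>order_ideals (Suc d). ?f D * ?f D) =
      (\<Sum>D\<in>order_ideals (Suc d). \<Sum>b\<in>removable D. ?f D * ?f (D - {b}))"
  proof (intro sum.cong refl)
    fix D assume "D \<in> order_ideals (Suc d)"
    then have "order_ideal D" "D \<noteq> {}" by (auto simp: order_ideals_def)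
    then show "?f D * ?f D = (\<Sum>b\<in>removable D. ?f D * ?f (D - {b}))"
      using card_standard_fillings_rec by (simp add: sum_distrib_left)
  qed
  also have "\<dots> = (\<Sum>(D, b)\<in>?A. ?f D * ?f (D - {b}))"
    using card_addable(3) by (intro sum.Sigma finite_order_ideals) (auto simp: order_ideals_def)
  also have "\<dots> = (\<Sum>(D, b)\<in>?B. ?f (insert b D) * ?f D)"
  proof (rule sum.reindex_bij_witness[of _ "\<lambda>(D, b). (insert b D, b)" "\<lambda>(D, b). (D - {b}, b)"])
    fix p assume "p \<in> ?A"
    then show "(case p of (D, b) \<Rightarrow> (D - {b}, b)) \<in> ?B"
      by (auto simp: order_ideals_def removable_def addable_def insert_absorb)
  next
    fix p assume "p \<in> ?B"
    then show "(case p of (D, b) \<Rightarrow> (insert b D, b)) \<in> ?A"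
      by (auto simp: order_ideals_def removable_def addable_def order_ideal_finite)
  qed (auto simp: removable_def addable_def insert_absorb)
  also have "\<dots> = (\<Sum>D\<in>order_ideals d. \<Sum>b\<in>addable D. ?f (insert b D) * ?f D)"
    using card_addable(2) by (intro sum.Sigma[symmetric] finite_order_ideals) (auto simp: order_ideals_def)
  also have "\<dots> = (\<Sum>D\<in>order_ideals d. Suc d * (?f D * ?f D))"
  proof (intro sum.cong refl)
    fix D assume "D \<in> order_ideals d"
    then have "order_ideal D" "card D = d" by (auto simp: order_ideals_def)
    then show "(\<Sum>b\<in>addable D. ?f (insert b D) * ?f D) = Suc d * (?f D * ?f D)"
      using sum_addable[of D] by (simp only: sum_distrib_right[symmetric] mult.assoc)
  qed
  finally show ?case by (simp only: sum_distrib_left[symmetric] Suc fact_Suc of_nat_id)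
qed

lemma order_ideal_boxes:
  assumes "young_diagram d lam"
  shows "order_ideal (boxes lam)"
proof -
  interpret young d lam by unfold_locales (rule assms)
  show ?thesis unfolding order_ideal_def using finite_boxes boxes_down_closed by blast
qed

lemma Stab_eq_standard_fillings:
  assumes "young_diagram d lam"
  shows "Stab lam = standard_fillings (boxes lam)"
proof -
  interpret young d lam by unfold_locales (rule assms)
  show ?thesis
  proof (intro equalityI subsetI)
    fix T assume T: "T \<in> Stab lam"
    then show "T \<in> standard_fillings (boxes lam)"
      using Stab_mono[OF T] by (auto simp: standard_fillings_def Stab_def fillings_def card_boxes sum_lam)
  next
    fix T assume "T \<in> standard_fillings (boxes lam)"
    then show "T \<in> Stab lam"
      by (auto simp: standard_fillings_def Stab_def fillings_def card_boxes sum_lam)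
  qed
qed

lemma ex_young_diagram_of_order_ideal:
  assumes D: "order_ideal D"
  shows "\<exists>lam. young_diagram (card D) lam \<and> boxes lam = D"
proof -
  have "finite {r. (r, 0) \<in> D}"
    by (rule finite_subset[OF _ finite_imageI[OF order_ideal_finite[OF D], of fst]]) force
  then have "{r. (r, 0) \<in> D} = {..<card {r. (r, 0) \<in> D}}"
    by (rule initial_segment_eq) (use order_idealD[OF D] in auto)
  then obtain k where k: "(r, 0) \<in> D \<longleftrightarrow> r < k" for r by auto
  define lam where "lam = map (row_length D) [0..<k]"
  have boxes: "boxes lam = D"
  proof (intro Set.set_eqI)
    fix b :: "nat \<times> nat"
    obtain r c where rc: "b = (r, c)" by force
    have "r < k" if "(r, c) \<in> D" using k order_idealD[OF D that, of r 0] by simp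
    then show "b \<in> boxes lam \<longleftrightarrow> b \<in> D"
      using mem_iff_row_length[OF D] by (auto simp: rc boxes_def lam_def)
  qed
  have "sorted_wrt (\<ge>) lam"
    using row_length_antimono[OF D] by (auto simp: lam_def sorted_wrt_iff_nth_less)
  moreover have "\<forall>m\<in>set lam. m > 0"
    using k mem_iff_row_length[OF D] by (auto simp: lam_def)
  ultimately have yd: "young_diagram (sum_list lam) lam" by (simp add: young_diagram_def)
  then interpret young "sum_list lam" lam by unfold_locales
  show ?thesis using yd boxes card_boxes by auto
qed

lemma bij_betw_boxes: "bij_betw boxes {lam. young_diagram d lam} (order_ideals d)"
proof (rule bij_betw_imageI)
  show "inj_on boxes {lam. young_diagram d lam}"
    using boxes_inject by (auto simp: inj_on_def)
  show "boxes ` {lam. young_diagram d lam} = order_ideals d"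
  proof (intro equalityI subsetI)
    fix D assume "D \<in> boxes ` {lam. young_diagram d lam}"
    then obtain lam where lam: "young_diagram d lam" "D = boxes lam" by auto
    interpret young d lam by unfold_locales (rule lam(1))
    show "D \<in> order_ideals d"
      using order_ideal_boxes[OF lam(1)] card_boxes by (simp add: order_ideals_def lam(2))
  next
    fix D assume "D \<in> order_ideals d"
    then show "D \<in> boxes ` {lam. young_diagram d lam}"
      using ex_young_diagram_of_order_ideal[of D] by (auto simp: order_ideals_def)
  qed
qed

lemma finite_young_diagrams: "finite {lam. young_diagram d lam}"
  using bij_betw_finite[OF bij_betw_boxes] finite_order_ideals by blast

lemma sum_squares_Stab: "(\<Sum>lam | young_diagram d lam. card (Stab lam) * card (Stab lam)) = fact d"
proof -
  have "(\<Sum>lam | young_diagram d lam. card (Stab lam) * card (Stab lam)) =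
      (\<Sum>lam | young_diagram d lam. card (standard_fillings (boxes lam)) * card (standard_fillings (boxes lam)))"
    by (intro sum.cong refl) (simp add: Stab_eq_standard_fillings)
  also have "\<dots> = (\<Sum>D\<in>order_ideals d. card (standard_fillings D) * card (standard_fillings D))"
    by (rule sum.reindex_bij_betw[OF bij_betw_boxes])
  finally show ?thesis by (simp add: sum_squares_standard_fillings)
qed

section \<open>The group algebra and its linear representations\<close>

lemma bij_betw_left_translation:
  assumes "\<sigma> permutes A"
  shows "bij_betw (\<lambda>\<tau>. \<sigma> \<circ> \<tau>) {\<tau>. \<tau> permutes A} {\<tau>. \<tau> permutes A}"
proof (rule bij_betw_byWitness[where f' = "\<lambda>\<tau>. inv \<sigma> \<circ> \<tau>"])
  show "\<forall>\<tau>\<in>{\<tau>. \<tau> permutes A}. inv \<sigma> \<circ> (\<sigma> \<circ> \<tau>) = \<tau>" "\<forall>\<tau>\<in>{\<tau>. \<tau> permutes A}. \<sigma> \<circ> (inv \<sigma> \<circ> \<tau>) = \<tau>"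
    using permutes_inv_o[OF assms] by (auto simp: comp_assoc[symmetric])
qed (auto intro: permutes_compose assms permutes_inv[OF assms])

lemma bij_betw_inv_permutations:
  "bij_betw inv {\<tau>. \<tau> permutes A} {\<tau>. \<tau> permutes A}"
  by (rule bij_betw_byWitness[where f' = inv]) (auto simp: permutes_inv permutes_inv_inv)

lemma op_mult_sum_right:
  "op_mult B A (\<lambda>x y. \<Sum>j\<in>I. c j * C j x y) = (\<lambda>x y. \<Sum>j\<in>I. c j * op_mult B A (C j) x y)"
proof (intro ext)
  fix x y
  have "op_mult B A (\<lambda>x y. \<Sum>j\<in>I. c j * C j x y) x y = (\<Sum>z\<in>B. \<Sum>j\<in>I. c j * (A x z * C j z y))"
    by (simp add: op_mult_def sum_distrib_left mult.left_commute)
  also have "\<dots> = (\<Sum>j\<in>I. \<Sum>z\<in>B. c j * (A x z * C j z y))" by (rule sum.swap)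
  finally show "op_mult B A (\<lambda>x y. \<Sum>j\<in>I. c j * C j x y) x y = (\<Sum>j\<in>I. c j * op_mult B A (C j) x y)"
    by (simp add: op_mult_def sum_distrib_left)
qed

lemma op_mult_sum_left:
  "op_mult B (\<lambda>x y. \<Sum>j\<in>I. c j * C j x y) A = (\<lambda>x y. \<Sum>j\<in>I. c j * op_mult B (C j) A x y)"
proof (intro ext)
  fix x y
  have "op_mult B (\<lambda>x y. \<Sum>j\<in>I. c j * C j x y) A x y = (\<Sum>z\<in>B. \<Sum>j\<in>I. c j * (C j x z * A z y))"
    by (simp add: op_mult_def sum_distrib_right mult.assoc)
  also have "\<dots> = (\<Sum>j\<in>I. \<Sum>z\<in>B. c j * (C j x z * A z y))" by (rule sum.swap)
  finally show "op_mult B (\<lambda>x y. \<Sum>j\<in>I. c j * C j x y) A x y = (\<Sum>j\<in>I. c j * op_mult B (C j) A x y)"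
    by (simp add: op_mult_def sum_distrib_left)
qed

lemma op_mult_assoc: "op_mult B (op_mult B A C) D = op_mult B A (op_mult B C D)"
proof (intro ext)
  fix x y
  have "op_mult B (op_mult B A C) D x y = (\<Sum>z\<in>B. \<Sum>w\<in>B. A x w * (C w z * D z y))"
    by (simp add: op_mult_def sum_distrib_right mult.assoc)
  also have "\<dots> = (\<Sum>w\<in>B. \<Sum>z\<in>B. A x w * (C w z * D z y))" by (rule sum.swap)
  finally show "op_mult B (op_mult B A C) D x y = op_mult B A (op_mult B C D) x y"
    by (simp add: op_mult_def sum_distrib_left)
qed

lemma op_mult_zero: "op_mult B op_zero A = op_zero" "op_mult B A op_zero = op_zero"
  by (simp_all add: op_mult_def op_zero_def)

lemma lin_ext_ga_mult:
  assumes hom: "\<And>\<sigma> \<tau>. \<sigma> permutes {1..d} \<Longrightarrow> \<tau> permutes {1..d} \<Longrightarrow> \<phi> (\<sigma> \<circ> \<tau>) = op_mult B (\<phi> \<sigma>) (\<phi> \<tau>)"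
  shows "lin_ext d \<phi> (ga_mult d x y) = op_mult B (lin_ext d \<phi> x) (lin_ext d \<phi> y)"
proof (intro ext)
  fix a b
  let ?S = "{\<sigma>. \<sigma> permutes {1..d}}"
  have "lin_ext d \<phi> (ga_mult d x y) a b = (\<Sum>\<pi>\<in>?S. \<Sum>\<sigma>\<in>?S. x \<sigma> * (y (inv \<sigma> \<circ> \<pi>) * \<phi> \<pi> a b))"
    by (simp add: lin_ext_def ga_mult_def sum_distrib_right mult.assoc)
  also have "\<dots> = (\<Sum>\<sigma>\<in>?S. \<Sum>\<pi>\<in>?S. x \<sigma> * (y (inv \<sigma> \<circ> \<pi>) * \<phi> \<pi> a b))" by (rule sum.swap)
  also have "\<dots> = (\<Sum>\<sigma>\<in>?S. \<Sum>\<tau>\<in>?S. x \<sigma> * (y \<tau> * op_mult B (\<phi> \<sigma>) (\<phi> \<tau>) a b))"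
  proof (rule sum.cong[OF refl])
    fix \<sigma> assume "\<sigma> \<in> ?S"
    then have \<sigma>: "\<sigma> permutes {1..d}" by simp
    have "(\<Sum>\<pi>\<in>?S. x \<sigma> * (y (inv \<sigma> \<circ> \<pi>) * \<phi> \<pi> a b)) =
        (\<Sum>\<tau>\<in>?S. x \<sigma> * (y (inv \<sigma> \<circ> (\<sigma> \<circ> \<tau>)) * \<phi> (\<sigma> \<circ> \<tau>) a b))"
      by (rule sum.reindex_bij_betw[OF bij_betw_left_translation[OF \<sigma>], symmetric])
    also have "\<dots> = (\<Sum>\<tau>\<in>?S. x \<sigma> * (y \<tau> * op_mult B (\<phi> \<sigma>) (\<phi> \<tau>) a b))"
      using permutes_inv_o(2)[OF \<sigma>]
      by (intro sum.cong refl) (simp add: hom[OF \<sigma>] comp_assoc[symmetric])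
    finally show "(\<Sum>\<pi>\<in>?S. x \<sigma> * (y (inv \<sigma> \<circ> \<pi>) * \<phi> \<pi> a b)) =
        (\<Sum>\<tau>\<in>?S. x \<sigma> * (y \<tau> * op_mult B (\<phi> \<sigma>) (\<phi> \<tau>) a b))" .
  qed
  also have "\<dots> = op_mult B (lin_ext d \<phi> x) (lin_ext d \<phi> y) a b"
    unfolding lin_ext_def op_mult_sum_left op_mult_sum_right by (simp add: sum_distrib_left)
  finally show "lin_ext d \<phi> (ga_mult d x y) a b = op_mult B (lin_ext d \<phi> x) (lin_ext d \<phi> y) a b" .
qed

lemma finite_permutes: "finite {\<sigma>. \<sigma> permutes {1..d::nat}}"
  by (rule finite_permutations) simp

lemma lin_ext_ga_of:
  assumes "\<sigma> permutes {1..d}"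
  shows "lin_ext d \<phi> (ga_of \<sigma>) = \<phi> \<sigma>"
proof (intro ext)
  fix a b
  have "lin_ext d \<phi> (ga_of \<sigma>) a b = (\<Sum>\<tau> | \<tau> permutes {1..d}. if \<tau> = \<sigma> then \<phi> \<tau> a b else 0)"
    unfolding lin_ext_def ga_of_def by (intro sum.cong refl) simp
  also have "\<dots> = \<phi> \<sigma> a b" using assms by (subst sum.delta[OF finite_permutes]) simp_all
  finally show "lin_ext d \<phi> (ga_of \<sigma>) a b = \<phi> \<sigma> a b" .
qed

lemma lin_ext_sum:
  "lin_ext d \<phi> (\<lambda>\<sigma>. \<Sum>j\<in>I. c j * x j \<sigma>) a b = (\<Sum>j\<in>I. c j * lin_ext d \<phi> (x j) a b)"
proof -
  have "lin_ext d \<phi> (\<lambda>\<sigma>. \<Sum>j\<in>I. c j * x j \<sigma>) a b =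
      (\<Sum>\<sigma> | \<sigma> permutes {1..d}. \<Sum>j\<in>I. c j * (x j \<sigma> * \<phi> \<sigma> a b))"
    by (simp add: lin_ext_def sum_distrib_right mult.assoc)
  also have "\<dots> = (\<Sum>j\<in>I. \<Sum>\<sigma> | \<sigma> permutes {1..d}. c j * (x j \<sigma> * \<phi> \<sigma> a b))" by (rule sum.swap)
  finally show ?thesis by (simp add: lin_ext_def sum_distrib_left)
qed

lemma lin_ext_scale: "lin_ext d \<phi> (\<lambda>\<sigma>. c * x \<sigma>) a b = c * lin_ext d \<phi> x a b"
  by (simp add: lin_ext_def sum_distrib_left mult.assoc)

lemma lin_ext_diff: "lin_ext d \<phi> (\<lambda>\<sigma>. x \<sigma> - y \<sigma>) a b = lin_ext d \<phi> x a b - lin_ext d \<phi> y a b"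
  by (simp add: lin_ext_def sum_subtractf left_diff_distrib)

definition ga_star :: "nat \<Rightarrow> group_alg \<Rightarrow> group_alg"
  where "ga_star d x = (\<lambda>\<sigma>. if \<sigma> permutes {1..d} then cnj (x (inv \<sigma>)) else 0)"

lemma lin_ext_ga_star:
  assumes inv: "\<And>\<sigma> a b. \<sigma> permutes {1..d} \<Longrightarrow> \<phi> (inv \<sigma>) a b = cnj (\<phi> \<sigma> b a)"
  shows "lin_ext d \<phi> (ga_star d x) = op_adj (lin_ext d \<phi> x)"
proof (intro ext)
  fix a b
  let ?S = "{\<sigma>. \<sigma> permutes {1..d}}"
  have "lin_ext d \<phi> (ga_star d x) a b = (\<Sum>\<sigma>\<in>?S. cnj (x (inv \<sigma>)) * \<phi> \<sigma> a b)"
    by (simp add: lin_ext_def ga_star_def)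
  also have "\<dots> = (\<Sum>\<sigma>\<in>?S. cnj (x (inv (inv \<sigma>))) * \<phi> (inv \<sigma>) a b)"
    by (rule sum.reindex_bij_betw[OF bij_betw_inv_permutations, symmetric])
  also have "\<dots> = (\<Sum>\<sigma>\<in>?S. cnj (x \<sigma> * \<phi> \<sigma> b a))"
    by (intro sum.cong refl) (auto simp: permutes_inv_inv inv)
  finally show "lin_ext d \<phi> (ga_star d x) a b = op_adj (lin_ext d \<phi> x) a b"
    by (simp add: op_adj_def lin_ext_def)
qed

lemma ga_of_in: "\<sigma> permutes {1..d} \<Longrightarrow> ga_of \<sigma> \<in> group_algebra d"
  by (simp add: group_algebra_def ga_of_def)

lemma ga_star_in: "ga_star d x \<in> group_algebra d"
  by (simp add: group_algebra_def ga_star_def)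

lemma ga_sum_in:
  assumes "\<And>j. j \<in> I \<Longrightarrow> x j \<in> group_algebra d"
  shows "(\<lambda>\<sigma>. \<Sum>j\<in>I. c j * x j \<sigma>) \<in> group_algebra d"
  unfolding group_algebra_def
proof (intro CollectI allI impI)
  fix \<sigma> assume "(\<Sum>j\<in>I. c j * x j \<sigma>) \<noteq> 0"
  then obtain j where "j \<in> I" "c j * x j \<sigma> \<noteq> 0" by (rule sum.not_neutral_contains_not_neutral)
  then show "\<sigma> permutes {1..d}" using assms[of j] unfolding group_algebra_def by auto
qed

lemma ga_scale_in: "x \<in> group_algebra d \<Longrightarrow> (\<lambda>\<sigma>. c * x \<sigma>) \<in> group_algebra d"
  by (simp add: group_algebra_def)

lemma ga_diff_in:
  assumes "x \<in> group_algebra d" "y \<in> group_algebra d"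
  shows "(\<lambda>\<sigma>. x \<sigma> - y \<sigma>) \<in> group_algebra d"
  unfolding group_algebra_def
proof (intro CollectI allI impI)
  fix \<sigma> assume "x \<sigma> - y \<sigma> \<noteq> 0"
  then have "x \<sigma> \<noteq> 0 \<or> y \<sigma> \<noteq> 0" by auto
  then show "\<sigma> permutes {1..d}" using assms unfolding group_algebra_def by blast
qed

lemma ga_mult_in:
  assumes "y \<in> group_algebra d"
  shows "ga_mult d x y \<in> group_algebra d"
  unfolding group_algebra_def
proof (intro CollectI allI impI)
  fix \<pi> assume "ga_mult d x y \<pi> \<noteq> 0"
  then obtain \<sigma> where "\<sigma> \<in> {\<sigma>. \<sigma> permutes {1..d}}" "x \<sigma> * y (inv \<sigma> \<circ> \<pi>) \<noteq> 0"
    unfolding ga_mult_def by (rule sum.not_neutral_contains_not_neutral)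
  then have \<sigma>: "\<sigma> permutes {1..d}" "y (inv \<sigma> \<circ> \<pi>) \<noteq> 0" by auto
  then have "inv \<sigma> \<circ> \<pi> permutes {1..d}" using assms by (simp add: group_algebra_def)
  then have "\<sigma> \<circ> (inv \<sigma> \<circ> \<pi>) permutes {1..d}" using \<sigma>(1) by (rule permutes_compose)
  then show "\<pi> permutes {1..d}" using permutes_inv_o(1)[OF \<sigma>(1)] by (simp add: comp_assoc[symmetric])
qed

section \<open>The group algebra is a direct sum of matrix algebras\<close>

abbreviation "rep d lam \<equiv> lin_ext d (young_rep d lam)"

lemma rep_mult:
  assumes "young_diagram d lam"
  shows "rep d lam (ga_mult d x y) = op_mult (Stab lam) (rep d lam x) (rep d lam y)"
proof -
  interpret young d lam by unfold_locales (rule assms)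
  show ?thesis by (rule lin_ext_ga_mult) (rule rho_comp)
qed

lemma rep_star:
  assumes "young_diagram d lam"
  shows "rep d lam (ga_star d x) = op_adj (rep d lam x)"
proof -
  interpret young d lam by unfold_locales (rule assms)
  show ?thesis by (rule lin_ext_ga_star) (rule rho_inv)
qed

text \<open>The coefficient 1 brings the sum into the form of \<open>lin_ext_sum\<close>.\<close>

definition jm_element :: "nat \<Rightarrow> group_alg"
  where "jm_element m = (\<lambda>\<sigma>. \<Sum>j\<in>{1..<m}. 1 * ga_of (Transposition.transpose j m) \<sigma>)"

lemma jm_transposition_permutes: "(m::nat) \<in> {1..d} \<Longrightarrow> j \<in> {1..<m} \<Longrightarrow> Transposition.transpose j m permutes {1..d}"
  by (rule permutes_swap_id) auto

lemma jm_element_in: "m \<in> {1..d} \<Longrightarrow> jm_element m \<in> group_algebra d"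
  unfolding jm_element_def by (intro ga_sum_in ga_of_in jm_transposition_permutes)

lemma rep_jm_element:
  assumes lam: "young_diagram d lam" and m: "m \<in> {1..d}"
  shows "rep d lam (jm_element m) S T = (if S = T \<and> S \<in> Stab lam then of_int (tab_content lam S m) else 0)"
proof -
  interpret young d lam by unfold_locales (rule lam)
  have "rep d lam (jm_element m) S T = (\<Sum>j\<in>{1..<m}. young_rep d lam (Transposition.transpose j m) S T)"
    unfolding jm_element_def lin_ext_sum
    by (intro sum.cong refl) (simp add: lin_ext_ga_of[OF jm_transposition_permutes[OF m]])
  also have "\<dots> = (if S = T \<and> S \<in> Stab lam then of_int (tab_content lam S m) else 0)"
  proof (cases "S \<in> Stab lam \<and> T \<in> Stab lam")
    case True
    then show ?thesis using jucys_murphy[of m S T] m by auto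
  next
    case False
    then show ?thesis by (auto simp: rho_outside)
  qed
  finally show ?thesis .
qed

lemma rep_id:
  assumes lam: "young_diagram d lam"
  shows "rep d lam (ga_of id) S T = (if S = T \<and> S \<in> Stab lam then 1 else 0)"
proof -
  interpret young d lam by unfold_locales (rule lam)
  show ?thesis
    unfolding lin_ext_ga_of[OF permutes_id] rho_id by (auto simp: op_one_def)
qed

text \<open>Each tableau in \<open>A\<close> differs from \<open>T\<close> in the content of some entry \<open>m\<close>; a linear polynomial in the \<open>m\<close>-th
  Jucys--Murphy element annihilates it and is 1 at \<open>T\<close>. The separator is the product of these.\<close>

lemma ex_diagonal_separator:
  assumes lam: "young_diagram d lam" and T: "T \<in> Stab lam"
    and "finite A" and "A \<subseteq> Sigma {bet. young_diagram d bet} Stab" and "(lam, T) \<notin> A"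
  shows "\<exists>x\<in>group_algebra d. \<exists>v.
    (\<forall>bet X Y. young_diagram d bet \<longrightarrow> rep d bet x X Y = (if X = Y \<and> X \<in> Stab bet then v bet X else 0)) \<and>
    v lam T = 1 \<and> (\<forall>(bet, X)\<in>A. v bet X = 0)"
  using assms(3-)
proof (induction A rule: finite_induct)
  case empty
  show ?case
    using ga_of_in[OF permutes_id] rep_id
    by (intro bexI[of _ "ga_of id"] exI[of _ "\<lambda>bet X. 1"]) auto
next
  case (insert p A)
  obtain bet R where p: "p = (bet, R)" by force
  then have bet: "young_diagram d bet" and R: "R \<in> Stab bet" and ne: "\<not> (lam = bet \<and> T = R)"
    using insert.prems by auto
  obtain x v where x: "x \<in> group_algebra d" "v lam T = 1" "\<forall>(bet, X)\<in>A. v bet X = 0"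
    "\<And>bet X Y. young_diagram d bet \<Longrightarrow> rep d bet x X Y = (if X = Y \<and> X \<in> Stab bet then v bet X else 0)"
  proof -
    have "A \<subseteq> Sigma {bet. young_diagram d bet} Stab" "(lam, T) \<notin> A" using insert.prems by auto
    from insert.IH[OF this] show ?thesis using that by blast
  qed
  obtain m where m: "m \<in> {1..d}" "tab_content lam T m \<noteq> tab_content bet R m"
    using contents_determine_tableau[OF lam bet T R] ne by blast
  define a b where "a = (of_int (tab_content bet R m) :: complex)"
    and "b = (of_int (tab_content lam T m) :: complex)"
  have ab: "b - a \<noteq> 0" using m(2) by (simp add: a_def b_def)
  \<comment> \<open>the linear polynomial in the Jucys--Murphy element that is 0 at \<open>R\<close> and 1 at \<open>T\<close>\<close>
  define y where "y = (\<lambda>\<sigma>. inverse (b - a) * (jm_element m \<sigma> - a * ga_of id \<sigma>))"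
  define w where "w = (\<lambda>bet X. inverse (b - a) * (of_int (tab_content bet X m) - a))"
  have y: "y \<in> group_algebra d"
    unfolding y_def by (intro ga_scale_in ga_diff_in jm_element_in[OF m(1)] ga_of_in permutes_id)
  have rep_y: "rep d bet y X Y = (if X = Y \<and> X \<in> Stab bet then w bet X else 0)"
    if "young_diagram d bet" for bet X Y
    unfolding y_def lin_ext_scale lin_ext_diff rep_jm_element[OF that m(1)] rep_id[OF that]
    by (cases "X = Y \<and> X \<in> Stab bet") (auto simp: w_def)
  have rep_xy: "rep d bet (ga_mult d x y) X Y = (if X = Y \<and> X \<in> Stab bet then v bet X * w bet X else 0)"
    if bet: "young_diagram d bet" for bet X Y
  proof -
    interpret young d bet by unfold_locales (rule bet)
    have "rep d bet (ga_mult d x y) X Y =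
        (\<Sum>Z\<in>Stab bet. if Z = X then (if X = Y then v bet X * w bet X else 0) else 0)"
      unfolding rep_mult[OF bet] op_mult_def x(4)[OF bet] rep_y[OF bet]
      by (intro sum.cong refl) auto
    then show ?thesis by (simp add: finite_Stab)
  qed
  have "w lam T = 1" "w bet R = 0" using ab by (auto simp: w_def a_def b_def)
  then show ?case
    using ga_mult_in[OF y] x rep_xy
    by (intro bexI[of _ "ga_mult d x y"] exI[of _ "\<lambda>bet X. v bet X * w bet X"]) (auto simp: p)
qed

lemma ex_diagonal_unit:
  assumes lam: "young_diagram d lam" and T: "T \<in> Stab lam"
  shows "\<exists>x\<in>group_algebra d. \<forall>bet. young_diagram d bet \<longrightarrow>
    rep d bet x = (if bet = lam then op_unit T T else op_zero)"
proof -
  let ?P = "Sigma {bet. young_diagram d bet} Stab"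
  have "finite (Stab bet)" if "young_diagram d bet" for bet
  proof -
    interpret young d bet by unfold_locales (rule that)
    show ?thesis by (rule finite_Stab)
  qed
  then have "finite ?P" by (auto intro: finite_SigmaI finite_young_diagrams)
  then have "finite (?P - {(lam, T)})" by simp
  then obtain x v where x: "x \<in> group_algebra d" "v lam T = 1" "\<forall>(bet, X)\<in>?P - {(lam, T)}. v bet X = 0"
    "\<And>bet X Y. young_diagram d bet \<Longrightarrow> rep d bet x X Y = (if X = Y \<and> X \<in> Stab bet then v bet X else 0)"
    using ex_diagonal_separator[OF lam T, of "?P - {(lam, T)}"] by auto
  have "rep d bet x = (if bet = lam then op_unit T T else op_zero)" if bet: "young_diagram d bet" for bet
  proof (intro ext)
    fix X Y
    have "v bet X = 0" if "X \<in> Stab bet" "(bet, X) \<noteq> (lam, T)" using x(3) bet that by auto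
    then show "rep d bet x X Y = (if bet = lam then op_unit T T else op_zero) X Y"
      using x(2) T unfolding x(4)[OF bet] by (auto simp: op_unit_def op_zero_def)
  qed
  then show ?thesis using x(1) by blast
qed

lemma op_unit_sandwich:
  assumes "finite B" "S \<in> B" "T \<in> B"
  shows "op_mult B (op_mult B (op_unit S S) A) (op_unit T T) = (\<lambda>x y. A S T * op_unit S T x y)"
proof (intro ext)
  fix x y
  have inner: "op_mult B (op_unit S S) A x z = (if x = S then A S z else 0)" for z
    unfolding op_mult_def op_unit_def using assms(1,2)
    by (simp add: if_distrib[of "\<lambda>u. u * _"] cong: if_cong)
  have "op_mult B (op_mult B (op_unit S S) A) (op_unit T T) x y =
      (\<Sum>z\<in>B. if z = T then (if x = S \<and> y = T then A S T else 0) else 0)"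
    unfolding op_mult_def[of B "op_mult B (op_unit S S) A"] inner
    by (intro sum.cong refl) (simp add: op_unit_def)
  also have "\<dots> = A S T * op_unit S T x y" using assms by (simp add: op_unit_def)
  finally show "op_mult B (op_mult B (op_unit S S) A) (op_unit T T) x y = A S T * op_unit S T x y" .
qed

lemma rep_sandwich:
  assumes lam: "young_diagram d lam" and S: "S \<in> Stab lam" and T: "T \<in> Stab lam"
    and x: "\<And>bet. young_diagram d bet \<Longrightarrow> rep d bet x = (if bet = lam then op_unit S S else op_zero)"
    and y: "\<And>bet. young_diagram d bet \<Longrightarrow> rep d bet y = (if bet = lam then op_unit T T else op_zero)"
    and \<sigma>: "\<sigma> permutes {1..d}" and bet: "young_diagram d bet"
  shows "rep d bet (ga_mult d (ga_mult d x (ga_of \<sigma>)) y) =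
    (\<lambda>X Y. if bet = lam then young_rep d lam \<sigma> S T * op_unit S T X Y else 0)"
proof -
  interpret young d lam by unfold_locales (rule lam)
  show ?thesis
  proof (cases "bet = lam")
    case True
    show ?thesis
      unfolding True rep_mult[OF lam] x[OF lam] y[OF lam] lin_ext_ga_of[OF \<sigma>]
      using op_unit_sandwich[OF finite_Stab S T] by simp
  next
    case False
    then show ?thesis
      unfolding rep_mult[OF bet] x[OF bet] y[OF bet] by (simp add: op_mult_zero) (simp add: op_zero_def)
  qed
qed

text \<open>The positions of all matrix entries in \<open>\<Oplus>\<^sub>\<lambda> End(V\<^sub>\<lambda>)\<close>.\<close>

definition unit_index :: "nat \<Rightarrow> (nat list \<times> filling \<times> filling) set"
  where "unit_index d = Sigma {lam. young_diagram d lam} (\<lambda>lam. Stab lam \<times> Stab lam)"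

lemma finite_Stab': "young_diagram d lam \<Longrightarrow> finite (Stab lam)"
  by (rule young.finite_Stab[OF young.intro])

lemma finite_unit_index: "finite (unit_index d)"
  unfolding unit_index_def by (auto intro!: finite_SigmaI finite_young_diagrams finite_Stab')

lemma card_unit_index: "card (unit_index d) = fact d"
  unfolding unit_index_def
  using sum_squares_Stab[of d]
  by (subst card_SigmaI) (auto simp: finite_young_diagrams finite_Stab' card_cartesian_product)

definition is_matrix_unit :: "nat \<Rightarrow> nat list \<Rightarrow> filling \<Rightarrow> filling \<Rightarrow> group_alg \<Rightarrow> bool"
  where "is_matrix_unit d lam S T x \<longleftrightarrow> x \<in> group_algebra d \<and>
    (\<forall>bet. young_diagram d bet \<longrightarrow> rep d bet x = (if bet = lam then op_unit S T else op_zero))"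

lemma ex_matrix_unit:
  assumes "(lam, S, T) \<in> unit_index d"
  shows "\<exists>x. is_matrix_unit d lam S T x"
proof -
  have lam: "young_diagram d lam" and S: "S \<in> Stab lam" and T: "T \<in> Stab lam"
    using assms by (auto simp: unit_index_def)
  interpret young d lam by unfold_locales (rule lam)
  obtain x where x: "x \<in> group_algebra d"
    "\<And>bet. young_diagram d bet \<Longrightarrow> rep d bet x = (if bet = lam then op_unit S S else op_zero)"
    using ex_diagonal_unit[OF lam S] by blast
  obtain y where y: "y \<in> group_algebra d"
    "\<And>bet. young_diagram d bet \<Longrightarrow> rep d bet y = (if bet = lam then op_unit T T else op_zero)"
    using ex_diagonal_unit[OF lam T] by blast
  define \<sigma> where "\<sigma> = sigma_tab lam T S"
  have \<sigma>: "\<sigma> permutes {1..d}" "relabel lam \<sigma> T = S"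
    using sigma_tab[OF Stab_fillings[OF T] Stab_fillings[OF S]] by (simp_all add: \<sigma>_def)
  define c where "c = young_rep d lam \<sigma> S T"
  have c: "c \<noteq> 0" using rho_relabel_nonzero[OF \<sigma>(1) T] \<sigma>(2) S by (simp add: c_def)
  define z where "z = (\<lambda>\<tau>. inverse c * ga_mult d (ga_mult d x (ga_of \<sigma>)) y \<tau>)"
  have "z \<in> group_algebra d"
    unfolding z_def by (intro ga_scale_in ga_mult_in y(1))
  moreover have "rep d bet z = (if bet = lam then op_unit S T else op_zero)"
    if bet: "young_diagram d bet" for bet
  proof (intro ext)
    fix X Y
    have "rep d bet z X Y = inverse c * (if bet = lam then c * op_unit S T X Y else 0)"
      unfolding z_def lin_ext_scale
      using fun_cong[OF fun_cong[OF rep_sandwich[OF lam S T x(2) y(2) \<sigma>(1) bet]], of X Y]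
      by (simp add: c_def)
    then show "rep d bet z X Y = (if bet = lam then op_unit S T else op_zero) X Y"
      using c by (simp add: op_zero_def)
  qed
  ultimately show ?thesis unfolding is_matrix_unit_def by blast
qed

text \<open>Sending coefficients to the combination of the matrix units is a right inverse of the map
  \<open>\<complex>[S\<^sub>d] \<rightarrow> \<Oplus>\<^sub>\<lambda> End(V\<^sub>\<lambda>)\<close>. Both sides have dimension \<open>d!\<close>, so the matrices of these maps are square and it is a
  left inverse as well.\<close>

lemma group_algebra_expansion:
  assumes u: "\<And>lam S T. (lam, S, T) \<in> unit_index d \<Longrightarrow> is_matrix_unit d lam S T (u lam S T)"
    and x: "x \<in> group_algebra d"
  shows "x \<tau> = (\<Sum>(lam, S, T)\<in>unit_index d. rep d lam x S T * u lam S T \<tau>)"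
proof -
  define N where "N = (fact d :: nat)"
  let ?S = "{\<sigma>. \<sigma> permutes {1..d}}"
  have cS: "card ?S = N"
    using card_permutations[of "{1..d}" d] by (simp add: N_def)
  obtain f where f: "bij_betw f {0..<N} (unit_index d)"
    using ex_bij_betw_nat_finite[OF finite_unit_index, of d] unfolding card_unit_index N_def by blast
  obtain g where g: "bij_betw g {0..<N} ?S"
    using ex_bij_betw_nat_finite[OF finite_permutes] cS by metis
  define U where "U = (\<lambda>(lam, S, T). u lam S T)"
  define r where "r = (\<lambda>(lam, S, T) x. rep d lam x S T)"
  define \<rho> where "\<rho> = (\<lambda>(lam, S, T) \<sigma>. young_rep d lam \<sigma> S T)"
  have r_sum: "r i y = (\<Sum>j\<in>{0..<N}. y (g j) * \<rho> i (g j))" for i y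
  proof -
    have "r i y = (\<Sum>\<sigma>\<in>?S. y \<sigma> * \<rho> i \<sigma>)"
      by (simp add: r_def \<rho>_def lin_ext_def split: prod.splits)
    then show ?thesis
      using sum.reindex_bij_betw[OF g, of "\<lambda>\<sigma>. y \<sigma> * \<rho> i \<sigma>"] by simp
  qed
  have rU: "r i (U j) = (if i = j then 1 else 0)" if "i \<in> unit_index d" "j \<in> unit_index d" for i j
  proof -
    obtain lam S T bet X Y where ij: "i = (lam, S, T)" "j = (bet, X, Y)" by (metis prod_cases3)
    then have "is_matrix_unit d bet X Y (u bet X Y)" "young_diagram d lam"
      using u that by (auto simp: unit_index_def)
    then have "rep d lam (u bet X Y) = (if lam = bet then op_unit X Y else op_zero)"
      by (simp add: is_matrix_unit_def)
    then show ?thesis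
      by (auto simp: ij r_def U_def op_unit_def op_zero_def)
  qed
  \<comment> \<open>rows of \<open>A\<close> are the matrix units, columns of \<open>B\<close> the coordinate functionals\<close>
  define A where "A = mat N N (\<lambda>(i, j). U (f i) (g j))"
  define B where "B = mat N N (\<lambda>(j, i). \<rho> (f i) (g j))"
  have AB: "A \<in> carrier_mat N N" "B \<in> carrier_mat N N" by (simp_all add: A_def B_def)
  have fi: "f i \<in> unit_index d" if "i < N" for i using bij_betwE[OF f] that by simp
  have inj: "f i = f j \<longleftrightarrow> i = j" if "i < N" "j < N" for i j
    using f that by (auto simp: bij_betw_def inj_on_def)
  have "A * B = 1\<^sub>m N"
  proof (rule eq_matI)
    fix i j assume "i < dim_row (1\<^sub>m N :: complex mat)" "j < dim_col (1\<^sub>m N :: complex mat)"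
    then have ij: "i < N" "j < N" by simp_all
    have "(A * B) $$ (i, j) = (\<Sum>k\<in>{0..<N}. U (f i) (g k) * \<rho> (f j) (g k))"
      using ij by (simp add: A_def B_def scalar_prod_def)
    also have "\<dots> = (if i = j then 1 else 0)"
      using rU[OF fi[OF ij(2)] fi[OF ij(1)]] inj[OF ij(2,1)] r_sum by auto
    finally show "(A * B) $$ (i, j) = 1\<^sub>m N $$ (i, j)" using ij by simp
  qed (simp_all add: A_def B_def)
  then have BA: "B * A = 1\<^sub>m N" by (rule mat_mult_left_right_inverse[OF AB])
  have dual: "(\<Sum>i\<in>{0..<N}. \<rho> (f i) (g j) * U (f i) (g k)) = (if j = k then 1 else 0)"
    if "j < N" "k < N" for j k
  proof -
    have "(B * A) $$ (j, k) = (\<Sum>i\<in>{0..<N}. \<rho> (f i) (g j) * U (f i) (g k))"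
      using that by (simp add: A_def B_def scalar_prod_def)
    then show ?thesis using BA that by simp
  qed
  have "(\<Sum>(lam, S, T)\<in>unit_index d. rep d lam x S T * u lam S T \<tau>) = (\<Sum>i\<in>unit_index d. r i x * U i \<tau>)"
    by (intro sum.cong refl) (auto simp: r_def U_def)
  also have "\<dots> = (\<Sum>i\<in>{0..<N}. r (f i) x * U (f i) \<tau>)"
    by (rule sum.reindex_bij_betw[OF f, symmetric])
  also have "\<dots> = x \<tau>"
  proof (cases "\<tau> \<in> ?S")
    case True
    then obtain k where k: "k < N" "\<tau> = g k"
      using g unfolding bij_betw_def by (metis atLeastLessThan_iff imageE)
    have "(\<Sum>i\<in>{0..<N}. r (f i) x * U (f i) \<tau>) =
        (\<Sum>i\<in>{0..<N}. \<Sum>j\<in>{0..<N}. x (g j) * (\<rho> (f i) (g j) * U (f i) (g k)))"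
      by (simp add: r_sum k sum_distrib_right mult.assoc)
    also have "\<dots> = (\<Sum>j\<in>{0..<N}. x (g j) * (\<Sum>i\<in>{0..<N}. \<rho> (f i) (g j) * U (f i) (g k)))"
      by (subst sum.swap) (simp add: sum_distrib_left)
    also have "\<dots> = (\<Sum>j\<in>{0..<N}. if j = k then x (g j) else 0)"
      by (intro sum.cong refl) (simp add: dual k)
    also have "\<dots> = x \<tau>" using k by simp
    finally show ?thesis .
  next
    case False
    then have "x \<tau> = 0" using x by (auto simp: group_algebra_def)
    moreover have "U (f i) \<tau> = 0" if "i < N" for i
    proof -
      obtain lam S T where i: "f i = (lam, S, T)" by (metis prod_cases3)
      then have "u lam S T \<in> group_algebra d"
        using u[of lam S T] fi[OF that] by (simp add: is_matrix_unit_def)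
      then show ?thesis using False by (auto simp: U_def i group_algebra_def)
    qed
    ultimately show ?thesis by simp
  qed
  finally show ?thesis by simp
qed

text \<open>Injectivity of \<open>\<complex>[S\<^sub>d] \<rightarrow> \<Oplus>\<^sub>\<lambda> End(V\<^sub>\<lambda>)\<close>: identities in the group algebra can be checked on all \<open>V\<^sub>\<lambda>\<close>.\<close>

lemma group_algebra_eqI:
  assumes x: "x \<in> group_algebra d" and y: "y \<in> group_algebra d"
    and eq: "\<And>lam. young_diagram d lam \<Longrightarrow> rep d lam x = rep d lam y"
  shows "x = y"
proof
  fix \<tau>
  define u where "u = (\<lambda>lam S T. SOME z. is_matrix_unit d lam S T z)"
  have u: "is_matrix_unit d lam S T (u lam S T)" if "(lam, S, T) \<in> unit_index d" for lam S T
    unfolding u_def by (rule someI_ex[OF ex_matrix_unit[OF that]])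
  have "x \<tau> = (\<Sum>(lam, S, T)\<in>unit_index d. rep d lam x S T * u lam S T \<tau>)"
    by (rule group_algebra_expansion[OF u x])
  also have "\<dots> = (\<Sum>(lam, S, T)\<in>unit_index d. rep d lam y S T * u lam S T \<tau>)"
    by (intro sum.cong refl) (auto simp: unit_index_def eq)
  also have "\<dots> = y \<tau>"
    by (rule group_algebra_expansion[OF u y, symmetric])
  finally show "x \<tau> = y \<tau>" .
qed

definition matrix_unit :: "nat \<Rightarrow> nat list \<Rightarrow> filling \<Rightarrow> filling \<Rightarrow> group_alg"
  where "matrix_unit d lam S T = (SOME z. is_matrix_unit d lam S T z)"

lemma matrix_unit:
  assumes "(lam, S, T) \<in> unit_index d"
  shows "matrix_unit d lam S T \<in> group_algebra d"
    and "young_diagram d bet \<Longrightarrow>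
      rep d bet (matrix_unit d lam S T) = (if bet = lam then op_unit S T else op_zero)"
  using someI_ex[OF ex_matrix_unit[OF assms]] by (simp_all add: matrix_unit_def is_matrix_unit_def)

lemma matrix_unit_expansion:
  assumes "x \<in> group_algebra d"
  shows "x \<tau> = (\<Sum>(lam, S, T)\<in>unit_index d. rep d lam x S T * matrix_unit d lam S T \<tau>)"
  by (rule group_algebra_expansion[OF _ assms])
    (simp add: is_matrix_unit_def matrix_unit)

lemma min_proj_eq_matrix_unit:
  assumes "young_diagram d lam" "T \<in> Stab lam"
  shows "min_proj d lam T = matrix_unit d lam T T"
proof -
  have idx: "(lam, T, T) \<in> unit_index d" using assms by (simp add: unit_index_def)
  show ?thesis
    unfolding min_proj_def
  proof (rule the_equality)
    show "matrix_unit d lam T T \<in> group_algebra d \<and> (\<forall>\<beta>. young_diagram d \<beta> \<longrightarrow>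
        rep d \<beta> (matrix_unit d lam T T) = (if \<beta> = lam then op_unit T T else op_zero))"
      using matrix_unit[OF idx] by simp
  next
    fix x assume "x \<in> group_algebra d \<and> (\<forall>\<beta>. young_diagram d \<beta> \<longrightarrow>
        rep d \<beta> x = (if \<beta> = lam then op_unit T T else op_zero))"
    then show "x = matrix_unit d lam T T"
      using matrix_unit[OF idx] by (intro group_algebra_eqI) auto
  qed
qed

text \<open>The factor is the coefficient of \<open>w\<^sub>S\<close> in \<open>\<sigma>\<^sub>T\<^sub>,\<^sub>S w\<^sub>T\<close>.\<close>

lemma E_tab_eq_matrix_unit:
  assumes idx: "(lam, S, T) \<in> unit_index d"
  shows "\<exists>c. c \<noteq> 0 \<and> E_tab d lam S T = (\<lambda>\<tau>. c * matrix_unit d lam S T \<tau>)"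
proof -
  have lam: "young_diagram d lam" and S: "S \<in> Stab lam" and T: "T \<in> Stab lam"
    using idx by (auto simp: unit_index_def)
  have idxS: "(lam, S, S) \<in> unit_index d" and idxT: "(lam, T, T) \<in> unit_index d"
    using lam S T by (auto simp: unit_index_def)
  interpret young d lam by unfold_locales (rule lam)
  define \<sigma> where "\<sigma> = sigma_tab lam T S"
  have \<sigma>: "\<sigma> permutes {1..d}" "relabel lam \<sigma> T = S"
    using sigma_tab[OF Stab_fillings[OF T] Stab_fillings[OF S]] by (simp_all add: \<sigma>_def)
  define c where "c = young_rep d lam \<sigma> S T"
  have "c \<noteq> 0" using rho_relabel_nonzero[OF \<sigma>(1) T] \<sigma>(2) S by (simp add: c_def)
  moreover have "E_tab d lam S T = (\<lambda>\<tau>. c * matrix_unit d lam S T \<tau>)"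
  proof (rule group_algebra_eqI)
    show "E_tab d lam S T \<in> group_algebra d"
      unfolding E_tab_def min_proj_eq_matrix_unit[OF lam T] by (intro ga_mult_in matrix_unit(1)[OF idxT])
    show "(\<lambda>\<tau>. c * matrix_unit d lam S T \<tau>) \<in> group_algebra d"
      by (intro ga_scale_in matrix_unit(1)[OF idx])
    fix bet assume bet: "young_diagram d bet"
    show "rep d bet (E_tab d lam S T) = rep d bet (\<lambda>\<tau>. c * matrix_unit d lam S T \<tau>)"
    proof (intro ext)
      fix X Y
      have "rep d bet (E_tab d lam S T) X Y = (if bet = lam then c * op_unit S T X Y else 0)"
        unfolding E_tab_def min_proj_eq_matrix_unit[OF lam T] min_proj_eq_matrix_unit[OF lam S] \<sigma>_def[symmetric]
        using fun_cong[OF fun_cong[OF rep_sandwich[OF lam S T matrix_unit(2)[OF idxS] matrix_unit(2)[OF idxT]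
          \<sigma>(1) bet]], of X Y]
        by (simp add: c_def)
      then show "rep d bet (E_tab d lam S T) X Y = rep d bet (\<lambda>\<tau>. c * matrix_unit d lam S T \<tau>) X Y"
        unfolding lin_ext_scale matrix_unit(2)[OF idx bet] by (simp add: op_zero_def)
    qed
  qed
  ultimately show ?thesis by blast
qed

lemma op_mult_op_unit:
  assumes "finite B" "T \<in> B"
  shows "op_mult B (op_unit S T) (op_unit T' R) = (if T = T' then op_unit S R else op_zero)"
proof (intro ext)
  fix x y
  have "op_mult B (op_unit S T) (op_unit T' R) x y =
      (\<Sum>z\<in>B. if z = T then (if x = S \<and> T = T' \<and> y = R then 1 else 0) else 0)"
    unfolding op_mult_def op_unit_def by (intro sum.cong refl) auto
  then show "op_mult B (op_unit S T) (op_unit T' R) x y = (if T = T' then op_unit S R else op_zero) x y"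
    using assms by (simp add: op_unit_def op_zero_def)
qed

lemma matrix_unit_mult:
  assumes 1: "(lam, S, T) \<in> unit_index d" and 2: "(lam', T', R) \<in> unit_index d"
  shows "ga_mult d (matrix_unit d lam S T) (matrix_unit d lam' T' R) =
    (if lam = lam' \<and> T = T' then matrix_unit d lam S R else (\<lambda>\<sigma>. 0))"
proof (rule group_algebra_eqI)
  have 3: "lam = lam' \<Longrightarrow> (lam, S, R) \<in> unit_index d" using 1 2 by (auto simp: unit_index_def)
  show "ga_mult d (matrix_unit d lam S T) (matrix_unit d lam' T' R) \<in> group_algebra d"
    by (rule ga_mult_in[OF matrix_unit(1)[OF 2]])
  show "(if lam = lam' \<and> T = T' then matrix_unit d lam S R else (\<lambda>\<sigma>. 0)) \<in> group_algebra d"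
    using matrix_unit(1)[OF 3] by (simp add: group_algebra_def)
  fix bet assume bet: "young_diagram d bet"
  have zero: "rep d bet (\<lambda>\<sigma>. 0) = op_zero" by (simp add: lin_ext_def op_zero_def)
  have fin: "finite (Stab lam)" "T \<in> Stab lam" using 1 finite_Stab' by (auto simp: unit_index_def)
  show "rep d bet (ga_mult d (matrix_unit d lam S T) (matrix_unit d lam' T' R)) =
      rep d bet (if lam = lam' \<and> T = T' then matrix_unit d lam S R else (\<lambda>\<sigma>. 0))"
    unfolding rep_mult[OF bet] matrix_unit(2)[OF 1 bet] matrix_unit(2)[OF 2 bet]
    using op_mult_op_unit[OF fin] matrix_unit(2)[OF 3 bet] by (auto simp: op_mult_zero zero)
qed

lemma matrix_unit_star:
  assumes idx: "(lam, S, T) \<in> unit_index d"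
  shows "ga_star d (matrix_unit d lam S T) = matrix_unit d lam T S"
proof (rule group_algebra_eqI)
  have idx': "(lam, T, S) \<in> unit_index d" using idx by (auto simp: unit_index_def)
  show "ga_star d (matrix_unit d lam S T) \<in> group_algebra d" by (rule ga_star_in)
  show "matrix_unit d lam T S \<in> group_algebra d" by (rule matrix_unit(1)[OF idx'])
  fix bet assume bet: "young_diagram d bet"
  show "rep d bet (ga_star d (matrix_unit d lam S T)) = rep d bet (matrix_unit d lam T S)"
    unfolding rep_star[OF bet] matrix_unit(2)[OF idx bet] matrix_unit(2)[OF idx' bet]
    by (auto simp: fun_eq_iff op_adj_def op_unit_def op_zero_def)
qed

section \<open>The action on tensors\<close>

lemma finite_multi_idx: "finite (multi_idx d n)"
  by (simp add: multi_idx_def finite_PiE)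

lemma multi_idx_comp:
  assumes "X \<in> multi_idx d n" "\<sigma> permutes {1..d}"
  shows "X \<circ> \<sigma> \<in> multi_idx d n"
  using assms permutes_in_image[OF assms(2)] permutes_not_in[OF assms(2)]
  by (auto simp: multi_idx_def PiE_def Pi_def extensional_def)

lemma comp_inv_eq_iff:
  assumes "\<sigma> permutes A"
  shows "Y = X \<circ> inv \<sigma> \<longleftrightarrow> X = Y \<circ> \<sigma>"
  using permutes_inv_o[OF assms] by (metis comp_assoc comp_id)

lemma perm_op_comp:
  assumes \<sigma>: "\<sigma> permutes {1..d}" and \<tau>: "\<tau> permutes {1..d}"
  shows "perm_op d n (\<sigma> \<circ> \<tau>) = op_mult (multi_idx d n) (perm_op d n \<sigma>) (perm_op d n \<tau>)"
proof (intro ext)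
  fix Y X :: "nat \<Rightarrow> nat"
  have inv: "X \<circ> inv (\<sigma> \<circ> \<tau>) = X \<circ> inv \<tau> \<circ> inv \<sigma>"
    using o_inv_distrib[OF permutes_bij[OF \<sigma>] permutes_bij[OF \<tau>]] by (simp only: comp_assoc)
  have "op_mult (multi_idx d n) (perm_op d n \<sigma>) (perm_op d n \<tau>) Y X =
      (\<Sum>Z\<in>multi_idx d n. if Z = X \<circ> inv \<tau>
        then (if X \<in> multi_idx d n \<and> Y \<in> multi_idx d n \<and> Y = X \<circ> inv \<tau> \<circ> inv \<sigma> then 1 else 0) else 0)"
    unfolding op_mult_def perm_op_def by (intro sum.cong refl) auto
  also have "\<dots> = perm_op d n (\<sigma> \<circ> \<tau>) Y X"
    unfolding perm_op_def inv
    using multi_idx_comp[OF _ permutes_inv[OF \<tau>], of X n]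
    by (subst sum.delta[OF finite_multi_idx]) auto
  finally show "perm_op d n (\<sigma> \<circ> \<tau>) Y X = op_mult (multi_idx d n) (perm_op d n \<sigma>) (perm_op d n \<tau>) Y X" ..
qed

lemma perm_op_inv:
  assumes \<sigma>: "\<sigma> permutes {1..d}"
  shows "perm_op d n (inv \<sigma>) X Y = cnj (perm_op d n \<sigma> Y X)"
  unfolding perm_op_def permutes_inv_inv[OF \<sigma>] comp_inv_eq_iff[OF \<sigma>] by auto

lemma tensor_rep_mult:
  "tensor_rep d n (ga_mult d x y) = op_mult (multi_idx d n) (tensor_rep d n x) (tensor_rep d n y)"
  unfolding tensor_rep_def by (rule lin_ext_ga_mult) (rule perm_op_comp)

lemma tensor_rep_star: "tensor_rep d n (ga_star d x) = op_adj (tensor_rep d n x)"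
  unfolding tensor_rep_def by (rule lin_ext_ga_star) (rule perm_op_inv)

lemma tensor_rep_outside:
  "X \<notin> multi_idx d n \<or> Y \<notin> multi_idx d n \<Longrightarrow> tensor_rep d n x X Y = 0"
  by (auto simp: tensor_rep_def lin_ext_def perm_op_def)

lemma tensor_rep_zero: "tensor_rep d n (\<lambda>\<sigma>. 0) = op_zero"
  by (simp add: tensor_rep_def lin_ext_def op_zero_def)

text \<open>Permuting the factors of a tensor creates no new indices, so the entries do not depend on the
  ambient dimension.\<close>

lemma tensor_rep_restrict:
  assumes "k \<le> n" "X \<in> multi_idx d k" "Y \<in> multi_idx d k"
  shows "tensor_rep d n x X Y = tensor_rep d k x X Y"
proof -
  have "multi_idx d k \<subseteq> multi_idx d n"
    unfolding multi_idx_def by (intro PiE_mono) (use assms(1) in auto)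
  then show ?thesis
    using assms unfolding tensor_rep_def lin_ext_def perm_op_def by (auto intro!: sum.cong)
qed

abbreviation "tensor_unit d n i \<equiv> tensor_rep d n (case i of (lam, S, T) \<Rightarrow> matrix_unit d lam S T)"

lemma tensor_unit_mult:
  assumes "(lam, S, T) \<in> unit_index d" "(lam', T', R) \<in> unit_index d"
  shows "op_mult (multi_idx d n) (tensor_unit d n (lam, S, T)) (tensor_unit d n (lam', T', R)) =
    (if lam = lam' \<and> T = T' then tensor_unit d n (lam, S, R) else op_zero)"
  using matrix_unit_mult[OF assms]
  by (simp add: tensor_rep_mult[symmetric] tensor_rep_zero)

lemma tensor_unit_adj:
  assumes "(lam, S, T) \<in> unit_index d"
  shows "op_adj (tensor_unit d n (lam, S, T)) = tensor_unit d n (lam, T, S)"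
  using matrix_unit_star[OF assms] by (simp add: tensor_rep_star[symmetric])

lemma perm_op_expansion:
  assumes \<sigma>: "\<sigma> permutes {1..d}"
  shows "perm_op d n \<sigma> = (\<lambda>X Y. \<Sum>i\<in>unit_index d.
    (case i of (lam, S, T) \<Rightarrow> young_rep d lam \<sigma> S T) * tensor_unit d n i X Y)"
proof (intro ext)
  fix X Y
  have "ga_of \<sigma> = (\<lambda>\<tau>. \<Sum>i\<in>unit_index d. (case i of (lam, S, T) \<Rightarrow> young_rep d lam \<sigma> S T) *
      (case i of (lam, S, T) \<Rightarrow> matrix_unit d lam S T) \<tau>)"
  proof
    fix \<tau>
    show "ga_of \<sigma> \<tau> = (\<Sum>i\<in>unit_index d. (case i of (lam, S, T) \<Rightarrow> young_rep d lam \<sigma> S T) *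
        (case i of (lam, S, T) \<Rightarrow> matrix_unit d lam S T) \<tau>)"
      unfolding matrix_unit_expansion[OF ga_of_in[OF \<sigma>], of \<tau>]
      by (intro sum.cong refl) (auto simp: lin_ext_ga_of[OF \<sigma>])
  qed
  then have "tensor_rep d n (ga_of \<sigma>) X Y = (\<Sum>i\<in>unit_index d.
      (case i of (lam, S, T) \<Rightarrow> young_rep d lam \<sigma> S T) * tensor_unit d n i X Y)"
    unfolding tensor_rep_def by (simp only: lin_ext_sum)
  then show "perm_op d n \<sigma> X Y = (\<Sum>i\<in>unit_index d.
      (case i of (lam, S, T) \<Rightarrow> young_rep d lam \<sigma> S T) * tensor_unit d n i X Y)"
    by (simp add: tensor_rep_def lin_ext_ga_of[OF \<sigma>])
qed

section \<open>The Hilbert--Schmidt inner product\<close>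

lemma hs_inner_eq: "hs_inner B A C = (\<Sum>x\<in>B. \<Sum>z\<in>B. A x z * cnj (C x z))"
  by (simp add: hs_inner_def op_trace_def op_mult_def op_adj_def)

lemma hs_inner_self: "hs_inner B A A = of_real (\<Sum>x\<in>B. \<Sum>z\<in>B. (cmod (A x z))\<^sup>2)"
  by (simp add: hs_inner_eq complex_norm_square[symmetric] of_real_sum del: of_real_power)

lemma hs_norm_squared: "of_real ((hs_norm B A)\<^sup>2) = hs_inner B A A"
proof -
  have "0 \<le> (\<Sum>x\<in>B. \<Sum>z\<in>B. (cmod (A x z))\<^sup>2)" by (intro sum_nonneg) simp
  then show ?thesis by (simp add: hs_norm_def hs_inner_self)
qed

lemma hs_inner_self_eq_0:
  assumes "finite B" "hs_inner B A A = 0" "x \<in> B" "z \<in> B"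
  shows "A x z = 0"
proof -
  have "(\<Sum>x\<in>B. \<Sum>z\<in>B. (cmod (A x z))\<^sup>2) = 0" using assms(2) by (simp only: hs_inner_self of_real_eq_0_iff)
  then have "(\<Sum>z\<in>B. (cmod (A x z))\<^sup>2) = 0"
    using assms(1,3) by (subst (asm) sum_nonneg_eq_0_iff) (auto intro: sum_nonneg)
  then show ?thesis using assms(1,4) by (subst (asm) sum_nonneg_eq_0_iff) auto
qed

lemma hs_inner_sum_left:
  "hs_inner B (\<lambda>x y. \<Sum>j\<in>I. c j * A j x y) C = (\<Sum>j\<in>I. c j * hs_inner B (A j) C)"
proof -
  have "hs_inner B (\<lambda>x y. \<Sum>j\<in>I. c j * A j x y) C =
      (\<Sum>x\<in>B. \<Sum>z\<in>B. \<Sum>j\<in>I. c j * (A j x z * cnj (C x z)))"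
    by (simp add: hs_inner_eq sum_distrib_right mult.assoc)
  also have "\<dots> = (\<Sum>x\<in>B. \<Sum>j\<in>I. \<Sum>z\<in>B. c j * (A j x z * cnj (C x z)))"
    by (intro sum.cong refl) (rule sum.swap)
  also have "\<dots> = (\<Sum>j\<in>I. \<Sum>x\<in>B. \<Sum>z\<in>B. c j * (A j x z * cnj (C x z)))" by (rule sum.swap)
  finally show ?thesis by (simp add: hs_inner_eq sum_distrib_left)
qed

lemma hs_inner_scale_left: "hs_inner B (\<lambda>x y. c * A x y) C = c * hs_inner B A C"
  by (simp add: hs_inner_eq sum_distrib_left mult.assoc)

lemma hs_inner_scale_right: "hs_inner B A (\<lambda>x y. c * C x y) = cnj c * hs_inner B A C"
  by (simp add: hs_inner_eq sum_distrib_left mult.assoc mult.left_commute)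

lemma op_trace_commute: "op_trace B (op_mult B A C) = op_trace B (op_mult B C A)"
  unfolding op_trace_def op_mult_def by (subst sum.swap) (simp add: mult.commute)

text \<open>The product of one matrix unit with the adjoint of another is zero or again a matrix unit, and
  off-diagonal matrix units are traceless, as \<open>e\<^sub>S\<^sub>S'\<close> is the product \<open>e\<^sub>S\<^sub>S e\<^sub>S\<^sub>S'\<close>, whose factors multiply to zero
  in the opposite order.\<close>

lemma hs_inner_tensor_unit:
  assumes i: "i \<in> unit_index d" and j: "j \<in> unit_index d" and ne: "i \<noteq> j"
  shows "hs_inner (multi_idx d n) (tensor_unit d n i) (tensor_unit d n j) = 0"
proof -
  let ?W = "multi_idx d n" and ?P = "tensor_unit d n"
  obtain lam S T where i': "i = (lam, S, T)" by (metis prod_cases3)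
  obtain lam' S' T' where j': "j = (lam', S', T')" by (metis prod_cases3)
  have idx: "(lam, S, T) \<in> unit_index d" "(lam', T', S') \<in> unit_index d" "(lam', S', T') \<in> unit_index d"
    using i j by (auto simp: i' j' unit_index_def)
  have eq: "hs_inner ?W (?P i) (?P j) =
      op_trace ?W (if lam = lam' \<and> T = T' then ?P (lam, S, S') else op_zero)"
    unfolding hs_inner_def i' j' tensor_unit_adj[OF idx(3)] tensor_unit_mult[OF idx(1,2)] ..
  show ?thesis
  proof (cases "lam = lam' \<and> T = T'")
    case True
    then have "S \<noteq> S'" using ne i' j' by auto
    have S: "(lam, S, S) \<in> unit_index d" "(lam, S, S') \<in> unit_index d"
      using idx True by (auto simp: unit_index_def)
    have "op_trace ?W (?P (lam, S, S')) = op_trace ?W (op_mult ?W (?P (lam, S, S)) (?P (lam, S, S')))"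
      using tensor_unit_mult[OF S] by simp
    also have "\<dots> = op_trace ?W (op_mult ?W (?P (lam, S, S')) (?P (lam, S, S)))" by (rule op_trace_commute)
    also have "\<dots> = 0"
      unfolding tensor_unit_mult[OF S(2,1)] using \<open>S \<noteq> S'\<close> by (simp add: op_trace_def op_zero_def)
    finally show ?thesis using True eq by simp
  next
    case False
    then show ?thesis unfolding eq if_not_P[OF False] by (simp add: op_trace_def op_zero_def)
  qed
qed

text \<open>A matrix unit may act by zero on the tensor space; its term is then \<open>0 / 0 = 0\<close>.\<close>

lemma tensor_unit_projection:
  assumes M: "\<And>X Y. M X Y = (\<Sum>i\<in>unit_index d. c i * tensor_unit d n i X Y)"
  shows "M X Y = (\<Sum>i\<in>unit_index d. hs_inner (multi_idx d n) M (tensor_unit d n i) * tensor_unit d n i X Y /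
    hs_inner (multi_idx d n) (tensor_unit d n i) (tensor_unit d n i))"
  unfolding M[of X Y]
proof (rule sum.cong[OF refl])
  let ?W = "multi_idx d n" and ?P = "tensor_unit d n"
  fix i assume i: "i \<in> unit_index d"
  have "M = (\<lambda>X Y. \<Sum>i\<in>unit_index d. c i * ?P i X Y)" using M by (intro ext)
  then have "hs_inner ?W M (?P i) = (\<Sum>j\<in>unit_index d. c j * hs_inner ?W (?P j) (?P i))"
    by (simp only: hs_inner_sum_left)
  also have "\<dots> = (\<Sum>j\<in>unit_index d. if j = i then c i * hs_inner ?W (?P i) (?P i) else 0)"
    using i hs_inner_tensor_unit by (intro sum.cong refl) auto
  also have "\<dots> = c i * hs_inner ?W (?P i) (?P i)"
    using i by (simp add: finite_unit_index)
  finally have Mi: "hs_inner ?W M (?P i) = c i * hs_inner ?W (?P i) (?P i)" .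
  show "c i * ?P i X Y = hs_inner ?W M (?P i) * ?P i X Y / hs_inner ?W (?P i) (?P i)"
  proof (cases "hs_inner ?W (?P i) (?P i) = 0")
    case True
    then have "?P i X Y = 0"
      using hs_inner_self_eq_0[OF finite_multi_idx True, of X Y] tensor_rep_outside[of X d n Y] by blast
    then show ?thesis by simp
  next
    case False
    then show ?thesis unfolding Mi by simp
  qed
qed

section \<open>Long diagrams act by zero\<close>

context young
begin

text \<open>Number the boxes column by column.\<close>

lemma ex_column_tableau:
  "\<exists>T\<in>Stab lam. \<forall>r<length lam. T (r, 0) = Suc r"
proof -
  \<comment> \<open>the lexicographic order of the boxes with the column as first key\<close>
  define le where "le = (\<lambda>x y :: nat \<times> nat. snd x < snd y \<or> snd x = snd y \<and> fst x \<le> fst y)"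
  define D where "D = (\<lambda>b. {x \<in> boxes lam. le x b})"
  define T where "T = (\<lambda>b\<in>boxes lam. card (D b))"
  have fin: "finite (D b)" for b using finite_boxes by (simp add: D_def)
  have strict: "T x < T y" if "x \<in> boxes lam" "y \<in> boxes lam" "le x y" "x \<noteq> y" for x y
  proof -
    have "y \<in> D y" "y \<notin> D x" using that by (auto simp: D_def le_def prod_eq_iff)
    moreover have "D x \<subseteq> D y" using that by (auto simp: D_def le_def)
    ultimately have "D x \<subset> D y" by blast
    then show ?thesis using that psubset_card_mono[OF fin] by (simp add: T_def)
  qed
  have inj: "inj_on T (boxes lam)"
  proof (rule inj_onI, rule ccontr)
    fix x y assume xy: "x \<in> boxes lam" "y \<in> boxes lam" "T x = T y" "x \<noteq> y"
    have "le x y \<or> le y x" by (auto simp: le_def)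
    then show False using strict xy by (metis less_irrefl)
  qed
  have sub: "T ` boxes lam \<subseteq> {1..d}"
  proof
    fix i assume "i \<in> T ` boxes lam"
    then obtain x where x: "x \<in> boxes lam" "i = card (D x)" by (auto simp: T_def)
    have "x \<in> D x" using x by (simp add: D_def le_def)
    then have "0 < i" using x fin card_gt_0_iff by blast
    moreover have "i \<le> card (boxes lam)"
      unfolding x(2) by (rule card_mono[OF finite_boxes]) (auto simp: D_def)
    ultimately show "i \<in> {1..d}" by (simp add: card_boxes)
  qed
  have "T ` boxes lam = {1..d}"
    using card_image[OF inj] card_boxes sub by (intro card_subset_eq) auto
  then have "T \<in> fillings lam"
    using inj by (simp add: fillings_def bij_betw_def sum_lam T_def)
  then have "T \<in> Stab lam"
    unfolding Stab_def using strict by (auto simp: le_def)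
  moreover have "T (r, 0) = Suc r" if r: "r < length lam" for r
  proof -
    have pos: "0 < lam ! r'" if "r' < length lam" for r'
      using young_diagram that by (simp add: young_diagram_def)
    have "D (r, 0) = (\<lambda>r'. (r', 0)) ` {..r}"
      using r pos by (auto simp: D_def le_def boxes_def)
    then have "card (D (r, 0)) = Suc r" by (simp add: card_image inj_on_def)
    moreover have "(r, 0) \<in> boxes lam" using r pos by (simp add: boxes_def)
    ultimately show ?thesis by (simp add: T_def)
  qed
  ultimately show ?thesis by blast
qed

end

text \<open>Adjacent transpositions move the two equal values next to each other, at the cost of signs.\<close>

lemma antisymmetric_vanishes:
  fixes f :: "(nat \<Rightarrow> nat) \<Rightarrow> complex"
  assumes "\<And>X i. a \<le> i \<Longrightarrow> i < c \<Longrightarrow> f (X \<circ> coxeter i) = - f X"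
    and "a < b" "b \<le> c" "X a = X b"
  shows "f X = 0"
  using assms(2-)
proof (induction b arbitrary: X rule: less_induct)
  case (less b)
  obtain m where m: "b = Suc m" using less.prems(1) by (cases b) auto
  show ?case
  proof (cases "m = a")
    case True
    have "X \<circ> coxeter a = X"
      using less.prems(3) m True by (auto simp: fun_eq_iff Transposition.transpose_def)
    then show ?thesis using assms(1)[of a X] less.prems by simp
  next
    case False
    have "f (X \<circ> coxeter m) = 0"
    proof (rule less.IH)
      show "(X \<circ> coxeter m) a = (X \<circ> coxeter m) m"
        using less.prems m False by (simp add: Transposition.transpose_def)
    qed (use less.prems m False in auto)
    then show ?thesis using assms(1)[of m X] less.prems m by simp
  qed
qed

text \<open>Let the first column of \<open>C\<close> contain \<open>1, \<dots>, l\<close> with \<open>l > k\<close>. Then the image of the diagonal unit at \<open>C\<close> is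
  antisymmetric in the first \<open>l\<close> tensor factors. There are only \<open>k\<close> basis vectors, so two of these
  factors agree, and antisymmetry forces the entry to be zero. Every unit of the same diagram is a
  multiple of this one.\<close>

lemma tensor_unit_long_vanishes:
  assumes idx: "(lam, S, T) \<in> unit_index d" and long: "k < length lam"
  shows "tensor_unit d k (lam, S, T) = op_zero"
proof -
  have lam: "young_diagram d lam" and S: "S \<in> Stab lam" and T: "T \<in> Stab lam"
    using idx by (auto simp: unit_index_def)
  interpret young d lam by unfold_locales (rule lam)
  let ?W = "multi_idx d k" and ?P = "tensor_unit d k"
  obtain C where C: "C \<in> Stab lam" "\<And>r. r < length lam \<Longrightarrow> C (r, 0) = Suc r"
    using ex_column_tableau by blast
  note Cf = Stab_fillings[OF C(1)]
  have idC: "(lam, C, C) \<in> unit_index d" "(lam, S, C) \<in> unit_index d" "(lam, C, T) \<in> unit_index d"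
    using lam S T C by (auto simp: unit_index_def)
  have box0: "(r, 0) \<in> boxes lam" if "r < length lam" for r
    using young_diagram that by (simp add: young_diagram_def boxes_def)
  have len: "length lam \<le> d"
    using filling_range[OF Cf box0[of "length lam - 1"]] C(2)[of "length lam - 1"] by (cases lam) auto
  have anti: "?P (lam, C, C) (Y \<circ> coxeter i) Z = - ?P (lam, C, C) Y Z"
    if i: "1 \<le> i" "i < length lam" for i Y Z
  proof -
    have id: "i \<in> {1..<d}" using i len by simp
    have "box_of lam C i = (i - 1, 0)" "box_of lam C (Suc i) = (i, 0)"
      using box_of_entry[OF Cf box0[of "i - 1"]] box_of_entry[OF Cf box0[of i]] C(2)[of "i - 1"] C(2)[of i] i
      by simp_all
    then have col: "snd (box_of lam C i) = snd (box_of lam C (Suc i))"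
      "axial_dist lam i C = -1"
      using i by (simp_all add: axial_dist_def tab_content_def of_nat_diff)
    then have "relabel lam (coxeter i) C \<notin> Stab lam" using coxeter_Stab_iff[OF C(1) id] by simp
    then have "young_off lam i C = 0" using young_off_eq_0_iff[OF C(1) id] by simp
    then have rho: "young_rep d lam (coxeter i) R C = (if R = C then - 1 else 0)" for R
      unfolding rho_coxeter[OF C(1) id] by (simp add: young_diag_def col)
    have "ga_mult d (ga_of (coxeter i)) (matrix_unit d lam C C) = (\<lambda>\<sigma>. - 1 * matrix_unit d lam C C \<sigma>)"
    proof (rule group_algebra_eqI)
      show "ga_mult d (ga_of (coxeter i)) (matrix_unit d lam C C) \<in> group_algebra d"
        by (intro ga_mult_in matrix_unit(1)[OF idC(1)])
      show "(\<lambda>\<sigma>. - 1 * matrix_unit d lam C C \<sigma>) \<in> group_algebra d"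
        by (intro ga_scale_in matrix_unit(1)[OF idC(1)])
      fix bet assume bet: "young_diagram d bet"
      show "rep d bet (ga_mult d (ga_of (coxeter i)) (matrix_unit d lam C C)) =
          rep d bet (\<lambda>\<sigma>. - 1 * matrix_unit d lam C C \<sigma>)"
      proof (intro ext)
        fix X Y
        have "op_mult (Stab lam) (young_rep d lam (coxeter i)) (op_unit C C) X Y = - op_unit C C X Y"
        proof -
          have "op_mult (Stab lam) (young_rep d lam (coxeter i)) (op_unit C C) X Y =
              (\<Sum>z\<in>Stab lam. if z = C then (if X = C \<and> Y = C then - 1 else 0) else 0)"
            unfolding op_mult_def by (intro sum.cong refl) (auto simp: op_unit_def rho)
          then show ?thesis using C(1) by (simp add: finite_Stab op_unit_def)
        qed
        then show "rep d bet (ga_mult d (ga_of (coxeter i)) (matrix_unit d lam C C)) X Y =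
            rep d bet (\<lambda>\<sigma>. - 1 * matrix_unit d lam C C \<sigma>) X Y"
          unfolding lin_ext_scale rep_mult[OF bet] matrix_unit(2)[OF idC(1) bet]
            lin_ext_ga_of[OF coxeter_permutes[OF id]]
          by (simp add: op_mult_zero) (simp add: op_zero_def)
      qed
    qed
    then have "op_mult ?W (perm_op d k (coxeter i)) (?P (lam, C, C)) Y Z = - ?P (lam, C, C) Y Z"
      using tensor_rep_mult[of d k "ga_of (coxeter i)" "matrix_unit d lam C C"]
        lin_ext_ga_of[OF coxeter_permutes[OF id], of "perm_op d k"]
        lin_ext_scale[of d "perm_op d k" "- 1" "matrix_unit d lam C C" Y Z]
      unfolding tensor_rep_def by simp
    moreover have "op_mult ?W (perm_op d k (coxeter i)) (?P (lam, C, C)) Y Z =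
        ?P (lam, C, C) (Y \<circ> coxeter i) Z"
    proof (cases "Y \<in> ?W")
      case True
      have YW: "Y \<circ> coxeter i \<in> ?W" using multi_idx_comp[OF True coxeter_permutes[OF id]] .
      have "op_mult ?W (perm_op d k (coxeter i)) (?P (lam, C, C)) Y Z =
          (\<Sum>X\<in>?W. if X = Y \<circ> coxeter i then ?P (lam, C, C) X Z else 0)"
        unfolding op_mult_def perm_op_def comp_inv_eq_iff[OF coxeter_permutes[OF id]]
        using True by (intro sum.cong refl) auto
      then show ?thesis using YW by (simp only: sum.delta[OF finite_multi_idx] if_True)
    next
      case False
      have "Y \<circ> coxeter i \<notin> ?W"
        using multi_idx_comp[of "Y \<circ> coxeter i" d k "coxeter i"] coxeter_permutes[OF id] False
        by (metis o_coxeter_o_coxeter)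
      then show ?thesis
        using False tensor_rep_outside by (simp add: op_mult_def perm_op_def)
    qed
    ultimately show ?thesis by simp
  qed
  have "?P (lam, C, C) X Z = 0" for X Z
  proof (cases "X \<in> ?W")
    case True
    have "\<not> inj_on X {1..length lam}"
    proof
      assume "inj_on X {1..length lam}"
      then have "card {1..length lam} \<le> card {1..k}"
        using True len by (intro card_inj_on_le) (auto simp: multi_idx_def PiE_def Pi_def)
      then show False using long by simp
    qed
    then obtain a b where ab: "a \<in> {1..length lam}" "b \<in> {1..length lam}" "a < b" "X a = X b"
      unfolding inj_on_def by (metis linorder_neqE_nat)
    show ?thesis
      by (rule antisymmetric_vanishes[of a "length lam" "\<lambda>X. ?P (lam, C, C) X Z" b])
        (use anti ab in auto)
  next
    case False
    then show ?thesis by (rule tensor_rep_outside[OF disjI1])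
  qed
  then have zero: "?P (lam, C, C) = op_zero" by (simp add: op_zero_def fun_eq_iff)
  have "?P (lam, S, T) = op_mult ?W (op_mult ?W (?P (lam, S, C)) (?P (lam, C, C))) (?P (lam, C, T))"
    using tensor_unit_mult[OF idC(2,1)] tensor_unit_mult[OF idC(2,3)] by simp
  then show ?thesis unfolding zero by (simp add: op_mult_zero)
qed

section \<open>The bicommutant of the symmetric group\<close>

definition commutes :: "'b set \<Rightarrow> 'b op \<Rightarrow> 'b op \<Rightarrow> bool"
  where "commutes B M A \<longleftrightarrow> op_mult B M A = op_mult B A M"

lemma commutes_sum:
  assumes "\<And>j. j \<in> I \<Longrightarrow> commutes B M (A j)"
  shows "commutes B M (\<lambda>x y. \<Sum>j\<in>I. c j * A j x y)"
  using assms unfolding commutes_def op_mult_sum_left op_mult_sum_right by (auto intro!: sum.cong)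

lemma commutes_mult:
  "commutes B M A \<Longrightarrow> commutes B M C \<Longrightarrow> commutes B M (op_mult B A C)"
  unfolding commutes_def by (metis op_mult_assoc)

definition tensor_span :: "nat \<Rightarrow> nat \<Rightarrow> (nat \<Rightarrow> nat) op set"
  where "tensor_span d n = {M. \<exists>c. \<forall>X Y. M X Y = (\<Sum>i\<in>unit_index d. c i * tensor_unit d n i X Y)}"

lemma tensor_span_sum:
  assumes "\<And>j. j \<in> I \<Longrightarrow> A j \<in> tensor_span d n"
  shows "(\<lambda>X Y. \<Sum>j\<in>I. a j * A j X Y) \<in> tensor_span d n"
proof -
  have "\<forall>j\<in>I. \<exists>c. \<forall>X Y. A j X Y = (\<Sum>i\<in>unit_index d. c i * tensor_unit d n i X Y)"
    using assms by (simp add: tensor_span_def)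
  from bchoice[OF this] obtain c where
    c: "\<forall>j\<in>I. \<forall>X Y. A j X Y = (\<Sum>i\<in>unit_index d. c j i * tensor_unit d n i X Y)" ..
  have "(\<Sum>j\<in>I. a j * A j X Y) = (\<Sum>i\<in>unit_index d. (\<Sum>j\<in>I. a j * c j i) * tensor_unit d n i X Y)" for X Y
  proof -
    have "(\<Sum>j\<in>I. a j * A j X Y) = (\<Sum>j\<in>I. \<Sum>i\<in>unit_index d. a j * c j i * tensor_unit d n i X Y)"
      by (intro sum.cong refl) (simp add: c sum_distrib_left mult.assoc)
    also have "\<dots> = (\<Sum>i\<in>unit_index d. \<Sum>j\<in>I. a j * c j i * tensor_unit d n i X Y)" by (rule sum.swap)
    finally show ?thesis by (simp add: sum_distrib_right)
  qed
  then show ?thesis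
    unfolding tensor_span_def by (intro CollectI exI[of _ "\<lambda>i. \<Sum>j\<in>I. a j * c j i"] allI)
qed

lemma tensor_unit_in_span: "i \<in> unit_index d \<Longrightarrow> tensor_unit d n i \<in> tensor_span d n"
  unfolding tensor_span_def
  by (intro CollectI exI[of _ "\<lambda>j. if j = i then 1 else 0"])
    (simp add: finite_unit_index if_distrib[of "\<lambda>x. x * _"] cong: if_cong)

lemma op_trace_op_mult:
  "op_trace B (op_mult B A C) = (\<Sum>Y\<in>B. \<Sum>b\<in>B. A Y b * C b Y)"
  by (simp add: op_trace_def op_mult_def)

text \<open>For any \<open>e\<close> the operator \<open>\<Sum>\<^sub>S P\<^sub>S\<^sub>T e P\<^sub>T\<^sub>S\<close> commutes with the group algebra, hence with \<open>M\<close>. Take \<open>e\<close> to be a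
  standard matrix unit and contract this identity with \<open>P\<^sub>T\<^sub>T\<close>: because the trace of \<open>P\<^sub>T\<^sub>S P\<^sub>T\<^sub>T\<close> vanishes
  unless \<open>S = T\<close>, what remains is \<open>tr(P\<^sub>T\<^sub>T) M P\<^sub>T\<^sub>T = \<Sum>\<^sub>S tr(P\<^sub>T\<^sub>S M P\<^sub>T\<^sub>T) P\<^sub>S\<^sub>T\<close>.\<close>

lemma bicommutant_column:
  assumes comm: "\<And>A. A \<in> ops (multi_idx d n) \<Longrightarrow>
      (\<And>\<sigma>. \<sigma> permutes {1..d} \<Longrightarrow> commutes (multi_idx d n) A (perm_op d n \<sigma>)) \<Longrightarrow>
      commutes (multi_idx d n) M A"
    and M: "M \<in> ops (multi_idx d n)"
    and idx: "(lam, T, T) \<in> unit_index d"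
  shows "op_mult (multi_idx d n) M (tensor_unit d n (lam, T, T)) \<in> tensor_span d n"
proof -
  let ?W = "multi_idx d n" and ?P = "tensor_unit d n" and ?S = "Stab lam"
  have lam: "young_diagram d lam" and T: "T \<in> ?S" using idx by (auto simp: unit_index_def)
  have id: "(lam, A, B) \<in> unit_index d" if "A \<in> ?S" "B \<in> ?S" for A B
    using that lam by (simp add: unit_index_def)
  \<comment> \<open>the operators \<open>\<Sum>\<^sub>S P\<^sub>S\<^sub>T e P\<^sub>T\<^sub>S\<close> for \<open>e\<close> the matrix unit at \<open>(X, Y)\<close>\<close>
  define A where "A = (\<lambda>X Y a b. \<Sum>S\<in>?S. 1 * (?P (lam, S, T) a X * ?P (lam, T, S) Y b))"
  have A_perm: "commutes ?W (A X Y) (perm_op d n \<sigma>)"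
    if X: "X \<in> ?W" and Y: "Y \<in> ?W" and \<sigma>: "\<sigma> permutes {1..d}" for X Y \<sigma>
    unfolding perm_op_expansion[OF \<sigma>]
  proof (rule commutes_sum)
    fix j assume j: "j \<in> unit_index d"
    obtain bet U V where j': "j = (bet, U, V)" by (metis prod_cases3)
    have left: "op_mult ?W (A X Y) (?P j) a b = (\<Sum>S\<in>?S. ?P (lam, S, T) a X * op_mult ?W (?P (lam, T, S)) (?P j) Y b)" for a b
      unfolding A_def op_mult_sum_left by (simp add: op_mult_def sum_distrib_left mult.assoc)
    have right: "op_mult ?W (?P j) (A X Y) a b = (\<Sum>S\<in>?S. op_mult ?W (?P j) (?P (lam, S, T)) a X * ?P (lam, T, S) Y b)" for a b
      unfolding A_def op_mult_sum_right by (simp add: op_mult_def sum_distrib_right mult.assoc)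
    show "commutes ?W (A X Y) (?P j)"
      unfolding commutes_def
    proof (intro ext)
      fix a b
      have "op_mult ?W (A X Y) (?P j) a b = (\<Sum>S\<in>?S. if S = U then (if bet = lam then ?P (lam, U, T) a X * ?P (lam, T, V) Y b else 0) else 0)"
        unfolding left
      proof (rule sum.cong[OF refl])
        fix S assume S: "S \<in> ?S"
        show "?P (lam, S, T) a X * op_mult ?W (?P (lam, T, S)) (?P j) Y b =
            (if S = U then (if bet = lam then ?P (lam, U, T) a X * ?P (lam, T, V) Y b else 0) else 0)"
          unfolding j' tensor_unit_mult[OF id[OF T S] j[unfolded j']] by (auto simp: op_zero_def)
      qed
      also have "\<dots> = (if bet = lam then ?P (lam, U, T) a X * ?P (lam, T, V) Y b else 0)"
        using j lam by (auto simp: j' unit_index_def finite_Stab'[OF lam])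
      also have "\<dots> = (\<Sum>S\<in>?S. if S = V then (if bet = lam then ?P (lam, U, T) a X * ?P (lam, T, V) Y b else 0) else 0)"
        using j lam by (auto simp: j' unit_index_def finite_Stab'[OF lam])
      also have "\<dots> = op_mult ?W (?P j) (A X Y) a b"
        unfolding right
      proof (rule sum.cong[OF refl])
        fix S assume S: "S \<in> ?S"
        show "(if S = V then (if bet = lam then ?P (lam, U, T) a X * ?P (lam, T, V) Y b else 0) else 0) =
            op_mult ?W (?P j) (?P (lam, S, T)) a X * ?P (lam, T, S) Y b"
          unfolding j' tensor_unit_mult[OF j[unfolded j'] id[OF S T]] by (auto simp: op_zero_def)
      qed
      finally show "op_mult ?W (A X Y) (?P j) a b = op_mult ?W (?P j) (A X Y) a b" .
    qed
  qed
  have A_ops: "A X Y \<in> ops ?W" for X Y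
    unfolding ops_def
  proof (intro CollectI allI impI conjI)
    fix a b assume ne: "A X Y a b \<noteq> 0"
    show "a \<in> ?W"
    proof (rule ccontr)
      assume "a \<notin> ?W"
      then show False using ne tensor_rep_outside[of a d n X] by (simp add: A_def)
    qed
    show "b \<in> ?W"
    proof (rule ccontr)
      assume "b \<notin> ?W"
      then show False using ne tensor_rep_outside[of Y d n b] by (simp add: A_def)
    qed
  qed
  have key: "(\<Sum>S\<in>?S. op_mult ?W M (?P (lam, S, T)) a X * ?P (lam, T, S) Y b) =
      (\<Sum>S\<in>?S. ?P (lam, S, T) a X * op_mult ?W (?P (lam, T, S)) M Y b)"
    if X: "X \<in> ?W" and Y: "Y \<in> ?W" for a b X Y
  proof -
    have "op_mult ?W M (A X Y) a b = op_mult ?W (A X Y) M a b"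
      using comm[OF A_ops A_perm[OF X Y]] unfolding commutes_def by simp
    then show ?thesis
      unfolding A_def op_mult_sum_left op_mult_sum_right
      by (simp add: op_mult_def sum_distrib_left sum_distrib_right mult.assoc)
  qed
  define t where "t = op_trace ?W (?P (lam, T, T))"
  define c where "c = (\<lambda>S. op_trace ?W (op_mult ?W (op_mult ?W (?P (lam, T, S)) M) (?P (lam, T, T))))"
  have contracted: "t * op_mult ?W M (?P (lam, T, T)) a X = (\<Sum>S\<in>?S. c S * ?P (lam, S, T) a X)"
    if X: "X \<in> ?W" for a X
  proof -
    have "(\<Sum>Y\<in>?W. \<Sum>b\<in>?W. (\<Sum>S\<in>?S. op_mult ?W M (?P (lam, S, T)) a X * ?P (lam, T, S) Y b) * ?P (lam, T, T) b Y) =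
        (\<Sum>Y\<in>?W. \<Sum>b\<in>?W. (\<Sum>S\<in>?S. ?P (lam, S, T) a X * op_mult ?W (?P (lam, T, S)) M Y b) * ?P (lam, T, T) b Y)"
      by (intro sum.cong refl) (simp only: key[OF X])
    moreover have "(\<Sum>Y\<in>?W. \<Sum>b\<in>?W. (\<Sum>S\<in>?S. f S * g S Y b) * h b Y) =
        (\<Sum>S\<in>?S. f S * op_trace ?W (op_mult ?W (g S) h))" for f g h
    proof -
      have "(\<Sum>Y\<in>?W. \<Sum>b\<in>?W. (\<Sum>S\<in>?S. f S * g S Y b) * h b Y) =
          (\<Sum>Y\<in>?W. \<Sum>b\<in>?W. \<Sum>S\<in>?S. f S * (g S Y b * h b Y))"
        by (simp add: sum_distrib_right mult.assoc)
      also have "\<dots> = (\<Sum>Y\<in>?W. \<Sum>S\<in>?S. \<Sum>b\<in>?W. f S * (g S Y b * h b Y))"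
        by (intro sum.cong refl) (rule sum.swap)
      also have "\<dots> = (\<Sum>S\<in>?S. \<Sum>Y\<in>?W. \<Sum>b\<in>?W. f S * (g S Y b * h b Y))" by (rule sum.swap)
      finally show ?thesis by (simp add: op_trace_op_mult sum_distrib_left)
    qed
    ultimately have "(\<Sum>S\<in>?S. op_mult ?W M (?P (lam, S, T)) a X * op_trace ?W (op_mult ?W (?P (lam, T, S)) (?P (lam, T, T)))) =
        (\<Sum>S\<in>?S. ?P (lam, S, T) a X * c S)"
      by (simp add: c_def)
    moreover have "(\<Sum>S\<in>?S. op_mult ?W M (?P (lam, S, T)) a X * op_trace ?W (op_mult ?W (?P (lam, T, S)) (?P (lam, T, T)))) =
        (\<Sum>S\<in>?S. if S = T then op_mult ?W M (?P (lam, T, T)) a X * t else 0)"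
    proof (rule sum.cong[OF refl])
      fix S assume S: "S \<in> ?S"
      show "op_mult ?W M (?P (lam, S, T)) a X * op_trace ?W (op_mult ?W (?P (lam, T, S)) (?P (lam, T, T))) =
          (if S = T then op_mult ?W M (?P (lam, T, T)) a X * t else 0)"
        unfolding tensor_unit_mult[OF id[OF T S] id[OF T T]] by (auto simp: t_def op_trace_def op_zero_def)
    qed
    ultimately show ?thesis
      using T by (simp add: finite_Stab'[OF lam] mult.commute)
  qed
  have outside: "op_mult ?W M (?P (lam, T, T)) a X = 0" "?P (lam, S, T) a X = 0" if "X \<notin> ?W" for a X S
    using that tensor_rep_outside[of a d n X] by (simp_all add: op_mult_def tensor_rep_outside)
  show ?thesis
  proof (cases "t = 0")
    case True
    have "hs_inner ?W (?P (lam, T, T)) (?P (lam, T, T)) = t"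
      unfolding hs_inner_def tensor_unit_adj[OF idx] tensor_unit_mult[OF idx idx] by (simp add: t_def)
    then have "?P (lam, T, T) a X = 0" for a X
      using True hs_inner_self_eq_0[OF finite_multi_idx, of d n "?P (lam, T, T)" a X]
        tensor_rep_outside[of a d n X] by auto
    then have "op_mult ?W M (?P (lam, T, T)) = (\<lambda>X Y. \<Sum>j\<in>{}. 0 * op_zero X Y)"
      unfolding op_mult_def by (auto simp: fun_eq_iff)
    then show ?thesis using tensor_span_sum[of "{}" "\<lambda>_. op_zero" d n "\<lambda>_. 0"] by simp
  next
    case False
    have "op_mult ?W M (?P (lam, T, T)) a X = (\<Sum>S\<in>?S. (c S / t) * ?P (lam, S, T) a X)" for a X
    proof (cases "X \<in> ?W")
      case True
      have "op_mult ?W M (?P (lam, T, T)) a X = (\<Sum>S\<in>?S. c S * ?P (lam, S, T) a X) / t"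
        using contracted[OF True, of a] False by (simp add: field_simps)
      then show ?thesis by (simp add: sum_divide_distrib)
    next
      case False
      show ?thesis using outside[OF False] by simp
    qed
    then have "op_mult ?W M (?P (lam, T, T)) = (\<lambda>a X. \<Sum>S\<in>?S. (c S / t) * ?P (lam, S, T) a X)"
      by (intro ext)
    then show ?thesis
      using tensor_span_sum[of ?S "\<lambda>S. ?P (lam, S, T)" d n "\<lambda>S. c S / t"] tensor_unit_in_span[OF id[OF _ T]] by simp
  qed
qed

text \<open>Sum \<open>M P\<^sub>T\<^sub>T\<close> over all \<open>T\<close>; the diagonal units add up to the identity.\<close>

lemma bicommutant:
  assumes comm: "\<And>A. A \<in> ops (multi_idx d n) \<Longrightarrow>
      (\<And>\<sigma>. \<sigma> permutes {1..d} \<Longrightarrow> commutes (multi_idx d n) A (perm_op d n \<sigma>)) \<Longrightarrow>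
      commutes (multi_idx d n) M A"
    and M: "M \<in> ops (multi_idx d n)"
  shows "M \<in> tensor_span d n"
proof -
  let ?W = "multi_idx d n" and ?P = "tensor_unit d n"
  define c :: "nat list \<times> filling \<times> filling \<Rightarrow> complex"
    where "c = (\<lambda>(lam, S, T). if S = T then 1 else 0)"
  have one: "perm_op d n id X Y = (\<Sum>i\<in>unit_index d. c i * ?P i X Y)" for X Y
    unfolding perm_op_expansion[OF permutes_id]
  proof (intro sum.cong refl)
    fix i assume i: "i \<in> unit_index d"
    obtain lam S T where i': "i = (lam, S, T)" by (metis prod_cases3)
    then have "young_rep d lam id S T = c i"
      using i young.rho_id[OF young.intro, of d lam] by (auto simp: unit_index_def op_one_def c_def)
    then show "(case i of (lam, S, T) \<Rightarrow> young_rep d lam id S T) * ?P i X Y = c i * ?P i X Y"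
      by (simp add: i')
  qed
  have "M = op_mult ?W M (perm_op d n id)"
  proof (intro ext)
    fix X Y
    have "op_mult ?W M (perm_op d n id) X Y = (\<Sum>Z\<in>?W. if Z = Y then M X Y else 0)"
      unfolding op_mult_def perm_op_def by (intro sum.cong refl) auto
    also have "\<dots> = M X Y" using M finite_multi_idx[of d n] by (auto simp: ops_def)
    finally show "M X Y = op_mult ?W M (perm_op d n id) X Y" ..
  qed
  also have "perm_op d n id = (\<lambda>X Y. \<Sum>i\<in>unit_index d. c i * ?P i X Y)" using one by (intro ext)
  also have "op_mult ?W M \<dots> = (\<lambda>X Y. \<Sum>i\<in>unit_index d. c i * op_mult ?W M (?P i) X Y)"
    by (rule op_mult_sum_right)
  also have "\<dots> = (\<lambda>X Y. \<Sum>i\<in>{i \<in> unit_index d. c i \<noteq> 0}. c i * op_mult ?W M (?P i) X Y)"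
    by (intro ext sum.mono_neutral_right finite_unit_index) auto
  also have "\<dots> \<in> tensor_span d n"
  proof (rule tensor_span_sum)
    fix i assume i: "i \<in> {i \<in> unit_index d. c i \<noteq> 0}"
    obtain lam S T where i': "i = (lam, S, T)" by (metis prod_cases3)
    then have "S = T" using i by (auto simp: c_def split: if_splits)
    then show "op_mult ?W M (?P i) \<in> tensor_span d n"
      using bicommutant_column[OF comm M, of lam T] i i' by simp
  qed
  finally show ?thesis .
qed

section \<open>Operators commuting with tensor powers of unitaries\<close>

lemma op_mult_tensor_op:
  "op_mult (multi_idx d n) (tensor_op d n A) (tensor_op d n C) = tensor_op d n (\<lambda>r. op_mult {1..n} (A r) (C r))"
proof (intro ext)
  fix X Y
  show "op_mult (multi_idx d n) (tensor_op d n A) (tensor_op d n C) X Y =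
      tensor_op d n (\<lambda>r. op_mult {1..n} (A r) (C r)) X Y"
  proof (cases "X \<in> multi_idx d n \<and> Y \<in> multi_idx d n")
    case True
    then have "op_mult (multi_idx d n) (tensor_op d n A) (tensor_op d n C) X Y =
        (\<Sum>Z\<in>multi_idx d n. \<Prod>r=1..d. A r (X r) (Z r) * C r (Z r) (Y r))"
      unfolding op_mult_def by (intro sum.cong refl) (simp add: tensor_op_def prod.distrib)
    also have "\<dots> = (\<Prod>r=1..d. \<Sum>z\<in>{1..n}. A r (X r) z * C r z (Y r))"
      unfolding multi_idx_def by (rule prod_sum_PiE[symmetric]) simp_all
    finally show ?thesis using True by (simp add: tensor_op_def op_mult_def)
  qed (auto simp: op_mult_def tensor_op_def)
qed

lemma tensor_op_cong:
  assumes "\<And>r x y. r \<in> {1..d} \<Longrightarrow> x \<in> {1..n} \<Longrightarrow> y \<in> {1..n} \<Longrightarrow> A r x y = C r x y"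
  shows "tensor_op d n A = tensor_op d n C"
proof (intro ext)
  fix X Y
  show "tensor_op d n A X Y = tensor_op d n C X Y"
    unfolding tensor_op_def by (auto intro!: prod.cong assms simp: multi_idx_def PiE_def Pi_def)
qed

lemma tensor_op_outside: "X \<notin> multi_idx d n \<or> Y \<notin> multi_idx d n \<Longrightarrow> tensor_op d n A X Y = 0"
  by (auto simp: tensor_op_def)

lemma op_mult_one:
  assumes "finite B" "x \<in> B" "y \<in> B"
  shows "op_mult B (op_one B) A x y = A x y" "op_mult B A (op_one B) x y = A x y"
proof -
  have "op_mult B (op_one B) A x y = (\<Sum>z\<in>B. if z = x then A x y else 0)"
    unfolding op_mult_def op_one_def by (intro sum.cong refl) auto
  then show "op_mult B (op_one B) A x y = A x y" using assms by simp
  have "op_mult B A (op_one B) x y = (\<Sum>z\<in>B. if z = y then A x y else 0)"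
    unfolding op_mult_def op_one_def by (intro sum.cong refl) auto
  then show "op_mult B A (op_one B) x y = A x y" using assms by simp
qed

lemma multi_idx_range: "X \<in> multi_idx d n \<Longrightarrow> r \<in> {1..d} \<Longrightarrow> X r \<in> {1..n}"
  by (auto simp: multi_idx_def PiE_def Pi_def)

lemma multi_idx_eqI:
  assumes "X \<in> multi_idx d n" "Y \<in> multi_idx d n" "\<And>r. r \<in> {1..d} \<Longrightarrow> X r = Y r"
  shows "X = Y"
  using assms unfolding multi_idx_def by (intro PiE_ext)

lemma tensor_op_one: "tensor_op d n (\<lambda>r. op_one {1..n}) = op_one (multi_idx d n)"
proof (intro ext)
  fix X Y
  show "tensor_op d n (\<lambda>r. op_one {1..n}) X Y = op_one (multi_idx d n) X Y"
  proof (cases "X \<in> multi_idx d n \<and> Y \<in> multi_idx d n")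
    case True
    then have "tensor_op d n (\<lambda>r. op_one {1..n}) X Y = (\<Prod>r=1..d. if X r = Y r then 1 else 0)"
      using multi_idx_range[of X d n] by (auto simp: tensor_op_def op_one_def intro!: prod.cong)
    also have "\<dots> = (if X = Y then 1 else 0)"
    proof (cases "X = Y")
      case False
      then obtain r where "r \<in> {1..d}" "X r \<noteq> Y r" using multi_idx_eqI True by blast
      then show ?thesis using False by (auto intro!: prod_zero)
    qed simp
    finally show ?thesis using True by (simp add: op_one_def)
  qed (auto simp: tensor_op_def op_one_def)
qed

lemma mat_unit_eq:
  assumes "I \<in> multi_idx d n" "J \<in> multi_idx d n"
  shows "mat_unit d n I J = op_unit I J"
proof (intro ext)
  fix X Y
  show "mat_unit d n I J X Y = op_unit I J X Y"
  proof (cases "X \<in> multi_idx d n \<and> Y \<in> multi_idx d n")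
    case True
    show ?thesis
    proof (cases "X = I \<and> Y = J")
      case True
      then show ?thesis using assms by (simp add: mat_unit_def tensor_op_def op_unit_def)
    next
      case False
      then obtain r where "r \<in> {1..d}" "X r \<noteq> I r \<or> Y r \<noteq> J r"
        using multi_idx_eqI[OF _ assms(1), of X] multi_idx_eqI[OF _ assms(2), of Y] True by blast
      then have "mat_unit d n I J X Y = 0"
        by (auto simp: mat_unit_def tensor_op_def op_unit_def intro!: prod_zero)
      then show ?thesis using False by (simp add: op_unit_def)
    qed
  next
    case False
    then show ?thesis using assms by (auto simp: mat_unit_def tensor_op_def op_unit_def)
  qed
qed

lemma commutes_add:
  assumes "commutes B M A" "commutes B M C"
  shows "commutes B M (\<lambda>x y. A x y + C x y)"
proof -
  have "op_mult B M (\<lambda>x y. A x y + C x y) = (\<lambda>x y. op_mult B M A x y + op_mult B M C x y)"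
    "op_mult B (\<lambda>x y. A x y + C x y) M = (\<lambda>x y. op_mult B A M x y + op_mult B C M x y)"
    by (auto simp: op_mult_def sum.distrib algebra_simps)
  then show ?thesis using assms by (simp add: commutes_def)
qed

lemma commutes_scale:
  assumes "commutes B M A"
  shows "commutes B M (\<lambda>x y. c * A x y)"
proof -
  have "op_mult B M (\<lambda>x y. c * A x y) = (\<lambda>x y. c * op_mult B M A x y)"
    "op_mult B (\<lambda>x y. c * A x y) M = (\<lambda>x y. c * op_mult B A M x y)"
    by (auto simp: op_mult_def sum_distrib_left algebra_simps)
  then show ?thesis using assms by (simp add: commutes_def)
qed

section \<open>The Lie algebra action\<close>

text \<open>The derivative at the identity of \<open>u \<mapsto> u\<^sup>\<otimes>\<^sup>d\<close> in the direction \<open>x\<close>. The coefficient 1 brings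
  the sum into the form of \<open>op_mult_sum_left\<close>.\<close>

definition lie_op :: "nat \<Rightarrow> nat \<Rightarrow> nat op \<Rightarrow> (nat \<Rightarrow> nat) op"
  where "lie_op d n x X Y = (\<Sum>s\<in>{1..d}. 1 * tensor_op d n (\<lambda>r. if r = s then x else op_one {1..n}) X Y)"

lemma lie_op_entry:
  assumes "X \<in> multi_idx d n" "Y \<in> multi_idx d n"
  shows "lie_op d n x X Y = (\<Sum>s\<in>{1..d}. x (X s) (Y s) * (\<Prod>r\<in>{1..d}-{s}. op_one {1..n} (X r) (Y r)))"
  unfolding lie_op_def
proof (rule sum.cong[OF refl])
  fix s assume s: "s \<in> {1..d}"
  have "(\<Prod>r=1..d. (if r = s then x else op_one {1..n}) (X r) (Y r)) =
      x (X s) (Y s) * (\<Prod>r\<in>{1..d}-{s}. (if r = s then x else op_one {1..n}) (X r) (Y r))"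
    using s by (subst prod.remove[of _ s]) auto
  also have "(\<Prod>r\<in>{1..d}-{s}. (if r = s then x else op_one {1..n}) (X r) (Y r)) =
      (\<Prod>r\<in>{1..d}-{s}. op_one {1..n} (X r) (Y r))"
    by (intro prod.cong refl) auto
  finally show "1 * tensor_op d n (\<lambda>r. if r = s then x else op_one {1..n}) X Y =
      x (X s) (Y s) * (\<Prod>r\<in>{1..d}-{s}. op_one {1..n} (X r) (Y r))"
    using assms by (simp add: tensor_op_def)
qed

lemma lie_op_outside: "X \<notin> multi_idx d n \<or> Y \<notin> multi_idx d n \<Longrightarrow> lie_op d n x X Y = 0"
  by (auto simp: lie_op_def tensor_op_def)

lemma lie_op_add: "lie_op d n (\<lambda>a b. x a b + y a b) = (\<lambda>X Y. lie_op d n x X Y + lie_op d n y X Y)"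
proof (intro ext)
  fix X Y
  show "lie_op d n (\<lambda>a b. x a b + y a b) X Y = lie_op d n x X Y + lie_op d n y X Y"
    by (cases "X \<in> multi_idx d n \<and> Y \<in> multi_idx d n")
      (auto simp: lie_op_entry lie_op_outside distrib_right sum.distrib)
qed

lemma lie_op_scale: "lie_op d n (\<lambda>a b. c * x a b) = (\<lambda>X Y. c * lie_op d n x X Y)"
proof (intro ext)
  fix X Y
  show "lie_op d n (\<lambda>a b. c * x a b) X Y = c * lie_op d n x X Y"
    by (cases "X \<in> multi_idx d n \<and> Y \<in> multi_idx d n")
      (auto simp: lie_op_entry lie_op_outside sum_distrib_left mult.assoc)
qed

definition unitary_op :: "nat \<Rightarrow> nat op \<Rightarrow> bool"
  where "unitary_op n u \<longleftrightarrow> (\<forall>x\<in>{1..n}. \<forall>y\<in>{1..n}.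
    (\<Sum>z\<in>{1..n}. u x z * cnj (u y z)) = (if x = y then 1 else 0) \<and>
    (\<Sum>z\<in>{1..n}. cnj (u z x) * u z y) = (if x = y then 1 else 0))"

text \<open>The condition on \<open>w\<close> says that \<open>1 + w\<close> has absolute value 1: the vector \<open>v\<close> is multiplied by \<open>1 + w\<close> and its
  orthogonal complement is fixed.\<close>

lemma unitary_rank_one_perturbation:
  assumes v: "(\<Sum>z\<in>{1..n}. v z * cnj (v z)) = 1" and w: "w + cnj w + w * cnj w = 0"
  shows "unitary_op n (\<lambda>x y. op_one {1..n} x y + w * (v x * cnj (v y)))"
  unfolding unitary_op_def
proof (intro ballI conjI)
  fix x y assume x: "x \<in> {1..n}" and y: "y \<in> {1..n}"
  define D where "D = (op_one {1..n} :: nat op)"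
  let ?u = "\<lambda>x y. D x y + w * (v x * cnj (v y))"
  let ?c = "v x * cnj (v y)"
  have cnj_one: "cnj (D a b) = D a b" for a b by (simp add: D_def op_one_def)
  have delta: "(\<Sum>z\<in>{1..n}. D a z * f z) = f a" "(\<Sum>z\<in>{1..n}. D z a * f z) = f a"
    if "a \<in> {1..n}" for a f
  proof -
    have "(\<Sum>z\<in>{1..n}. D a z * f z) = (\<Sum>z\<in>{1..n}. if z = a then f a else 0)"
      by (intro sum.cong refl) (use that in \<open>auto simp: D_def op_one_def\<close>)
    then show "(\<Sum>z\<in>{1..n}. D a z * f z) = f a" using that by simp
    have "(\<Sum>z\<in>{1..n}. D z a * f z) = (\<Sum>z\<in>{1..n}. if z = a then f a else 0)"
      by (intro sum.cong refl) (use that in \<open>auto simp: D_def op_one_def\<close>)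
    then show "(\<Sum>z\<in>{1..n}. D z a * f z) = f a" using that by simp
  qed
  have "(\<Sum>z\<in>{1..n}. ?u x z * cnj (?u y z)) =
      (\<Sum>z\<in>{1..n}. D x z * D y z) +
      (\<Sum>z\<in>{1..n}. D x z * (cnj w * (cnj (v y) * v z))) +
      (\<Sum>z\<in>{1..n}. D y z * (w * (v x * cnj (v z)))) +
      w * cnj w * ?c * (\<Sum>z\<in>{1..n}. v z * cnj (v z))"
    by (simp add: cnj_one sum.distrib[symmetric] sum_distrib_left algebra_simps)
  also have "\<dots> = (if x = y then 1 else 0) + ?c * (w + cnj w + w * cnj w)"
    using x y unfolding v delta[OF x] delta[OF y] by (simp add: D_def op_one_def algebra_simps)
  finally show "(\<Sum>z\<in>{1..n}. (op_one {1..n} x z + w * (v x * cnj (v z))) *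
      cnj (op_one {1..n} y z + w * (v y * cnj (v z)))) = (if x = y then 1 else 0)"
    using w unfolding D_def by simp
  have "(\<Sum>z\<in>{1..n}. cnj (?u z x) * ?u z y) =
      (\<Sum>z\<in>{1..n}. D z x * D z y) +
      (\<Sum>z\<in>{1..n}. D z x * (w * (v z * cnj (v y)))) +
      (\<Sum>z\<in>{1..n}. D z y * (cnj w * (cnj (v z) * v x))) +
      w * cnj w * ?c * (\<Sum>z\<in>{1..n}. v z * cnj (v z))"
    by (simp add: cnj_one sum.distrib[symmetric] sum_distrib_left algebra_simps)
  also have "\<dots> = (if x = y then 1 else 0) + ?c * (w + cnj w + w * cnj w)"
    using x y unfolding v delta[OF x] delta[OF y] by (simp add: D_def op_one_def algebra_simps)
  finally show "(\<Sum>z\<in>{1..n}. cnj (op_one {1..n} z x + w * (v z * cnj (v x))) *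
      (op_one {1..n} z y + w * (v z * cnj (v y)))) = (if x = y then 1 else 0)"
    using w unfolding D_def by simp
qed

context
  fixes d n :: nat and M :: "(nat \<Rightarrow> nat) op"
  assumes M: "M \<in> ops (multi_idx d n)"
    and unitary: "\<And>u. unitary_op n u \<Longrightarrow> commutes (multi_idx d n) M (tensor_op d n (\<lambda>r. u))"
begin

abbreviation (input) "W \<equiv> multi_idx d n"

text \<open>Let \<open>P\<close> be the projection to \<open>v\<close>. The commutator of \<open>M\<close> with the tensor power of \<open>1 + w P\<close> is a polynomial in
  \<open>w\<close> that vanishes on the circle \<open>w = e\<^sup>i\<^sup>t - 1\<close>; its derivative at 0 is the commutator with the Lie
  algebra action of \<open>P\<close>, which therefore vanishes.\<close>

lemma commutes_lie_op_unit_vector: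
  assumes v: "(\<Sum>z\<in>{1..n}. v z * cnj (v z)) = 1"
  shows "commutes W M (lie_op d n (\<lambda>x y. v x * cnj (v y)))"
  unfolding commutes_def
proof (intro ext)
  fix X Y
  define P where "P = (\<lambda>x y. v x * cnj (v y))"
  define T where "T = (\<lambda>w. tensor_op d n (\<lambda>r x y. op_one {1..n} x y + w * P x y))"
  define f where "f = (\<lambda>w. op_mult W M (T w) X Y - op_mult W (T w) M X Y)"
  define g where "g = (\<lambda>t::real. cis t - 1)"
  have dT: "((\<lambda>w. T w A B) has_field_derivative lie_op d n P A B) (at 0)" for A B
  proof (cases "A \<in> W \<and> B \<in> W")
    case True
    have "((\<lambda>w. \<Prod>r=1..d. op_one {1..n} (A r) (B r) + w * P (A r) (B r)) has_field_derivative
        (\<Sum>s=1..d. P (A s) (B s) * (\<Prod>r\<in>{1..d}-{s}. op_one {1..n} (A r) (B r) + 0 * P (A r) (B r)))) (at 0)"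
      by (rule has_field_derivative_prod) (auto intro!: derivative_eq_intros)
    then show ?thesis using True by (simp add: T_def tensor_op_def lie_op_entry)
  next
    case False
    then show ?thesis by (simp add: T_def tensor_op_outside lie_op_outside)
  qed
  have df: "(f has_field_derivative (op_mult W M (lie_op d n P) X Y - op_mult W (lie_op d n P) M X Y)) (at 0)"
    unfolding f_def op_mult_def by (intro DERIV_diff DERIV_sum DERIV_cmult DERIV_cmult_right dT)
  have g0: "g 0 = 0" by (simp add: g_def)
  have dg: "(g has_vector_derivative \<i>) (at 0)"
    unfolding g_def has_vector_derivative_def
    by (auto intro!: derivative_eq_intros simp: scaleR_conv_of_real)
  have "((f \<circ> g) has_vector_derivative (\<i> * (op_mult W M (lie_op d n P) X Y - op_mult W (lie_op d n P) M X Y))) (at 0)"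
    using df by (intro field_vector_diff_chain_at dg) (simp add: g0)
  moreover have "f \<circ> g = (\<lambda>t. 0)"
  proof
    fix t
    have "cis t * cnj (cis t) = 1" by (simp add: cis_cnj cis_mult)
    then have "g t + cnj (g t) + g t * cnj (g t) = 0" by (simp add: g_def algebra_simps)
    then have "commutes W M (T (g t))"
      unfolding T_def P_def by (intro unitary unitary_rank_one_perturbation[OF v])
    then show "(f \<circ> g) t = 0" by (simp add: f_def commutes_def)
  qed
  ultimately have "\<i> * (op_mult W M (lie_op d n P) X Y - op_mult W (lie_op d n P) M X Y) = 0"
    by (metis has_vector_derivative_const vector_derivative_unique_at)
  then show "op_mult W M (lie_op d n (\<lambda>x y. v x * cnj (v y))) X Y = op_mult W (lie_op d n (\<lambda>x y. v x * cnj (v y))) M X Y"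
    by (simp add: P_def)
qed

lemma commutes_lie_op_vector: "commutes W M (lie_op d n (\<lambda>x y. v x * cnj (v y)))"
proof -
  define N where "N = (\<Sum>z\<in>{1..n}. (cmod (v z))\<^sup>2)"
  have N: "(\<Sum>z\<in>{1..n}. v z * cnj (v z)) = of_real N"
    by (simp add: N_def complex_norm_square[symmetric] of_real_sum del: of_real_power)
  have N0: "0 \<le> N" by (simp add: N_def sum_nonneg)
  show ?thesis
  proof (cases "N = 0")
    case True
    then have "v z = 0" if "z \<in> {1..n}" for z
      using that unfolding N_def by (subst (asm) sum_nonneg_eq_0_iff) auto
    then have "lie_op d n (\<lambda>x y. v x * cnj (v y)) X Y = 0" for X Y
      using multi_idx_range[of X d n]
      by (cases "X \<in> W \<and> Y \<in> W") (auto simp: lie_op_entry lie_op_outside)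
    then show ?thesis by (simp add: commutes_def op_mult_def)
  next
    case False
    define v' where "v' = (\<lambda>z. v z / of_real (sqrt N))"
    have sq: "complex_of_real (sqrt N) * complex_of_real (sqrt N) = of_real N"
      using N0 by (simp add: of_real_mult[symmetric] del: of_real_mult)
    have ne: "complex_of_real (sqrt N) \<noteq> 0" using False N0 by simp
    have v': "v' x * cnj (v' y) = (v x * cnj (v y)) / of_real N" for x y
      using ne by (simp add: v'_def sq[symmetric])
    have "(\<Sum>z\<in>{1..n}. v' z * cnj (v' z)) = (\<Sum>z\<in>{1..n}. v z * cnj (v z)) / of_real N"
      by (simp only: v' sum_divide_distrib)
    then have "(\<Sum>z\<in>{1..n}. v' z * cnj (v' z)) = of_real N / of_real N" by (simp only: N)
    then have "(\<Sum>z\<in>{1..n}. v' z * cnj (v' z)) = 1" using False by simp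
    then have "commutes W M (lie_op d n (\<lambda>x y. v' x * cnj (v' y)))" by (rule commutes_lie_op_unit_vector)
    then have "commutes W M (lie_op d n (\<lambda>x y. of_real N * (v' x * cnj (v' y))))"
      unfolding lie_op_scale by (rule commutes_scale)
    then show ?thesis using False by (simp add: v')
  qed
qed

text \<open>Polarization: the matrix units are combinations of rank one operators \<open>v v\<^sup>*\<close>.\<close>

lemma commutes_lie_op_unit: "commutes W M (lie_op d n (op_unit a b))"
proof -
  define V where "V = (\<lambda>v (x :: nat) (y :: nat). v x * cnj (v y) :: complex)"
  define e where "e = (\<lambda>a z :: nat. if z = a then 1 else 0 :: complex)"
  \<comment> \<open>\<open>e\<^sub>a e\<^sub>b\<^sup>* + e\<^sub>b e\<^sub>a\<^sup>*\<close> comes from \<open>e\<^sub>a + e\<^sub>b\<close>, and the difference of the two from \<open>e\<^sub>a + \<i> e\<^sub>b\<close>\<close>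
  define v1 where "v1 = (\<lambda>z. e a z + e b z)"
  define v2 where "v2 = (\<lambda>z. e a z + \<i> * e b z)"
  have eq: "op_unit a b = (\<lambda>x y. (1 / 2) * V v1 x y + ((\<i> / 2) * V v2 x y +
      ((- (1 + \<i>) / 2) * V (e a) x y + (- (1 + \<i>) / 2) * V (e b) x y)))"
  proof (intro ext)
    fix x y
    have ce: "cnj (e a z) = e a z" "cnj (e b z) = e b z" for z by (simp_all add: e_def)
    have "(1 / 2) * V v1 x y + ((\<i> / 2) * V v2 x y +
      ((- (1 + \<i>) / 2) * V (e a) x y + (- (1 + \<i>) / 2) * V (e b) x y)) = e a x * e b y"
      by (simp add: V_def v1_def v2_def ce field_simps)
    also have "\<dots> = op_unit a b x y" by (simp add: e_def op_unit_def)
    finally show "op_unit a b x y = (1 / 2) * V v1 x y + ((\<i> / 2) * V v2 x y +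
      ((- (1 + \<i>) / 2) * V (e a) x y + (- (1 + \<i>) / 2) * V (e b) x y))" ..
  qed
  have V: "commutes W M (lie_op d n (V v))" for v
    using commutes_lie_op_vector[of v] by (simp add: V_def)
  show ?thesis
    unfolding eq lie_op_add lie_op_scale by (intro commutes_add commutes_scale V)
qed

lemma commutes_lie_op: "commutes W M (lie_op d n x)"
proof -
  have eq: "lie_op d n x = (\<lambda>X Y. \<Sum>p\<in>{1..n}\<times>{1..n}. x (fst p) (snd p) * lie_op d n (op_unit (fst p) (snd p)) X Y)"
  proof (intro ext)
    fix X Y
    show "lie_op d n x X Y = (\<Sum>p\<in>{1..n}\<times>{1..n}. x (fst p) (snd p) * lie_op d n (op_unit (fst p) (snd p)) X Y)"
    proof (cases "X \<in> W \<and> Y \<in> W")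
      case True
      let ?c = "\<lambda>s. \<Prod>r\<in>{1..d}-{s}. op_one {1..n} (X r) (Y r)"
      have "(\<Sum>p\<in>{1..n}\<times>{1..n}. x (fst p) (snd p) * lie_op d n (op_unit (fst p) (snd p)) X Y) =
          (\<Sum>p\<in>{1..n}\<times>{1..n}. \<Sum>s\<in>{1..d}. x (fst p) (snd p) * op_unit (fst p) (snd p) (X s) (Y s) * ?c s)"
        using True by (simp add: lie_op_entry sum_distrib_left mult.assoc)
      also have "\<dots> = (\<Sum>s\<in>{1..d}. \<Sum>p\<in>{1..n}\<times>{1..n}. x (fst p) (snd p) * op_unit (fst p) (snd p) (X s) (Y s) * ?c s)"
        by (rule sum.swap)
      also have "\<dots> = (\<Sum>s\<in>{1..d}. x (X s) (Y s) * ?c s)"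
      proof (rule sum.cong[OF refl])
        fix s assume s: "s \<in> {1..d}"
        have "(\<Sum>p\<in>{1..n}\<times>{1..n}. x (fst p) (snd p) * op_unit (fst p) (snd p) (X s) (Y s) * ?c s) =
            (\<Sum>p\<in>{1..n}\<times>{1..n}. if p = (X s, Y s) then x (X s) (Y s) * ?c s else 0)"
          by (intro sum.cong refl) (auto simp: op_unit_def)
        also have "\<dots> = x (X s) (Y s) * ?c s"
          using True multi_idx_range[of X d n s] multi_idx_range[of Y d n s] s
          by (subst sum.delta) auto
        finally show "(\<Sum>p\<in>{1..n}\<times>{1..n}. x (fst p) (snd p) * op_unit (fst p) (snd p) (X s) (Y s) * ?c s) =
            x (X s) (Y s) * ?c s" .
      qed
      finally show ?thesis using True by (simp add: lie_op_entry)
    next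
      case False
      then show ?thesis by (simp add: lie_op_outside)
    qed
  qed
  show ?thesis unfolding eq by (intro commutes_sum commutes_lie_op_unit)
qed

section \<open>Symmetrized tensors\<close>

text \<open>The symmetrization of \<open>x\<^sub>1 \<otimes> \<dots> \<otimes> x\<^sub>j \<otimes> 1 \<otimes> \<dots> \<otimes> 1\<close>.\<close>

definition sym_op :: "nat \<Rightarrow> (nat \<Rightarrow> nat op) \<Rightarrow> (nat \<Rightarrow> nat) op"
  where "sym_op j x = (\<lambda>X Y. \<Sum>\<sigma>\<in>{\<sigma>. \<sigma> permutes {1..d}}.
    1 * tensor_op d n (\<lambda>r. if \<sigma> r \<le> j then x (\<sigma> r) else op_one {1..n}) X Y)"

text \<open>The Lie algebra element \<open>y\<close> meets either a slot occupied by some \<open>x\<^sub>u\<close> or one of the \<open>d - j\<close> empty slots;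
  by symmetry all empty slots give the same sum. This allows to fill the slots one after the other.\<close>

lemma lie_op_mult_sym_op:
  assumes j: "j < d"
  shows "op_mult W (lie_op d n y) (sym_op j x) X Y =
    (\<Sum>u\<in>{1..j}. sym_op j (x(u := op_mult {1..n} y (x u))) X Y) + of_nat (d - j) * sym_op (Suc j) (x(Suc j := y)) X Y"
proof -
  let ?S = "{\<sigma>. \<sigma> permutes {1..d}}" and ?I = "op_one {1..n} :: nat op"
  define c :: "(nat \<Rightarrow> nat) \<Rightarrow> nat \<Rightarrow> nat op" where "c = (\<lambda>\<sigma> r. if \<sigma> r \<le> j then x (\<sigma> r) else ?I)"
  define t where "t = (\<lambda>u \<sigma>. tensor_op d n (\<lambda>r. if \<sigma> r = u then op_mult {1..n} y (c \<sigma> r) else c \<sigma> r) X Y)"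
  have one: "op_mult {1..n} ?I A a b = A a b" "op_mult {1..n} A ?I a b = A a b"
    if "a \<in> {1..n}" "b \<in> {1..n}" for A a b
    using op_mult_one[of "{1..n}" a b A] that by simp_all
  have lie: "lie_op d n y = (\<lambda>X Y. \<Sum>s\<in>{1..d}. 1 * tensor_op d n (\<lambda>r. if r = s then y else ?I) X Y)"
    by (intro ext) (simp add: lie_op_def)
  have "op_mult W (lie_op d n y) (sym_op j x) X Y =
      (\<Sum>s\<in>{1..d}. \<Sum>\<sigma>\<in>?S. op_mult W (tensor_op d n (\<lambda>r. if r = s then y else ?I)) (tensor_op d n (c \<sigma>)) X Y)"
    unfolding sym_op_def lie op_mult_sum_left op_mult_sum_right by (simp add: c_def[abs_def])
  also have "\<dots> = (\<Sum>\<sigma>\<in>?S. \<Sum>s\<in>{1..d}. op_mult W (tensor_op d n (\<lambda>r. if r = s then y else ?I)) (tensor_op d n (c \<sigma>)) X Y)"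
    by (rule sum.swap)
  also have "\<dots> = (\<Sum>\<sigma>\<in>?S. \<Sum>u\<in>{1..d}. t u \<sigma>)"
  proof (rule sum.cong[OF refl])
    fix \<sigma> assume "\<sigma> \<in> ?S"
    then have \<sigma>: "\<sigma> permutes {1..d}" by simp
    have "(\<Sum>s\<in>{1..d}. op_mult W (tensor_op d n (\<lambda>r. if r = s then y else ?I)) (tensor_op d n (c \<sigma>)) X Y) =
        (\<Sum>s\<in>{1..d}. t (\<sigma> s) \<sigma>)"
    proof (rule sum.cong[OF refl])
      fix s
      have "tensor_op d n (\<lambda>r. op_mult {1..n} (if r = s then y else ?I) (c \<sigma> r)) =
          tensor_op d n (\<lambda>r. if \<sigma> r = \<sigma> s then op_mult {1..n} y (c \<sigma> r) else c \<sigma> r)"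
        using one permutes_eq_iff[OF \<sigma>] by (intro tensor_op_cong) simp
      then show "op_mult W (tensor_op d n (\<lambda>r. if r = s then y else ?I)) (tensor_op d n (c \<sigma>)) X Y = t (\<sigma> s) \<sigma>"
        unfolding op_mult_tensor_op t_def by simp
    qed
    also have "\<dots> = (\<Sum>u\<in>{1..d}. t u \<sigma>)"
      by (rule sum.reindex_bij_betw[OF permutes_imp_bij[OF \<sigma>]])
    finally show "(\<Sum>s\<in>{1..d}. op_mult W (tensor_op d n (\<lambda>r. if r = s then y else ?I)) (tensor_op d n (c \<sigma>)) X Y) =
        (\<Sum>u\<in>{1..d}. t u \<sigma>)" .
  qed
  also have "\<dots> = (\<Sum>u\<in>{1..d}. \<Sum>\<sigma>\<in>?S. t u \<sigma>)" by (rule sum.swap)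
  also have "\<dots> = (\<Sum>u\<in>{1..j}. \<Sum>\<sigma>\<in>?S. t u \<sigma>) + (\<Sum>u\<in>{Suc j..d}. \<Sum>\<sigma>\<in>?S. t u \<sigma>)"
  proof -
    have "{1..d} = {1..j} \<union> {Suc j..d}" using j by auto
    then show ?thesis by (simp only:) (rule sum.union_disjoint, auto)
  qed
  also have "(\<Sum>u\<in>{1..j}. \<Sum>\<sigma>\<in>?S. t u \<sigma>) = (\<Sum>u\<in>{1..j}. sym_op j (x(u := op_mult {1..n} y (x u))) X Y)"
  proof (rule sum.cong[OF refl])
    fix u assume u: "u \<in> {1..j}"
    have "(\<lambda>r. if \<sigma> r = u then op_mult {1..n} y (c \<sigma> r) else c \<sigma> r) =
        (\<lambda>r. if \<sigma> r \<le> j then (x(u := op_mult {1..n} y (x u))) (\<sigma> r) else ?I)" for \<sigma>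
      using u by (auto simp: c_def)
    then show "(\<Sum>\<sigma>\<in>?S. t u \<sigma>) = sym_op j (x(u := op_mult {1..n} y (x u))) X Y"
      by (simp only: t_def sym_op_def mult_1)
  qed
  also have "(\<Sum>u\<in>{Suc j..d}. \<Sum>\<sigma>\<in>?S. t u \<sigma>) = (\<Sum>u\<in>{Suc j..d}. sym_op (Suc j) (x(Suc j := y)) X Y)"
  proof (rule sum.cong[OF refl])
    fix u assume u: "u \<in> {Suc j..d}"
    \<comment> \<open>relabelling slots moves the new factor \<open>y\<close> to slot \<open>j + 1\<close>\<close>
    let ?\<tau> = "Transposition.transpose (Suc j) u"
    have \<tau>: "?\<tau> permutes {1..d}" using u by (intro permutes_swap_id) auto
    have "(\<Sum>\<sigma>\<in>?S. t u \<sigma>) = (\<Sum>\<sigma>\<in>?S. t u (?\<tau> \<circ> \<sigma>))"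
      by (rule sum.reindex_bij_betw[OF bij_betw_left_translation[OF \<tau>], symmetric])
    also have "\<dots> = sym_op (Suc j) (x(Suc j := y)) X Y"
      unfolding sym_op_def
    proof (rule sum.cong[OF refl])
      fix \<sigma>
      have low: "?\<tau> m = u \<longleftrightarrow> m = Suc j" "?\<tau> m \<le> j \<longleftrightarrow> m \<le> j" "m \<le> j \<Longrightarrow> ?\<tau> m = m" for m
        using u by (auto simp: Transposition.transpose_def)
      have "tensor_op d n (\<lambda>r. if (?\<tau> \<circ> \<sigma>) r = u then op_mult {1..n} y (c (?\<tau> \<circ> \<sigma>) r) else c (?\<tau> \<circ> \<sigma>) r) =
          tensor_op d n (\<lambda>r. if \<sigma> r \<le> Suc j then (x(Suc j := y)) (\<sigma> r) else ?I)"
      proof (rule tensor_op_cong)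
        fix r a b assume ab: "a \<in> {1..n}" "b \<in> {1..n}"
        consider "\<sigma> r = Suc j" | "\<sigma> r \<le> j" | "Suc j < \<sigma> r" by linarith
        then show "(if (?\<tau> \<circ> \<sigma>) r = u then op_mult {1..n} y (c (?\<tau> \<circ> \<sigma>) r) else c (?\<tau> \<circ> \<sigma>) r) a b =
            (if \<sigma> r \<le> Suc j then (x(Suc j := y)) (\<sigma> r) else ?I) a b"
          using low one(2)[OF ab] u by cases (auto simp: c_def)
      qed
      then show "t u (?\<tau> \<circ> \<sigma>) = 1 * tensor_op d n (\<lambda>r. if \<sigma> r \<le> Suc j then (x(Suc j := y)) (\<sigma> r) else ?I) X Y"
        by (simp only: t_def mult_1)
    qed
    finally show "(\<Sum>\<sigma>\<in>?S. t u \<sigma>) = sym_op (Suc j) (x(Suc j := y)) X Y" .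
  qed
  finally show ?thesis by (simp only: sum_constant card_atLeastAtMost diff_Suc_Suc)
qed

lemma commutes_sym_op: "j \<le> d \<Longrightarrow> commutes W M (sym_op j x)"
proof (induction j arbitrary: x)
  case 0
  have one: "commutes W M (op_one W)"
    unfolding commutes_def
  proof (intro ext)
    fix X Y
    show "op_mult W M (op_one W) X Y = op_mult W (op_one W) M X Y"
    proof (cases "X \<in> W \<and> Y \<in> W")
      case True
      then show ?thesis using op_mult_one[OF finite_multi_idx] by simp
    next
      case False
      have "X \<notin> W \<Longrightarrow> M X Z = 0" "Y \<notin> W \<Longrightarrow> M Z Y = 0" for Z
        using M by (auto simp: ops_def)
      then show ?thesis
        using False by (auto simp: op_mult_def op_one_def intro!: sum.neutral)
    qed
  qed
  have "tensor_op d n (\<lambda>r. if \<sigma> r \<le> 0 then x (\<sigma> r) else op_one {1..n}) = op_one W"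
    if "\<sigma> permutes {1..d}" for \<sigma>
  proof -
    have "tensor_op d n (\<lambda>r. if \<sigma> r \<le> 0 then x (\<sigma> r) else op_one {1..n}) = tensor_op d n (\<lambda>r. op_one {1..n})"
    proof (rule tensor_op_cong)
      fix r a b assume "r \<in> {1..d}"
      then have "\<sigma> r \<in> {1..d}" using permutes_in_image[OF that] by blast
      then show "(if \<sigma> r \<le> 0 then x (\<sigma> r) else op_one {1..n}) a b = op_one {1..n} a b" by simp
    qed
    then show ?thesis by (simp only: tensor_op_one)
  qed
  then show ?case
    unfolding sym_op_def by (intro commutes_sum) (simp add: one)
next
  case (Suc j)
  then have j: "j < d" by simp
  let ?y = "x (Suc j)"
  have eq: "sym_op (Suc j) x = (\<lambda>X Y. inverse (of_nat (d - j)) * (op_mult W (lie_op d n ?y) (sym_op j x) X Y +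
      (\<Sum>u\<in>{1..j}. - 1 * sym_op j (x(u := op_mult {1..n} ?y (x u))) X Y)))"
    using j by (auto simp: fun_eq_iff lie_op_mult_sym_op[OF j] sum_negf)
  show ?case
    unfolding eq using Suc.IH j
    by (intro commutes_scale commutes_add commutes_mult commutes_lie_op commutes_sum) simp_all
qed

text \<open>An operator commuting with permutations equals its average over \<open>S\<^sub>d\<close>, which is a combination of
  symmetrized tensor products of matrix units.\<close>

lemma commutes_symmetric:
  assumes A: "A \<in> ops W" and perm: "\<And>\<sigma>. \<sigma> permutes {1..d} \<Longrightarrow> commutes W A (perm_op d n \<sigma>)"
  shows "commutes W M A"
proof -
  let ?S = "{\<sigma>. \<sigma> permutes {1..d}}"
  define x :: "(nat \<Rightarrow> nat) \<times> (nat \<Rightarrow> nat) \<Rightarrow> nat \<Rightarrow> nat op"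
    where "x = (\<lambda>p r. op_unit (fst p r) (snd p r))"
  have inv: "A (X \<circ> \<sigma>) (Y \<circ> \<sigma>) = A X Y" if \<sigma>: "\<sigma> permutes {1..d}" and XY: "X \<in> W" "Y \<in> W" for X Y \<sigma>
  proof -
    have Y\<sigma>: "Y \<circ> \<sigma> \<in> W" "X \<circ> \<sigma> \<in> W" using multi_idx_comp \<sigma> XY by auto
    have "op_mult W A (perm_op d n \<sigma>) X (Y \<circ> \<sigma>) = (\<Sum>Z\<in>W. if Z = Y then A X Y else 0)"
      unfolding op_mult_def perm_op_def comp_inv_eq_iff[OF \<sigma>]
    proof (rule sum.cong[OF refl])
      fix Z assume "Z \<in> W"
      have "Y \<circ> \<sigma> = Z \<circ> \<sigma> \<longleftrightarrow> Z = Y"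
        using permutes_surj[OF \<sigma>] by (metis surj_fun_eq)
      then show "A X Z * (if Y \<circ> \<sigma> \<in> W \<and> Z \<in> W \<and> Y \<circ> \<sigma> = Z \<circ> \<sigma> then 1 else 0) = (if Z = Y then A X Y else 0)"
        using Y\<sigma> XY by auto
    qed
    then have "op_mult W A (perm_op d n \<sigma>) X (Y \<circ> \<sigma>) = A X Y"
      using XY finite_multi_idx[of d n] by simp
    moreover have "op_mult W (perm_op d n \<sigma>) A X (Y \<circ> \<sigma>) = (\<Sum>Z\<in>W. if Z = X \<circ> \<sigma> then A (X \<circ> \<sigma>) (Y \<circ> \<sigma>) else 0)"
      unfolding op_mult_def perm_op_def comp_inv_eq_iff[OF \<sigma>] using XY Y\<sigma> by (intro sum.cong refl) auto
    then have "op_mult W (perm_op d n \<sigma>) A X (Y \<circ> \<sigma>) = A (X \<circ> \<sigma>) (Y \<circ> \<sigma>)"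
      using Y\<sigma> finite_multi_idx[of d n] by simp
    ultimately show ?thesis using perm[OF \<sigma>] unfolding commutes_def by metis
  qed
  have entry: "sym_op d (x (X, Y)) C D = (\<Sum>\<sigma>\<in>?S. if C = X \<circ> \<sigma> \<and> D = Y \<circ> \<sigma> then 1 else 0)"
    if XY: "X \<in> W" "Y \<in> W" for X Y C D
    unfolding sym_op_def
  proof (rule sum.cong[OF refl])
    fix \<sigma> assume "\<sigma> \<in> ?S"
    then have \<sigma>: "\<sigma> permutes {1..d}" by simp
    have "tensor_op d n (\<lambda>r. if \<sigma> r \<le> d then x (X, Y) (\<sigma> r) else op_one {1..n}) = mat_unit d n (X \<circ> \<sigma>) (Y \<circ> \<sigma>)"
      unfolding mat_unit_def using permutes_in_image[OF \<sigma>] by (intro tensor_op_cong) (auto simp: x_def)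
    also have "\<dots> = op_unit (X \<circ> \<sigma>) (Y \<circ> \<sigma>)" using multi_idx_comp XY \<sigma> by (intro mat_unit_eq) auto
    finally show "1 * tensor_op d n (\<lambda>r. if \<sigma> r \<le> d then x (X, Y) (\<sigma> r) else op_one {1..n}) C D =
        (if C = X \<circ> \<sigma> \<and> D = Y \<circ> \<sigma> then 1 else 0)"
      by (simp add: op_unit_def)
  qed
  have eq: "A = (\<lambda>C D. inverse (fact d) * (\<Sum>p\<in>W\<times>W. A (fst p) (snd p) * sym_op d (x p) C D))"
  proof (intro ext)
    fix C D
    have "(\<Sum>p\<in>W\<times>W. A (fst p) (snd p) * sym_op d (x p) C D) =
        (\<Sum>p\<in>W\<times>W. \<Sum>\<sigma>\<in>?S. if C = fst p \<circ> \<sigma> \<and> D = snd p \<circ> \<sigma> then A (fst p) (snd p) else 0)"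
    proof (rule sum.cong[OF refl])
      fix p assume p: "p \<in> W \<times> W"
      then have "sym_op d (x p) C D = (\<Sum>\<sigma>\<in>?S. if C = fst p \<circ> \<sigma> \<and> D = snd p \<circ> \<sigma> then 1 else 0)"
        using entry[of "fst p" "snd p"] by auto
      then show "A (fst p) (snd p) * sym_op d (x p) C D =
          (\<Sum>\<sigma>\<in>?S. if C = fst p \<circ> \<sigma> \<and> D = snd p \<circ> \<sigma> then A (fst p) (snd p) else 0)"
        by (simp only: sum_distrib_left) (auto intro!: sum.cong)
    qed
    also have "\<dots> = (\<Sum>\<sigma>\<in>?S. \<Sum>p\<in>W\<times>W. if C = fst p \<circ> \<sigma> \<and> D = snd p \<circ> \<sigma> then A (fst p) (snd p) else 0)"
      by (rule sum.swap)
    also have "\<dots> = (\<Sum>\<sigma>\<in>?S. A C D)"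
    proof (rule sum.cong[OF refl])
      fix \<sigma> assume "\<sigma> \<in> ?S"
      then have \<sigma>: "\<sigma> permutes {1..d}" and \<sigma>': "inv \<sigma> permutes {1..d}" using permutes_inv by auto
      have eq: "C = X \<circ> \<sigma> \<longleftrightarrow> X = C \<circ> inv \<sigma>" for C X :: "nat \<Rightarrow> nat"
        using comp_inv_eq_iff[OF \<sigma>, of X C] by auto
      have "(\<Sum>p\<in>W\<times>W. if C = fst p \<circ> \<sigma> \<and> D = snd p \<circ> \<sigma> then A (fst p) (snd p) else 0) =
          (\<Sum>p\<in>W\<times>W. if p = (C \<circ> inv \<sigma>, D \<circ> inv \<sigma>) then A (C \<circ> inv \<sigma>) (D \<circ> inv \<sigma>) else 0)"
        by (intro sum.cong refl) (auto simp: eq)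
      also have "\<dots> = (if C \<circ> inv \<sigma> \<in> W \<and> D \<circ> inv \<sigma> \<in> W then A (C \<circ> inv \<sigma>) (D \<circ> inv \<sigma>) else 0)"
        by (subst sum.delta) (auto simp: finite_multi_idx)
      also have "\<dots> = A C D"
      proof (cases "C \<in> W \<and> D \<in> W")
        case True
        then show ?thesis using multi_idx_comp[OF _ \<sigma>'] inv[OF \<sigma>'] by auto
      next
        case False
        have "\<not> (C \<circ> inv \<sigma> \<in> W \<and> D \<circ> inv \<sigma> \<in> W)"
        proof
          assume "C \<circ> inv \<sigma> \<in> W \<and> D \<circ> inv \<sigma> \<in> W"
          then have "(C \<circ> inv \<sigma>) \<circ> \<sigma> \<in> W \<and> (D \<circ> inv \<sigma>) \<circ> \<sigma> \<in> W" using multi_idx_comp[OF _ \<sigma>] by blast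
          then show False using False permutes_inv_o(2)[OF \<sigma>] by (simp add: comp_assoc)
        qed
        moreover have "A C D = 0" using A False by (auto simp: ops_def)
        ultimately show ?thesis by (simp only: if_False)
      qed
      finally show "(\<Sum>p\<in>W\<times>W. if C = fst p \<circ> \<sigma> \<and> D = snd p \<circ> \<sigma> then A (fst p) (snd p) else 0) = A C D" .
    qed
    also have "\<dots> = fact d * A C D"
      using card_permutations[of "{1..d}" d] by simp
    finally show "A C D = inverse (fact d) * (\<Sum>p\<in>W\<times>W. A (fst p) (snd p) * sym_op d (x p) C D)" by simp
  qed
  show ?thesis by (subst eq) (intro commutes_scale commutes_sum commutes_sym_op order_refl)
qed

text \<open>Schur--Weyl duality for the unitary group.\<close>

lemma unitary_commutant_in_span: "M \<in> tensor_span d n"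
  by (rule bicommutant[OF commutes_symmetric M])

end

section \<open>Integration over the unitary group\<close>

lemma ctranspose_unitary: "V \<in> unitary_group \<Longrightarrow> ctranspose V \<in> unitary_group"
proof -
  have "ctranspose (ctranspose V) = V" by (simp add: ctranspose_def Finite_Cartesian_Product.vec_eq_iff)
  then show "V \<in> unitary_group \<Longrightarrow> ctranspose V \<in> unitary_group" by (simp add: unitary_group_def)
qed

lemma ctranspose_mult: "ctranspose (A ** B) = ctranspose B ** ctranspose A"
  by (simp add: ctranspose_def matrix_matrix_mult_def Finite_Cartesian_Product.vec_eq_iff mult.commute)

lemma unitary_group_mult:
  assumes "V \<in> unitary_group" "U \<in> unitary_group"
  shows "V ** U \<in> unitary_group"
proof -
  have "(V ** U) ** ctranspose (V ** U) = V ** (U ** ctranspose U) ** ctranspose V"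
    "ctranspose (V ** U) ** (V ** U) = ctranspose U ** (ctranspose V ** V) ** U"
    by (simp_all only: ctranspose_mult matrix_mul_assoc)
  then show ?thesis using assms by (simp add: unitary_group_def)
qed

lemma haar_space:
  assumes "normalized_haar \<mu>"
  shows "space \<mu> = unitary_group"
  using assms sets_eq_imp_space_eq[of \<mu> "restrict_space borel unitary_group"]
  by (simp add: normalized_haar_def space_restrict_space)

lemma haar_measurable:
  fixes f :: "complex^'n^'n \<Rightarrow> 'a::topological_space"
  assumes "normalized_haar \<mu>" "continuous_on UNIV f"
  shows "f \<in> borel_measurable \<mu>"
proof -
  have "f \<in> borel_measurable (restrict_space borel unitary_group)"
    by (rule borel_measurable_continuous_on_restrict[OF continuous_on_subset[OF assms(2)]]) simp
  moreover have "sets \<mu> = sets (restrict_space borel unitary_group)"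
    using assms(1) by (simp add: normalized_haar_def)
  ultimately show ?thesis by (subst measurable_cong_sets[OF _ refl])
qed

lemma continuous_on_left_mult: "continuous_on A (\<lambda>U :: complex^'n^'n. V ** U)"
  unfolding matrix_matrix_mult_def by (intro continuous_intros)

text \<open>The measure is invariant under \<open>V\<close> in the sense of images of sets; preimages are images under the
  inverse \<open>V\<^sup>*\<close>.\<close>

lemma haar_translation:
  fixes \<mu> :: "(complex^'n^'n) measure" and f :: "complex^'n^'n \<Rightarrow> complex"
  assumes haar: "normalized_haar \<mu>" and V: "V \<in> unitary_group" and f: "f \<in> borel_measurable \<mu>"
  shows "(LINT U|\<mu>. f (V ** U)) = (LINT U|\<mu>. f U)"
proof -
  let ?g = "\<lambda>U. V ** U"
  have sets: "sets \<mu> = sets (restrict_space borel unitary_group)" using haar by (simp add: normalized_haar_def)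
  have "?g \<in> measurable (restrict_space borel unitary_group) (restrict_space borel unitary_group)"
  proof (rule measurable_restrict_space2)
    show "?g \<in> space (restrict_space borel unitary_group) \<rightarrow> unitary_group"
      using unitary_group_mult[OF V] by (auto simp: space_restrict_space)
    show "?g \<in> measurable (restrict_space borel unitary_group) borel"
      by (rule borel_measurable_continuous_on_restrict[OF continuous_on_left_mult])
  qed
  then have g: "?g \<in> measurable \<mu> \<mu>"
    using measurable_cong_sets[OF sets sets] by simp
  have cV: "ctranspose V ** V = Finite_Cartesian_Product.mat 1" "V ** ctranspose V = Finite_Cartesian_Product.mat 1" using V by (auto simp: unitary_group_def)
  have "distr \<mu> \<mu> ?g = \<mu>"
  proof (rule measure_eqI)
    fix A assume "A \<in> sets (distr \<mu> \<mu> ?g)"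
    then have A: "A \<in> sets \<mu>" by simp
    have AG: "A \<subseteq> unitary_group" using sets.sets_into_space[OF A] haar_space[OF haar] by simp
    have "?g -` A \<inter> space \<mu> = (\<lambda>U. ctranspose V ** U) ` A"
    proof (intro equalityI subsetI)
      fix U assume "U \<in> ?g -` A \<inter> space \<mu>"
      moreover have "U = ctranspose V ** (V ** U)" by (simp add: matrix_mul_assoc cV)
      ultimately show "U \<in> (\<lambda>U. ctranspose V ** U) ` A" by blast
    next
      fix U assume "U \<in> (\<lambda>U. ctranspose V ** U) ` A"
      then obtain U' where U': "U = ctranspose V ** U'" "U' \<in> A" by blast
      have "V ** U = U'" by (simp add: U'(1) matrix_mul_assoc cV)
      then show "U \<in> ?g -` A \<inter> space \<mu>"
        using U' AG unitary_group_mult[OF ctranspose_unitary[OF V], of U'] haar_space[OF haar] by auto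
    qed
    then have "emeasure (distr \<mu> \<mu> ?g) A = emeasure \<mu> ((\<lambda>U. ctranspose V ** U) ` A)"
      using emeasure_distr[OF g A] by simp
    also have "\<dots> = emeasure \<mu> A"
      using haar A ctranspose_unitary[OF V] by (simp add: normalized_haar_def)
    finally show "emeasure (distr \<mu> \<mu> ?g) A = emeasure \<mu> A" .
  qed simp
  then have "(LINT U|\<mu>. f U) = (LINT U|distr \<mu> \<mu> ?g. f U)" by simp
  also have "\<dots> = (LINT U|\<mu>. f (V ** U))" by (rule integral_distr[OF g f])
  finally show ?thesis ..
qed

definition coordinate_op :: "(nat \<Rightarrow> 'n) \<Rightarrow> complex^'n^'n \<Rightarrow> nat op"
  where "coordinate_op label U x y = U $ label x $ label y"

definition tensor_power :: "nat \<Rightarrow> nat \<Rightarrow> nat op \<Rightarrow> (nat \<Rightarrow> nat) op"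
  where "tensor_power d n u = tensor_op d n (\<lambda>r. u)"

lemma tensor_power_mult:
  "op_mult (multi_idx d n) (tensor_power d n u) (tensor_power d n v) = tensor_power d n (op_mult {1..n} u v)"
  by (simp add: tensor_power_def op_mult_tensor_op)

lemma tensor_power_adj: "op_adj (tensor_power d n u) = tensor_power d n (op_adj u)"
  by (auto simp: fun_eq_iff op_adj_def tensor_power_def tensor_op_def)

lemma tensor_power_cong:
  assumes "\<And>x y. x \<in> {1..n} \<Longrightarrow> y \<in> {1..n} \<Longrightarrow> u x y = v x y"
  shows "tensor_power d n u = tensor_power d n v"
  unfolding tensor_power_def using assms by (intro tensor_op_cong) auto

lemma tensor_power_unitary:
  assumes "unitary_op n u"
  shows "op_mult (multi_idx d n) (op_adj (tensor_power d n u)) (tensor_power d n u) = op_one (multi_idx d n)"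
proof -
  have "tensor_power d n (op_mult {1..n} (op_adj u) u) = tensor_power d n (op_one {1..n})"
    using assms by (intro tensor_power_cong) (simp add: op_mult_def op_adj_def unitary_op_def op_one_def)
  then show ?thesis
    unfolding tensor_power_adj tensor_power_mult by (simp only: tensor_power_def tensor_op_one)
qed

lemma perm_op_commutes_tensor_power:
  assumes \<sigma>: "\<sigma> permutes {1..d}"
  shows "commutes (multi_idx d n) (tensor_power d n u) (perm_op d n \<sigma>)"
  unfolding commutes_def
proof (intro ext)
  fix X Y
  let ?W = "multi_idx d n" and ?T = "tensor_power d n u"
  note \<sigma>' = permutes_inv[OF \<sigma>]
  show "op_mult ?W ?T (perm_op d n \<sigma>) X Y = op_mult ?W (perm_op d n \<sigma>) ?T X Y"
  proof (cases "X \<in> ?W \<and> Y \<in> ?W")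
    case True
    then have XY: "X \<circ> \<sigma> \<in> ?W" "Y \<circ> inv \<sigma> \<in> ?W" using multi_idx_comp \<sigma> \<sigma>' by auto
    have "op_mult ?W ?T (perm_op d n \<sigma>) X Y = (\<Sum>Z\<in>?W. if Z = Y \<circ> inv \<sigma> then ?T X (Y \<circ> inv \<sigma>) else 0)"
      unfolding op_mult_def perm_op_def using True by (intro sum.cong refl) auto
    also have "\<dots> = ?T X (Y \<circ> inv \<sigma>)" using XY finite_multi_idx[of d n] by simp
    also have "\<dots> = (\<Prod>r=1..d. u (X r) (Y (inv \<sigma> r)))"
      using True XY by (simp add: tensor_power_def tensor_op_def)
    also have "\<dots> = (\<Prod>r=1..d. u (X (\<sigma> r)) (Y r))"
      using prod.permute[OF \<sigma>, of "\<lambda>r. u (X r) (Y (inv \<sigma> r))"] permutes_inverses(2)[OF \<sigma>]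
      by (simp add: o_def)
    also have "\<dots> = ?T (X \<circ> \<sigma>) Y" using True XY by (simp add: tensor_power_def tensor_op_def)
    also have "\<dots> = (\<Sum>Z\<in>?W. if Z = X \<circ> \<sigma> then ?T (X \<circ> \<sigma>) Y else 0)"
      using XY finite_multi_idx[of d n] by simp
    also have "\<dots> = op_mult ?W (perm_op d n \<sigma>) ?T X Y"
      unfolding op_mult_def perm_op_def comp_inv_eq_iff[OF \<sigma>] using True by (intro sum.cong refl) auto
    finally show ?thesis .
  next
    case False
    then show ?thesis
      by (auto simp: op_mult_def perm_op_def tensor_power_def tensor_op_def intro!: sum.neutral)
  qed
qed

lemma tensor_rep_commutes_tensor_power:
  "commutes (multi_idx d n) (tensor_power d n u) (tensor_rep d n x)"
proof -
  have eq: "tensor_rep d n x = (\<lambda>X Y. \<Sum>\<sigma>\<in>{\<sigma>. \<sigma> permutes {1..d}}. x \<sigma> * perm_op d n \<sigma> X Y)"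
    by (intro ext) (simp add: tensor_rep_def lin_ext_def)
  show ?thesis unfolding eq by (intro commutes_sum perm_op_commutes_tensor_power) simp
qed

text \<open>Tensor powers commute with permutations of the factors.\<close>

lemma conjugate_tensor_rep:
  assumes "unitary_op n u"
  shows "op_mult (multi_idx d n) (op_adj (tensor_power d n u))
    (op_mult (multi_idx d n) (tensor_rep d n x) (tensor_power d n u)) = tensor_rep d n x"
proof -
  let ?W = "multi_idx d n" and ?T = "tensor_power d n u" and ?P = "tensor_rep d n x"
  have "op_mult ?W (op_adj ?T) (op_mult ?W ?P ?T) = op_mult ?W (op_one ?W) ?P"
    using tensor_rep_commutes_tensor_power[of d n u x] tensor_power_unitary[OF assms, of d]
    unfolding commutes_def by (metis op_mult_assoc)
  also have "\<dots> = ?P"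
  proof (intro ext)
    fix X Y
    show "op_mult ?W (op_one ?W) ?P X Y = ?P X Y"
    proof (cases "X \<in> ?W \<and> Y \<in> ?W")
      case True
      then show ?thesis using op_mult_one[OF finite_multi_idx] by simp
    next
      case False
      then show ?thesis
        using tensor_rep_outside[of X d n Y] by (auto simp: op_mult_def op_one_def tensor_rep_outside intro!: sum.neutral)
    qed
  qed
  finally show ?thesis .
qed

locale unitary_integral =
  fixes d n :: nat and label :: "nat \<Rightarrow> 'n::finite" and \<mu> :: "(complex^'n^'n) measure"
  assumes label: "bij_betw label {1..n} (UNIV :: 'n set)" and haar: "normalized_haar \<mu>"
begin

abbreviation "co \<equiv> coordinate_op label"
abbreviation "B \<equiv> multi_idx d n"
abbreviation "TP U \<equiv> tensor_power d n (co U)"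

lemma sum_label: "(\<Sum>k\<in>UNIV. f k) = (\<Sum>z\<in>{1..n}. f (label z))"
  by (rule sum.reindex_bij_betw[OF label, symmetric])

lemma label_eq: "x \<in> {1..n} \<Longrightarrow> y \<in> {1..n} \<Longrightarrow> label x = label y \<longleftrightarrow> x = y"
  by (rule inj_on_eq_iff[OF bij_betw_imp_inj_on[OF label]])

lemma unitary_op_coordinates:
  assumes "U \<in> unitary_group"
  shows "unitary_op n (co U)"
  unfolding unitary_op_def
proof (intro ballI conjI)
  fix x y assume xy: "x \<in> {1..n}" "y \<in> {1..n}"
  have 1: "U ** ctranspose U = Finite_Cartesian_Product.mat 1" and 2: "ctranspose U ** U = Finite_Cartesian_Product.mat 1"
    using assms by (auto simp: unitary_group_def)
  have "(\<Sum>z\<in>{1..n}. co U x z * cnj (co U y z)) = (U ** ctranspose U) $ label x $ label y"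
    by (simp add: matrix_matrix_mult_def ctranspose_def sum_label coordinate_op_def)
  then show "(\<Sum>z\<in>{1..n}. co U x z * cnj (co U y z)) = (if x = y then 1 else 0)"
    unfolding 1 using label_eq[OF xy] by (simp add: Finite_Cartesian_Product.mat_def)
  have "(\<Sum>z\<in>{1..n}. cnj (co U z x) * co U z y) = (ctranspose U ** U) $ label x $ label y"
    by (simp add: matrix_matrix_mult_def ctranspose_def sum_label coordinate_op_def)
  then show "(\<Sum>z\<in>{1..n}. cnj (co U z x) * co U z y) = (if x = y then 1 else 0)"
    unfolding 2 using label_eq[OF xy] by (simp add: Finite_Cartesian_Product.mat_def)
qed

lemma ex_unitary_with_coordinates:
  assumes u: "unitary_op n u"
  shows "\<exists>V\<in>unitary_group. \<forall>x\<in>{1..n}. \<forall>y\<in>{1..n}. co V x y = u x y"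
proof -
  define l where "l = the_inv_into {1..n} label"
  have inj: "inj_on label {1..n}" and surj: "label ` {1..n} = UNIV" using label by (auto simp: bij_betw_def)
  have l: "l (label x) = x" if "x \<in> {1..n}" for x
    unfolding l_def by (rule the_inv_into_f_f[OF inj that])
  define V :: "complex^'n^'n" where "V = (\<chi> i j. u (l i) (l j))"
  have co: "co V x y = u x y" if "x \<in> {1..n}" "y \<in> {1..n}" for x y
    using that by (simp add: coordinate_op_def V_def l)
  have "(V ** ctranspose V) $ label x $ label y = Finite_Cartesian_Product.mat 1 $ label x $ label y \<and>
      (ctranspose V ** V) $ label x $ label y = Finite_Cartesian_Product.mat 1 $ label x $ label y"
    if xy: "x \<in> {1..n}" "y \<in> {1..n}" for x y
  proof -
    have "(V ** ctranspose V) $ label x $ label y = (\<Sum>z\<in>{1..n}. u x z * cnj (u y z))"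
      "(ctranspose V ** V) $ label x $ label y = (\<Sum>z\<in>{1..n}. cnj (u z x) * u z y)"
      using xy by (simp_all add: matrix_matrix_mult_def ctranspose_def sum_label V_def l)
    then show ?thesis using u xy label_eq[OF xy] by (simp add: unitary_op_def Finite_Cartesian_Product.mat_def)
  qed
  then have "(V ** ctranspose V) $ i $ j = Finite_Cartesian_Product.mat 1 $ i $ j"
    "(ctranspose V ** V) $ i $ j = Finite_Cartesian_Product.mat 1 $ i $ j" for i j
    using surj by (metis UNIV_I imageE)+
  then have "V \<in> unitary_group"
    unfolding unitary_group_def by (simp add: Finite_Cartesian_Product.vec_eq_iff)
  then show ?thesis using co by blast
qed

lemma coordinate_op_mult: "co (V ** U) x y = op_mult {1..n} (co V) (co U) x y"
  by (simp add: coordinate_op_def op_mult_def matrix_matrix_mult_def sum_label)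

lemma tensor_power_group_mult: "TP (V ** U) = op_mult B (TP V) (TP U)"
  unfolding tensor_power_mult by (intro tensor_power_cong coordinate_op_mult)

lemma cmod_coordinate_le:
  assumes "U \<in> unitary_group" "x \<in> {1..n}" "y \<in> {1..n}"
  shows "cmod (co U x y) \<le> 1"
proof -
  have "of_real (\<Sum>z\<in>{1..n}. (cmod (co U x z))\<^sup>2) = (\<Sum>z\<in>{1..n}. co U x z * cnj (co U x z))"
    by (simp add: complex_norm_square[symmetric] of_real_sum del: of_real_power)
  also have "\<dots> = of_real 1" using unitary_op_coordinates[OF assms(1)] assms(2) by (simp add: unitary_op_def)
  finally have "(\<Sum>z\<in>{1..n}. (cmod (co U x z))\<^sup>2) = 1" by (simp only: of_real_eq_iff)
  moreover have "(cmod (co U x y))\<^sup>2 \<le> (\<Sum>z\<in>{1..n}. (cmod (co U x z))\<^sup>2)"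
    using assms(3) by (intro member_le_sum) auto
  ultimately have "(cmod (co U x y))\<^sup>2 \<le> 1\<^sup>2" by simp
  then show ?thesis by (rule power2_le_imp_le) simp
qed

lemma cmod_tensor_power_le:
  assumes "U \<in> unitary_group"
  shows "cmod (TP U X Y) \<le> 1"
proof (cases "X \<in> B \<and> Y \<in> B")
  case True
  then have "cmod (TP U X Y) = (\<Prod>r=1..d. cmod (co U (X r) (Y r)))"
    by (simp add: tensor_power_def tensor_op_def prod_norm)
  also have "\<dots> \<le> 1"
    using True cmod_coordinate_le[OF assms] multi_idx_range[of _ d n] by (intro prod_le_1) auto
  finally show ?thesis .
qed (auto simp: tensor_power_def tensor_op_def)

lemma continuous_tensor_power: "continuous_on A (\<lambda>U. TP U X Y)"
proof (cases "X \<in> B \<and> Y \<in> B")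
  case True
  then show ?thesis
    unfolding tensor_power_def tensor_op_def coordinate_op_def by (auto intro!: continuous_intros)
qed (auto simp: tensor_power_def tensor_op_def)

lemma integrand_measurable: "(\<lambda>U. TP U X J * cnj (TP U Y L)) \<in> borel_measurable \<mu>"
  by (intro haar_measurable[OF haar] continuous_intros continuous_tensor_power)

lemma integrable_integrand: "integrable \<mu> (\<lambda>U. TP U X J * cnj (TP U Y L))"
proof -
  interpret prob_space \<mu> using haar by (simp add: normalized_haar_def)
  show ?thesis
  proof (rule integrable_const_bound)
    show "AE U in \<mu>. norm (TP U X J * cnj (TP U Y L)) \<le> 1"
    proof (rule AE_I2)
      fix U assume "U \<in> space \<mu>"
      then have "U \<in> unitary_group" using haar_space[OF haar] by simp
      then show "norm (TP U X J * cnj (TP U Y L)) \<le> 1"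
        using cmod_tensor_power_le by (simp add: norm_mult mult_le_one)
    qed
  qed (rule integrand_measurable)
qed

text \<open>The entries of \<open>\<integral> U\<^sup>\<otimes>\<^sup>d e\<^sub>J\<^sub>L (U\<^sup>\<otimes>\<^sup>d)\<^sup>* d\<mu>\<close>.\<close>

definition twirl :: "(nat \<Rightarrow> nat) \<Rightarrow> (nat \<Rightarrow> nat) \<Rightarrow> (nat \<Rightarrow> nat) op"
  where "twirl J L X Y = (LINT U|\<mu>. TP U X J * cnj (TP U Y L))"

lemma twirl_ops: "twirl J L \<in> ops B"
  unfolding ops_def
proof (intro CollectI allI impI conjI)
  fix X Y assume ne: "twirl J L X Y \<noteq> 0"
  have "twirl J L X Y = 0" if "X \<notin> B \<or> Y \<notin> B"
  proof -
    have "TP U X J * cnj (TP U Y L) = 0" for U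
      using that by (auto simp: tensor_power_def tensor_op_def)
    then show ?thesis unfolding twirl_def by (simp only: Bochner_Integration.integral_zero)
  qed
  then show "X \<in> B" "Y \<in> B" using ne by blast+
qed

lemma twirl_conjugate:
  assumes V: "V \<in> unitary_group"
  shows "twirl J L = op_mult B (op_mult B (TP V) (twirl J L)) (op_adj (TP V))"
proof (intro ext)
  fix X Y
  have "twirl J L X Y = (LINT U|\<mu>. TP (V ** U) X J * cnj (TP (V ** U) Y L))"
    unfolding twirl_def by (rule haar_translation[OF haar V integrand_measurable, symmetric])
  also have "\<dots> = (LINT U|\<mu>. (\<Sum>Z\<in>B. \<Sum>Z'\<in>B. TP V X Z * cnj (TP V Y Z') * (TP U Z J * cnj (TP U Z' L))))"
    unfolding tensor_power_group_mult op_mult_def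
    by (simp add: sum_product algebra_simps)
  also have "\<dots> = (\<Sum>Z\<in>B. \<Sum>Z'\<in>B. TP V X Z * cnj (TP V Y Z') * twirl J L Z Z')"
    unfolding twirl_def
    by (simp only: Bochner_Integration.integral_sum Bochner_Integration.integrable_sum
        integrable_mult_right integrable_integrand integral_mult_right_zero)
  also have "\<dots> = (\<Sum>Z'\<in>B. \<Sum>Z\<in>B. TP V X Z * cnj (TP V Y Z') * twirl J L Z Z')" by (rule sum.swap)
  also have "\<dots> = op_mult B (op_mult B (TP V) (twirl J L)) (op_adj (TP V)) X Y"
    by (simp add: op_mult_def op_adj_def sum_distrib_left sum_distrib_right algebra_simps)
  finally show "twirl J L X Y = op_mult B (op_mult B (TP V) (twirl J L)) (op_adj (TP V)) X Y" .
qed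

lemma twirl_commutes:
  assumes u: "unitary_op n u"
  shows "commutes B (twirl J L) (tensor_op d n (\<lambda>r. u))"
proof -
  obtain V where V: "V \<in> unitary_group" "\<forall>x\<in>{1..n}. \<forall>y\<in>{1..n}. co V x y = u x y"
    using ex_unitary_with_coordinates[OF u] by blast
  have TV: "TP V = tensor_op d n (\<lambda>r. u)"
    using V(2) unfolding tensor_power_def by (intro tensor_op_cong) simp
  have unit: "op_mult B (op_adj (TP V)) (TP V) = op_one B"
    by (rule tensor_power_unitary[OF unitary_op_coordinates[OF V(1)]])
  have "op_mult B (twirl J L) (TP V) =
      op_mult B (op_mult B (TP V) (twirl J L)) (op_mult B (op_adj (TP V)) (TP V))"
    by (subst twirl_conjugate[OF V(1)]) (rule op_mult_assoc)
  also have "\<dots> = op_mult B (TP V) (twirl J L)"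
  proof (intro ext)
    fix X Y
    show "op_mult B (op_mult B (TP V) (twirl J L)) (op_mult B (op_adj (TP V)) (TP V)) X Y =
        op_mult B (TP V) (twirl J L) X Y"
    proof (cases "X \<in> B \<and> Y \<in> B")
      case True
      then show ?thesis unfolding unit using op_mult_one(2)[OF finite_multi_idx] by simp
    next
      case False
      have "X \<notin> B \<Longrightarrow> TP V X Z = 0" "Y \<notin> B \<Longrightarrow> twirl J L Z Y = 0" for Z
        using twirl_ops[of J L] by (auto simp: ops_def tensor_power_def tensor_op_def)
      then show ?thesis
        unfolding unit using False by (auto simp: op_mult_def op_one_def intro!: sum.neutral)
    qed
  qed
  finally show ?thesis unfolding commutes_def TV .
qed

text \<open>Under the integral, the unitaries can be moved to the second argument, which they fix under
  conjugation.\<close>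

lemma hs_inner_twirl:
  assumes "J \<in> B" "L \<in> B"
  shows "hs_inner B (twirl J L) (tensor_rep d n x) = cnj (tensor_rep d n x J L)"
proof -
  interpret prob_space \<mu> using haar by (simp add: normalized_haar_def)
  let ?P = "tensor_rep d n x"
  have "hs_inner B (twirl J L) ?P =
      (LINT U|\<mu>. (\<Sum>X\<in>B. \<Sum>Y\<in>B. TP U X J * cnj (TP U Y L) * cnj (?P X Y)))"
    unfolding hs_inner_eq twirl_def
    by (simp only: Bochner_Integration.integral_sum Bochner_Integration.integrable_sum
        integrable_mult_left integrable_integrand integral_mult_left_zero)
  also have "\<dots> = (LINT U|\<mu>. cnj (?P J L))"
  proof (rule Bochner_Integration.integral_cong[OF refl])
    fix U assume "U \<in> space \<mu>"
    then have U: "unitary_op n (co U)" using haar_space[OF haar] unitary_op_coordinates by simp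
    have "op_mult B (op_adj (TP U)) (op_mult B ?P (TP U)) J L = ?P J L"
      by (simp only: conjugate_tensor_rep[OF U])
    then have "cnj (?P J L) = cnj (\<Sum>X\<in>B. \<Sum>Y\<in>B. cnj (TP U X J) * (?P X Y * TP U Y L))"
      by (simp add: op_mult_def op_adj_def sum_distrib_left)
    then show "(\<Sum>X\<in>B. \<Sum>Y\<in>B. TP U X J * cnj (TP U Y L) * cnj (?P X Y)) = cnj (?P J L)"
      by (simp add: algebra_simps)
  qed
  also have "\<dots> = cnj (?P J L)" by (simp add: prob_space)
  finally show ?thesis .
qed

lemma twirl_expansion:
  assumes "J \<in> B" "L \<in> B"
  shows "twirl J L X Y = (\<Sum>i\<in>unit_index d. cnj (tensor_unit d n i J L) * tensor_unit d n i X Y /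
    hs_inner B (tensor_unit d n i) (tensor_unit d n i))"
proof -
  have "twirl J L \<in> tensor_span d n"
    by (rule unitary_commutant_in_span[OF twirl_ops twirl_commutes])
  then obtain c where "\<And>X Y. twirl J L X Y = (\<Sum>i\<in>unit_index d. c i * tensor_unit d n i X Y)"
    unfolding tensor_span_def by blast
  from tensor_unit_projection[OF this] show ?thesis
    unfolding hs_inner_twirl[OF assms] .
qed

end

section \<open>The integration formula\<close>

lemma length_young_diagram_le:
  assumes "young_diagram d lam"
  shows "length lam \<le> d"
proof -
  have "(\<Sum>i<length lam. 1) \<le> (\<Sum>i<length lam. lam ! i)"
    using assms by (intro sum_mono) (auto simp: young_diagram_def Suc_le_eq)
  then show ?thesis
    using assms by (simp add: young_diagram_def sum_list_sum_nth lessThan_atLeast0)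
qed

lemma hs_inner_mat_unit:
  assumes "I \<in> multi_idx d n" "J \<in> multi_idx d n"
  shows "hs_inner (multi_idx d n) A (mat_unit d n I J) = A I J"
    and "hs_inner (multi_idx d n) (mat_unit d n I J) A = cnj (A I J)"
proof -
  have "hs_inner (multi_idx d n) A (mat_unit d n I J) =
      (\<Sum>x\<in>multi_idx d n. if x = I then \<Sum>z\<in>multi_idx d n. if z = J then A I J else 0 else 0)"
    unfolding hs_inner_eq mat_unit_eq[OF assms] by (intro sum.cong refl) (auto simp: op_unit_def intro!: sum.cong)
  then show "hs_inner (multi_idx d n) A (mat_unit d n I J) = A I J"
    using assms finite_multi_idx[of d n] by simp
  have "hs_inner (multi_idx d n) (mat_unit d n I J) A =
      (\<Sum>x\<in>multi_idx d n. if x = I then \<Sum>z\<in>multi_idx d n. if z = J then cnj (A I J) else 0 else 0)"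
    unfolding hs_inner_eq mat_unit_eq[OF assms] by (intro sum.cong refl) (auto simp: op_unit_def intro!: sum.cong)
  then show "hs_inner (multi_idx d n) (mat_unit d n I J) A = cnj (A I J)"
    using assms finite_multi_idx[of d n] by simp
qed

text \<open>The summands do not depend on the scaling of \<open>E\<^sub>S\<^sub>,\<^sub>T\<close>, so \<open>E\<^sub>S\<^sub>,\<^sub>T\<close> can be replaced by the matrix unit.\<close>

lemma E_tab_term:
  assumes idx: "(lam, S, T) \<in> unit_index d"
    and IK: "I \<in> multi_idx d n" "K \<in> multi_idx d n" and JL: "J \<in> multi_idx d n" "L \<in> multi_idx d n"
  shows "hs_inner (multi_idx d n) (mat_unit d n J L) (tensor_rep d n (E_tab d lam S T)) *
      hs_inner (multi_idx d n) (tensor_rep d n (E_tab d lam S T)) (mat_unit d n I K) /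
      of_real ((hs_norm (multi_idx d n) (tensor_rep d n (E_tab d lam S T)))\<^sup>2) =
    cnj (tensor_unit d n (lam, S, T) J L) * tensor_unit d n (lam, S, T) I K /
      hs_inner (multi_idx d n) (tensor_unit d n (lam, S, T)) (tensor_unit d n (lam, S, T))"
proof -
  let ?P = "tensor_unit d n (lam, S, T)"
  obtain c where c: "c \<noteq> 0" "E_tab d lam S T = (\<lambda>\<tau>. c * matrix_unit d lam S T \<tau>)"
    using E_tab_eq_matrix_unit[OF idx] by blast
  have E: "tensor_rep d n (E_tab d lam S T) = (\<lambda>X Y. c * ?P X Y)"
    unfolding c(2) tensor_rep_def by (intro ext) (simp add: lin_ext_scale)
  show ?thesis
    unfolding hs_norm_squared hs_inner_mat_unit[OF IK] hs_inner_mat_unit[OF JL]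
      E hs_inner_scale_left hs_inner_scale_right
    using c(1) by simp
qed

theorem theorem17:
  fixes d k n :: nat
    and label :: "nat \<Rightarrow> 'n::finite"
    and \<mu> :: "(complex^'n^'n) measure"
    and I J K L :: "nat \<Rightarrow> nat"
  assumes "1 \<le> d" and "1 \<le> k" and "k \<le> n"
    and "bij_betw label {1..n} (UNIV :: 'n set)"
    and "normalized_haar \<mu>"
    and "I \<in> {1..d} \<rightarrow>\<^sub>E {1..k}" and "J \<in> {1..d} \<rightarrow>\<^sub>E {1..k}"
    and "K \<in> {1..d} \<rightarrow>\<^sub>E {1..k}" and "L \<in> {1..d} \<rightarrow>\<^sub>E {1..k}"
  shows "(LINT U|\<mu>. (\<Prod>r=1..d. U $ label (I r) $ label (J r)) *
                    (\<Prod>r=1..d. cnj (U $ label (K r) $ label (L r)))) =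
    (\<Sum>lam | young_diagram d lam \<and> length lam \<le> min k d. \<Sum>S\<in>Stab lam. \<Sum>T\<in>Stab lam.
      hs_inner (multi_idx d n) (mat_unit d n J L) (tensor_rep d n (E_tab d lam S T)) *
      hs_inner (multi_idx d n) (tensor_rep d n (E_tab d lam S T)) (mat_unit d n I K) /
      of_real ((hs_norm (multi_idx d n) (tensor_rep d n (E_tab d lam S T)))\<^sup>2))"
proof -
  interpret unitary_integral d n label \<mu> by unfold_locales (fact assms(4), fact assms(5))
  let ?t = "\<lambda>lam S T. hs_inner B (mat_unit d n J L) (tensor_rep d n (E_tab d lam S T)) *
      hs_inner B (tensor_rep d n (E_tab d lam S T)) (mat_unit d n I K) /
      of_real ((hs_norm B (tensor_rep d n (E_tab d lam S T)))\<^sup>2)"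
  define f where "f = (\<lambda>i. cnj (tensor_unit d n i J L) * tensor_unit d n i I K /
      hs_inner B (tensor_unit d n i) (tensor_unit d n i))"
  have k: "I \<in> multi_idx d k" "J \<in> multi_idx d k" "K \<in> multi_idx d k" "L \<in> multi_idx d k"
    using assms(6-9) by (simp_all add: multi_idx_def)
  have "multi_idx d k \<subseteq> B"
    unfolding multi_idx_def by (intro PiE_mono) (use assms(3) in auto)
  then have n: "I \<in> B" "J \<in> B" "K \<in> B" "L \<in> B" using k by auto
  have "(LINT U|\<mu>. (\<Prod>r=1..d. U $ label (I r) $ label (J r)) *
      (\<Prod>r=1..d. cnj (U $ label (K r) $ label (L r)))) = twirl J L I K"
    using n by (simp add: twirl_def tensor_power_def tensor_op_def coordinate_op_def)
  also have "\<dots> = (\<Sum>i\<in>unit_index d. f i)"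
    unfolding f_def by (rule twirl_expansion[OF n(2,4)])
  also have "\<dots> = (\<Sum>lam | young_diagram d lam. \<Sum>(S, T)\<in>Stab lam \<times> Stab lam. f (lam, S, T))"
    unfolding unit_index_def
    by (subst sum.Sigma) (auto simp: finite_young_diagrams finite_Stab' intro!: sum.cong)
  also have "\<dots> = (\<Sum>lam | young_diagram d lam. \<Sum>S\<in>Stab lam. \<Sum>T\<in>Stab lam. f (lam, S, T))"
    by (simp add: sum.cartesian_product)
  also have "\<dots> = (\<Sum>lam | young_diagram d lam \<and> length lam \<le> min k d.
      \<Sum>S\<in>Stab lam. \<Sum>T\<in>Stab lam. f (lam, S, T))"
  proof (rule sum.mono_neutral_right[OF finite_young_diagrams])
    show "\<forall>lam\<in>{lam. young_diagram d lam} - {lam. young_diagram d lam \<and> length lam \<le> min k d}.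
        (\<Sum>S\<in>Stab lam. \<Sum>T\<in>Stab lam. f (lam, S, T)) = 0"
    proof (intro ballI sum.neutral)
      fix lam S T
      assume lam: "lam \<in> {lam. young_diagram d lam} - {lam. young_diagram d lam \<and> length lam \<le> min k d}"
        and ST: "S \<in> Stab lam" "T \<in> Stab lam"
      have idx: "(lam, S, T) \<in> unit_index d" using lam ST by (simp add: unit_index_def)
      have "k < length lam" using lam length_young_diagram_le[of d lam] by auto
      then have "tensor_unit d n (lam, S, T) I K = 0"
        using tensor_unit_long_vanishes[OF idx] tensor_rep_restrict[OF assms(3) k(1,3)]
        by (simp add: op_zero_def)
      then show "f (lam, S, T) = 0" by (simp add: f_def)
    qed
  qed auto
  also have "\<dots> = (\<Sum>lam | young_diagram d lam \<and> length lam \<le> min k d. \<Sum>S\<in>Stab lam. \<Sum>T\<in>Stab lam. ?t lam S T)"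
  proof (intro sum.cong refl)
    fix lam S T
    assume "lam \<in> {lam. young_diagram d lam \<and> length lam \<le> min k d}" "S \<in> Stab lam" "T \<in> Stab lam"
    then have idx: "(lam, S, T) \<in> unit_index d" by (simp add: unit_index_def)
    show "f (lam, S, T) = ?t lam S T"
      unfolding f_def by (rule E_tab_term[OF idx n(1,3) n(2,4), symmetric])
  qed
  finally show ?thesis .
qed

end
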